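(* Let $n\geq 1$, let $[m]=(m_1,\ldots,m_n)\in\mathbb{Z}_{>1}^n$ and $[m']=(m_1',\ldots,m_n')\in\mathbb{Z}_{>1}^n$ be two multi-indices for which the subsets $\{m_1,\ldots,m_n\}$ and $\{m_1',\ldots,m_n'\}$ of $\mathbb{Z}$ are distinct, and let $\lambda_1,\ldots,\lambda_r$, where $r\geq 2$, be a collection of pairwise distinct complex numbers. Then the Danielewski varieties $X$ and $X'$ in $\mathbb{C}^{n+2}=\mathrm{Spec}(\mathbb{C}[x_1,\ldots,x_n,y,z])$ with equations $$x_1^{m_1}\cdots x_n^{m_n}z-\prod_{i=1}^r(y-\lambda_i)=0\quad\text{and}\quad x_1^{m_1'}\cdots x_n^{m_n'}z-\prod_{i=1}^r(y-\lambda_i)=0$$ are not isomorphic, but the varieties $X\times\mathbb{C}$ and $X'\times\mathbb{C}$ are isomorphic.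
   Context: Isomorphism means isomorphism of complex algebraic varieties. A Danielewski variety is a nonsingular affine complex variety of dimension at least $2$ which is the total space of a principal homogeneous $\mathbb{C}_+$-bundle (i.e. a Zariski-locally trivial torsor under the additive group) over the scheme $Z_{n,r}$ obtained by gluing $r$ copies of $\mathbb{C}^n$ by the identity along $(\mathbb{C}^* )^n$, for some $n$ and some $r\geq 1$. *)

theory Defs
  imports "HOL-Analysis.Analysis" "HOL-Library.Poly_Mapping"
begin

subsection \<open>Polynomials and affine space\<close>

type_synonym point = "nat \<Rightarrow> complex"
type_synonym cpoly = "(nat \<Rightarrow>\<^sub>0 nat) \<Rightarrow>\<^sub>0 complex"

definition affine_space :: "nat \<Rightarrow> point set" where
  "affine_space N = {..<N} \<rightarrow>\<^sub>E UNIV"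

definition polys :: "nat \<Rightarrow> cpoly set" where
  "polys N = {P. \<forall>e \<in> Poly_Mapping.keys P. Poly_Mapping.keys e \<subseteq> {..<N}}"

definition peval :: "cpoly \<Rightarrow> point \<Rightarrow> complex" where
  "peval P p = (\<Sum>e \<in> Poly_Mapping.keys P. Poly_Mapping.lookup P e * (\<Prod>i \<in> Poly_Mapping.keys e. p i ^ Poly_Mapping.lookup e i))"

definition zariski_closed :: "nat \<Rightarrow> point set \<Rightarrow> bool" where
  "zariski_closed N X \<longleftrightarrow>
     (\<exists>S \<subseteq> polys N. X = {p \<in> affine_space N. \<forall>f \<in> S. peval f p = 0})"

definition zariski_open_in :: "nat \<Rightarrow> point set \<Rightarrow> point set \<Rightarrow> bool" where
  "zariski_open_in N X U \<longleftrightarrow>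
     (\<exists>S \<subseteq> polys N. U = {p \<in> X. \<exists>f \<in> S. peval f p \<noteq> 0})"

text \<open>The product with the affine line; the new coordinate has index \<open>N\<close>.\<close>

definition cylinder :: "nat \<Rightarrow> point set \<Rightarrow> point set" where
  "cylinder N X = {p(N := t) | p t. p \<in> X}"


subsection \<open>Morphisms and isomorphisms of affine varieties\<close>

text \<open>
  For Zariski closed \<open>X\<close> in affine \<open>N\<close>-space and \<open>Y\<close> in affine \<open>M\<close>-space.
\<close>

definition morphism :: "nat \<Rightarrow> point set \<Rightarrow> nat \<Rightarrow> point set \<Rightarrow> (point \<Rightarrow> point) \<Rightarrow> bool" where
  "morphism N X M Y \<phi> \<longleftrightarrow>
     \<phi> \<in> X \<rightarrow> Y \<and> (\<forall>j<M. \<exists>P \<in> polys N. \<forall>p \<in> X. \<phi> p j = peval P p)"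

definition isomorphic :: "nat \<Rightarrow> point set \<Rightarrow> nat \<Rightarrow> point set \<Rightarrow> bool" where
  "isomorphic N X M Y \<longleftrightarrow>
     (\<exists>\<phi> \<psi>. morphism N X M Y \<phi> \<and> morphism M Y N X \<psi> \<and>
        (\<forall>p \<in> X. \<psi> (\<phi> p) = p) \<and> (\<forall>q \<in> Y. \<phi> (\<psi> q) = q))"


subsection \<open>Regular maps on Zariski open pieces\<close>

text \<open>
  For \<open>U\<close> Zariski open in a closed set. Every neighbourhood of a point of \<open>U\<close> contains the
  trace on \<open>U\<close> of a principal open set around that point, and a local fraction \<open>g / h\<close> can be
  expanded so that this trace is the locus where the denominator does not vanish.
\<close>

definition regular_function :: "nat \<Rightarrow> point set \<Rightarrow> (point \<Rightarrow> complex) \<Rightarrow> bool" where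
  "regular_function N U f \<longleftrightarrow>
     (\<forall>p \<in> U. \<exists>g \<in> polys N. \<exists>h \<in> polys N. peval h p \<noteq> 0 \<and>
        (\<forall>q \<in> U. peval h q \<noteq> 0 \<longrightarrow> f q = peval g q / peval h q))"

definition regular_map :: "nat \<Rightarrow> point set \<Rightarrow> nat \<Rightarrow> point set \<Rightarrow> (point \<Rightarrow> point) \<Rightarrow> bool" where
  "regular_map N U M W \<phi> \<longleftrightarrow>
     \<phi> \<in> U \<rightarrow> W \<and> (\<forall>j<M. regular_function N U (\<lambda>p. \<phi> p j))"


subsection \<open>Nonsingular varieties\<close>

definition partial_deriv :: "cpoly \<Rightarrow> nat \<Rightarrow> point \<Rightarrow> complex" where
  "partial_deriv f i p = deriv (\<lambda>t. peval f (p(i := t))) (p i)"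

text \<open>
  Smoothness of dimension \<open>d\<close> by the Jacobian condition: near each of its points, \<open>X\<close> is cut out
  by \<open>N - d\<close> polynomials whose differentials are linearly independent at that point. (Such
  polynomials generate the ideal of \<open>X\<close> near the point.)
\<close>

definition nonsingular_of_dim :: "nat \<Rightarrow> nat \<Rightarrow> point set \<Rightarrow> bool" where
  "nonsingular_of_dim N d X \<longleftrightarrow> d \<le> N \<and>
     (\<forall>p \<in> X. \<exists>f. \<exists>h \<in> polys N.
        (\<forall>k < N - d. f k \<in> polys N) \<and> peval h p \<noteq> 0 \<and>
        {q \<in> X. peval h q \<noteq> 0} =
          {q \<in> affine_space N. peval h q \<noteq> 0 \<and> (\<forall>k < N - d. peval (f k) q = 0)} \<and>
        (\<forall>c :: nat \<Rightarrow> complex.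
           (\<forall>i<N. (\<Sum>k < N - d. c k * partial_deriv (f k) i p) = 0) \<longrightarrow> (\<forall>k < N - d. c k = 0)))"


subsection \<open>The scheme \<open>Z\<close> and Danielewski varieties\<close>

text \<open>
  The closed points of the scheme obtained from \<open>r\<close> copies of affine \<open>n\<close>-space by gluing along
  the torus; \<open>Z_chart n r i\<close> is the open embedding of the \<open>i\<close>-th copy.
\<close>

definition torus :: "nat \<Rightarrow> point set" where
  "torus n = {x \<in> affine_space n. \<forall>i<n. x i \<noteq> 0}"

definition glue_rel :: "nat \<Rightarrow> nat \<Rightarrow> ((nat \<times> point) \<times> (nat \<times> point)) set" where
  "glue_rel n r = {((i, x), (j, y)). i < r \<and> j < r \<and> x \<in> affine_space n \<and> y = x \<and>
                                     (i = j \<or> x \<in> torus n)}"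

definition Z_space :: "nat \<Rightarrow> nat \<Rightarrow> (nat \<times> point) set set" where
  "Z_space n r = ({..<r} \<times> affine_space n) // glue_rel n r"

definition Z_chart :: "nat \<Rightarrow> nat \<Rightarrow> nat \<Rightarrow> point \<Rightarrow> (nat \<times> point) set" where
  "Z_chart n r i x = glue_rel n r `` {(i, x)}"

definition morphism_to_Z ::
  "nat \<Rightarrow> point set \<Rightarrow> nat \<Rightarrow> nat \<Rightarrow> (point \<Rightarrow> (nat \<times> point) set) \<Rightarrow> bool" where
  "morphism_to_Z N X n r \<pi> \<longleftrightarrow> \<pi> \<in> X \<rightarrow> Z_space n r \<and>
     (\<forall>i<r. let U = {p \<in> X. \<pi> p \<in> Z_chart n r i ` affine_space n} in
        zariski_open_in N X U \<and>
        (\<exists>\<xi>. regular_map N U n (affine_space n) \<xi> \<and> (\<forall>p \<in> U. \<pi> p = Z_chart n r i (\<xi> p))))"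

definition additive_action :: "nat \<Rightarrow> point set \<Rightarrow> (complex \<Rightarrow> point \<Rightarrow> point) \<Rightarrow> bool" where
  "additive_action N X \<alpha> \<longleftrightarrow>
     (\<exists>a. morphism (Suc N) (cylinder N X) N X a \<and> (\<forall>p \<in> X. \<forall>t. \<alpha> t p = a (p(N := t)))) \<and>
     (\<forall>p \<in> X. \<alpha> 0 p = p \<and> (\<forall>s t. \<alpha> (s + t) p = \<alpha> s (\<alpha> t p)))"

text \<open>
  Zariski local triviality is required over open sets of the charts, which form a basis of the
  topology of \<open>Z_space n r\<close>. The map \<open>\<Phi>\<close> is an equivariant isomorphism over \<open>V\<close> from the
  trivial bundle, with inverse \<open>\<Psi>\<close>.
\<close>

definition principal_additive_bundle :: "nat \<Rightarrow> point set \<Rightarrow> nat \<Rightarrow> nat \<Rightarrow> bool" where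
  "principal_additive_bundle N X n r \<longleftrightarrow>
     (\<exists>\<pi> \<alpha>. morphism_to_Z N X n r \<pi> \<and> additive_action N X \<alpha> \<and>
        (\<forall>p \<in> X. \<forall>t. \<pi> (\<alpha> t p) = \<pi> p) \<and>
        (\<forall>\<zeta> \<in> Z_space n r. \<exists>i<r. \<exists>V. zariski_open_in n (affine_space n) V \<and>
           \<zeta> \<in> Z_chart n r i ` V \<and>
           (let U = {p \<in> X. \<pi> p \<in> Z_chart n r i ` V} in
            \<exists>\<Phi> \<Psi>. regular_map (Suc n) (cylinder n V) N U \<Phi> \<and>
                  regular_map N U (Suc n) (cylinder n V) \<Psi> \<and>
                  (\<forall>q \<in> cylinder n V. \<Psi> (\<Phi> q) = q) \<and> (\<forall>p \<in> U. \<Phi> (\<Psi> p) = p) \<and>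
                  (\<forall>x \<in> V. \<forall>s t. \<pi> (\<Phi> (x(n := t))) = Z_chart n r i x \<and>
                               \<Phi> (x(n := s + t)) = \<alpha> s (\<Phi> (x(n := t)))))))"

text \<open>
  Irreducibility is not listed: the total space of a principal bundle with irreducible group over
  the irreducible scheme \<open>Z\<close> is irreducible.
\<close>

definition danielewski_variety :: "nat \<Rightarrow> point set \<Rightarrow> bool" where
  "danielewski_variety N X \<longleftrightarrow> zariski_closed N X \<and>
     (\<exists>d\<ge>2. nonsingular_of_dim N d X) \<and>
     (\<exists>n. \<exists>r\<ge>1. principal_additive_bundle N X n r)"


subsection \<open>The hypersurfaces\<close>

text \<open>The coordinates \<open>x\<^sub>1, \<dots>, x\<^sub>n, y, z\<close> have the indices \<open>0, \<dots>, n - 1, n, n + 1\<close>.\<close>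

definition danielewski_hypersurface ::
  "nat \<Rightarrow> (nat \<Rightarrow> nat) \<Rightarrow> nat \<Rightarrow> (nat \<Rightarrow> complex) \<Rightarrow> point set" where
  "danielewski_hypersurface n m r lam =
     {p \<in> affine_space (n + 2).
        (\<Prod>i<n. p i ^ m i) * p (n + 1) - (\<Prod>j<r. (p n - lam j)) = 0}"

end

theory Submission
  imports Defs "HOL-Computational_Algebra.Formal_Laurent_Series" "HOL-Computational_Algebra.Fraction_Field"
begin

text \<open>
  Non-isomorphism. An isomorphism \<open>X \<cong> X'\<close> transports the additive action of \<open>X'\<close> to \<open>X\<close>, that is, it
  moves the generic point of \<open>X\<close> in a one-parameter family with polynomial coordinates in \<open>T\<close>. If
  \<open>x\<^sub>i\<close> were not constant in the family, then some invariant function would have a pole along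
  \<open>x\<^sub>i = 0\<close>; degenerating the family along the torus action with \<open>x\<^sub>i\<close> of weight \<open>1\<close> gives a
  nonconstant family on which \<open>z\<close> is constant. This is impossible, as \<open>x^(m-1)\<close> divides \<open>y'\<close> when
  \<open>x^m z = P(y)\<close> and all \<open>m\<^sub>i\<close> exceed \<open>1\<close>. So the isomorphism covers a polynomial automorphism
  \<open>x \<mapsto> f(x)\<close> of the base and is affine in \<open>y\<close> with constant slope. Comparing
  denominators, \<open>f^m'\<close> divides \<open>x^m\<close>, hence \<open>f\<close> permutes the coordinates up to
  scalars, and the exponents match.

  Cylinders. Both varieties are torsors over the same scheme \<open>Z\<close>, so \<open>X \<times> \<complex>\<close> and \<open>X' \<times> \<complex>\<close> are both
  isomorphic to \<open>X \<times>\<^sub>Z X'\<close>. A section over \<open>X\<close> is \<open>y' = \<theta>(y)\<close> for a polynomial \<open>\<theta>\<close> that agrees with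
  \<open>lam j\<close> to high order at \<open>lam j\<close>; iterating Newton's method for \<open>P\<close> provides one.
\<close>

subsection \<open>Evaluating polynomials in arbitrary commutative algebras\<close>

text \<open>The non-isomorphism needs points that are generic, approach the divisor x_i = 0 and move
  along an action, all at once. Their coordinates lie in \<open>cpoly fract\<close> (the generic
  point), in Laurent series in s over it (its torus orbit) and in polynomials in T over those (a
  family through that orbit). Identities known at complex points reach these domains because x^N Q
  is, modulo the equation, a polynomial in x and y alone.

  Why a pole must exist: the order in s is a valuation on functions of X', through the isomorphism.
  If it is zero on all nonzero polynomials in x', then either y' has order at least 0, all
  coordinates of X' are integral and z cannot have its pole of order m_i; or y' has a pole, and x_i,
  of order 1, becomes after multiplication by a power of x'^m' a polynomial in y' with coefficients
  of order 0, whose order cannot be positive. If some polynomial in x' has positive order, then x_i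
  divides it along the family and is constant.

  For the cylinders, both inverse maps have the same form: the new fibre coordinate is (y -
  \<theta>(y')) / x^m, and the whole work is to show that this quotient is a polynomial.\<close>

definition rhom :: "('a::comm_ring_1 \<Rightarrow> 'b::comm_ring_1) \<Rightarrow> bool" where
  "rhom h \<longleftrightarrow> h 1 = 1 \<and> (\<forall>a b. h (a + b) = h a + h b) \<and> (\<forall>a b. h (a * b) = h a * h b)"

lemma rhomI:
  assumes "h 1 = 1" "\<And>a b. h (a + b) = h a + h b" "\<And>a b. h (a * b) = h a * h b"
  shows "rhom h"
  using assms by (auto simp: rhom_def)

context
  fixes h :: "'a::comm_ring_1 \<Rightarrow> 'b::comm_ring_1"
  assumes h: "rhom h"
begin

lemma rhom_1: "h 1 = 1" and rhom_add: "h (a + b) = h a + h b" and rhom_mult: "h (a * b) = h a * h b"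
  using h by (auto simp: rhom_def)

lemma rhom_0: "h 0 = 0"
  using rhom_add[of 0 0] by simp

lemma rhom_minus: "h (- a) = - h a"
  using rhom_add[of a "- a"] by (simp add: rhom_0 eq_neg_iff_add_eq_0 add.commute)

lemma rhom_diff: "h (a - b) = h a - h b"
  using rhom_add[of a "- b"] by (simp add: rhom_minus)

lemma rhom_power: "h (a ^ k) = h a ^ k"
  by (induction k) (auto simp: rhom_1 rhom_mult)

lemma rhom_sum: "h (sum f A) = (\<Sum>i\<in>A. h (f i))"
  by (induction A rule: infinite_finite_induct) (auto simp: rhom_0 rhom_add)

lemma rhom_prod: "h (prod f A) = (\<Prod>i\<in>A. h (f i))"
  by (induction A rule: infinite_finite_induct) (auto simp: rhom_1 rhom_mult)

lemma rhom_of_nat: "h (of_nat k) = of_nat k"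
  by (induction k) (auto simp: rhom_0 rhom_1 rhom_add)

lemmas rhom_simps = rhom_1 rhom_add rhom_mult rhom_0 rhom_minus rhom_diff rhom_power rhom_sum rhom_prod

end

lemma rhom_comp: "rhom g \<Longrightarrow> rhom h \<Longrightarrow> rhom (g \<circ> h)"
  by (auto simp: rhom_def)

lemma rhom_id: "rhom id"
  by (auto simp: rhom_def)

definition mon :: "(nat \<Rightarrow> 'a::comm_monoid_mult) \<Rightarrow> (nat \<Rightarrow>\<^sub>0 nat) \<Rightarrow> 'a" where
  "mon p e = (\<Prod>i\<in>Poly_Mapping.keys e. p i ^ Poly_Mapping.lookup e i)"

text \<open>\<iota> carries the complex-algebra structure of the target. Complex points use
  \<open>id\<close>, substitution of polynomials uses \<open>Con\<close>, and the larger coordinate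
  rings use their embeddings of the constants.\<close>

definition ev :: "(complex \<Rightarrow> 'a::comm_ring_1) \<Rightarrow> cpoly \<Rightarrow> (nat \<Rightarrow> 'a) \<Rightarrow> 'a" where
  "ev \<iota> Q p = (\<Sum>e\<in>Poly_Mapping.keys Q. \<iota> (Poly_Mapping.lookup Q e) * mon p e)"

abbreviation Con :: "complex \<Rightarrow> cpoly" where
  "Con c \<equiv> Poly_Mapping.single 0 c"

abbreviation Var :: "nat \<Rightarrow> cpoly" where
  "Var i \<equiv> Poly_Mapping.single (Poly_Mapping.single i (Suc 0)) 1"

lemma peval_ev: "peval Q p = ev id Q p"
  by (simp add: peval_def ev_def mon_def)

lemma mon_superset:
  assumes "finite S" "Poly_Mapping.keys e \<subseteq> S"
  shows "mon p e = (\<Prod>i\<in>S. p i ^ Poly_Mapping.lookup e i)"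
  unfolding mon_def
  by (rule prod.mono_neutral_left) (use assms in \<open>auto simp: in_keys_iff\<close>)

lemma mon_add: "mon p (e + e') = mon p e * mon p e'"
proof -
  let ?S = "Poly_Mapping.keys e \<union> Poly_Mapping.keys e'"
  have "mon p (e + e') = (\<Prod>i\<in>?S. p i ^ Poly_Mapping.lookup (e + e') i)"
    by (rule mon_superset) (auto simp: keys_add)
  also have "\<dots> = mon p e * mon p e'"
    by (simp add: mon_superset[of ?S] lookup_add power_add prod.distrib)
  finally show ?thesis .
qed

lemma mon_0 [simp]: "mon p 0 = 1"
  by (simp add: mon_def)

lemma mon_single [simp]: "mon p (Poly_Mapping.single i k) = p i ^ k"
  by (cases "k = 0") (simp_all add: mon_def)

lemma cpoly_sum_monomials:
  "(\<Sum>e\<in>Poly_Mapping.keys Q. Poly_Mapping.single e (Poly_Mapping.lookup Q e)) = (Q :: cpoly)"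
  by (rule poly_mapping_eqI) (auto simp: lookup_sum lookup_single when_def in_keys_iff)

lemma rhom_Con: "rhom Con"
  by (rule rhomI) (auto simp: single_add mult_single)

context
  fixes \<iota> :: "complex \<Rightarrow> 'a::comm_ring_1"
  assumes \<iota>: "rhom \<iota>"
begin

lemma ev_superset:
  assumes "finite S" "Poly_Mapping.keys Q \<subseteq> S"
  shows "ev \<iota> Q p = (\<Sum>e\<in>S. \<iota> (Poly_Mapping.lookup Q e) * mon p e)"
  unfolding ev_def
  by (rule sum.mono_neutral_left) (use assms in \<open>auto simp: in_keys_iff rhom_0[OF \<iota>]\<close>)

lemma ev_add: "ev \<iota> (Q + R) p = ev \<iota> Q p + ev \<iota> R p"
proof -
  let ?S = "Poly_Mapping.keys Q \<union> Poly_Mapping.keys R"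
  have "ev \<iota> (Q + R) p = (\<Sum>e\<in>?S. \<iota> (Poly_Mapping.lookup (Q + R) e) * mon p e)"
    by (rule ev_superset) (use Poly_Mapping.keys_add[of Q R] in auto)
  also have "\<dots> = ev \<iota> Q p + ev \<iota> R p"
    by (simp add: ev_superset[of ?S] lookup_add rhom_add[OF \<iota>] sum.distrib distrib_right)
  finally show ?thesis .
qed

lemma ev_single: "ev \<iota> (Poly_Mapping.single e c) p = \<iota> c * mon p e"
  by (cases "c = 0") (simp_all add: ev_def rhom_0[OF \<iota>])

lemma ev_sum: "ev \<iota> (sum f A) p = (\<Sum>i\<in>A. ev \<iota> (f i) p)"
proof (induction A rule: infinite_finite_induct)
  case (insert x F) then show ?case by (simp add: ev_add)
qed (auto simp: ev_def)

lemma ev_mult: "ev \<iota> (Q * R) p = ev \<iota> Q p * ev \<iota> R p"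
proof -
  let ?k = Poly_Mapping.keys and ?l = Poly_Mapping.lookup
  have "Q * R = (\<Sum>e\<in>?k Q. Poly_Mapping.single e (?l Q e)) * (\<Sum>e\<in>?k R. Poly_Mapping.single e (?l R e))"
    by (simp add: cpoly_sum_monomials)
  also have "\<dots> = (\<Sum>e\<in>?k Q. \<Sum>e'\<in>?k R. Poly_Mapping.single (e + e') (?l Q e * ?l R e'))"
    by (simp add: sum_product mult_single)
  finally have "ev \<iota> (Q * R) p = (\<Sum>e\<in>?k Q. \<Sum>e'\<in>?k R. \<iota> (?l Q e * ?l R e') * mon p (e + e'))"
    by (simp add: ev_sum ev_single)
  also have "\<dots> = ev \<iota> Q p * ev \<iota> R p"
    by (simp add: ev_def sum_product rhom_mult[OF \<iota>] mon_add mult_ac)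
  finally show ?thesis .
qed

lemma rhom_ev: "rhom (\<lambda>Q. ev \<iota> Q p)"
  by (rule rhomI) (use ev_single[of 0 1 p] in \<open>auto simp: ev_add ev_mult rhom_1[OF \<iota>]\<close>)

lemma ev_Con: "ev \<iota> (Con c) p = \<iota> c" and ev_Var: "ev \<iota> (Var i) p = p i"
  by (simp_all add: ev_single rhom_1[OF \<iota>])

lemmas ev_simps = ev_Con ev_Var rhom_simps[OF rhom_ev]

lemma rhom_ev_apply:
  assumes "rhom h"
  shows "h (ev \<iota> Q p) = ev (h \<circ> \<iota>) Q (h \<circ> p)"
  using assms by (simp add: ev_def mon_def rhom_simps)

lemma ev_ev: "ev \<iota> (ev Con Q \<sigma>) p = ev \<iota> Q (\<lambda>i. ev \<iota> (\<sigma> i) p)"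
proof -
  have "ev \<iota> (ev Con Q \<sigma>) p = ev ((\<lambda>Q. ev \<iota> Q p) \<circ> Con) Q ((\<lambda>Q. ev \<iota> Q p) \<circ> \<sigma>)"
    unfolding ev_def[of Con] mon_def
    by (simp add: rhom_simps[OF rhom_ev]) (simp add: ev_def[of "(\<lambda>Q. ev \<iota> Q p) \<circ> Con"] mon_def)
  also have "(\<lambda>Q. ev \<iota> Q p) \<circ> Con = \<iota>"
    by (auto simp: fun_eq_iff ev_Con)
  finally show ?thesis by (simp add: o_def)
qed

end

section \<open>Polynomials in the first \<open>N\<close> variables\<close>

lemma polys_add: "Q \<in> polys N \<Longrightarrow> R \<in> polys N \<Longrightarrow> Q + R \<in> polys N"
  using Poly_Mapping.keys_add[of Q R] by (auto simp: polys_def)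

lemma polys_single: "Poly_Mapping.keys e \<subseteq> {..<N} \<Longrightarrow> Poly_Mapping.single e c \<in> polys N"
  by (auto simp: polys_def)

lemma polys_Con: "Con c \<in> polys N"
  by (auto intro: polys_single)

lemma polys_Var: "i < N \<Longrightarrow> Var i \<in> polys N"
  by (auto intro!: polys_single)

lemma polys_mult:
  assumes "Q \<in> polys N" "R \<in> polys N"
  shows "Q * R \<in> polys N"
proof -
  { fix e assume "e \<in> Poly_Mapping.keys (Q * R)"
    then obtain a b where ab: "e = a + b" "a \<in> Poly_Mapping.keys Q" "b \<in> Poly_Mapping.keys R"
      using Poly_Mapping.keys_mult[of Q R] by auto
    then have "Poly_Mapping.keys e \<subseteq> {..<N}"
      using Poly_Mapping.keys_add[of a b] assms unfolding polys_def by blast }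
  then show ?thesis by (auto simp: polys_def)
qed

lemma polys_0: "0 \<in> polys N" and polys_1: "1 \<in> polys N"
  by (auto simp: polys_def)

lemma polys_uminus: "Q \<in> polys N \<Longrightarrow> - Q \<in> polys N"
  by (auto simp: polys_def in_keys_iff)

lemma polys_diff: "Q \<in> polys N \<Longrightarrow> R \<in> polys N \<Longrightarrow> Q - R \<in> polys N"
  using polys_add[of Q N "- R"] polys_uminus[of R N] by simp

lemma polys_power: "Q \<in> polys N \<Longrightarrow> Q ^ k \<in> polys N"
  by (induction k) (auto intro: polys_1 polys_mult)

lemma polys_sum: "(\<And>i. i \<in> A \<Longrightarrow> f i \<in> polys N) \<Longrightarrow> sum f A \<in> polys N"
  by (induction A rule: infinite_finite_induct) (auto intro: polys_0 polys_add)

lemma polys_prod: "(\<And>i. i \<in> A \<Longrightarrow> f i \<in> polys N) \<Longrightarrow> prod f A \<in> polys N"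
  by (induction A rule: infinite_finite_induct) (auto intro: polys_1 polys_mult)

lemmas polys_intros = polys_add polys_mult polys_Con polys_Var polys_0 polys_1 polys_uminus
  polys_diff polys_power polys_sum polys_prod

lemma polys_mono: "N \<le> M \<Longrightarrow> Q \<in> polys N \<Longrightarrow> Q \<in> polys M"
  by (fastforce simp: polys_def)

lemma ev_Con_in_polys:
  assumes "Q \<in> polys N" "\<And>i. i < N \<Longrightarrow> \<sigma> i \<in> polys M"
  shows "ev Con Q \<sigma> \<in> polys M"
proof -
  have "\<sigma> i \<in> polys M" if "e \<in> Poly_Mapping.keys Q" "i \<in> Poly_Mapping.keys e" for e i
    using that assms(1) by (intro assms(2)) (auto simp: polys_def)
  then show ?thesis
    unfolding ev_def mon_def by (intro polys_intros) auto
qed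

lemma ev_cong:
  assumes "Q \<in> polys N" "\<And>i. i < N \<Longrightarrow> p i = q i"
  shows "ev \<iota> Q p = ev \<iota> Q q"
proof -
  have "p i = q i" if "e \<in> Poly_Mapping.keys Q" "i \<in> Poly_Mapping.keys e" for e i
    using that assms by (auto simp: polys_def)
  then show ?thesis
    unfolding ev_def mon_def by (intro sum.cong prod.cong arg_cong2[where f = "(*)"] refl) auto
qed

lemma ev_Con_Var: "ev Con Q Var = Q"
proof -
  have "Var i ^ k = Poly_Mapping.single (Poly_Mapping.single i k) 1" for i k
    by (induction k) (auto simp: mult_single single_add[symmetric])
  moreover have "(\<Prod>i\<in>A. Poly_Mapping.single (f i) 1) = Poly_Mapping.single (sum f A) (1::complex)"
    for A :: "nat set" and f :: "nat \<Rightarrow> (nat \<Rightarrow>\<^sub>0 nat)"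
    by (induction A rule: infinite_finite_induct) (auto simp: mult_single)
  moreover have "(\<Sum>i\<in>Poly_Mapping.keys e. Poly_Mapping.single i (Poly_Mapping.lookup e i)) = e"
    for e :: "nat \<Rightarrow>\<^sub>0 nat"
    by (rule poly_mapping_eqI) (auto simp: lookup_sum lookup_single when_def in_keys_iff)
  ultimately have "mon Var e = Poly_Mapping.single e 1" for e
    by (simp add: mon_def)
  then show ?thesis
    by (simp add: ev_def mult_single cpoly_sum_monomials)
qed

lemma polys_induct [consumes 1, case_names Con Var add mult]:
  assumes "Q \<in> polys N"
    and Con: "\<And>c. P (Con c)" and Var: "\<And>i. i < N \<Longrightarrow> P (Var i)"
    and add: "\<And>Q R. Q \<in> polys N \<Longrightarrow> R \<in> polys N \<Longrightarrow> P Q \<Longrightarrow> P R \<Longrightarrow> P (Q + R)"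
    and mult: "\<And>Q R. Q \<in> polys N \<Longrightarrow> R \<in> polys N \<Longrightarrow> P Q \<Longrightarrow> P R \<Longrightarrow> P (Q * R)"
  shows "P Q"
proof -
  let ?P = "\<lambda>Q. Q \<in> polys N \<and> P Q"
  have 1: "?P 1" using Con[of 1] by (simp add: polys_1)
  have 0: "?P 0" using Con[of 0] by (simp add: polys_0)
  have pow: "?P (Q ^ k)" if "?P Q" for Q k
    by (induction k) (use 1 that in \<open>auto intro: mult polys_mult\<close>)
  have prod: "?P (prod f A)" if "\<And>i. i \<in> A \<Longrightarrow> ?P (f i)" for f and A :: "nat set"
    using that by (induction A rule: infinite_finite_induct) (use 1 in \<open>auto intro: mult polys_mult\<close>)
  have sum: "?P (sum f A)" if "\<And>i. i \<in> A \<Longrightarrow> ?P (f i)" for f and A :: "(nat \<Rightarrow>\<^sub>0 nat) set"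
    using that by (induction A rule: infinite_finite_induct) (use 0 in \<open>auto intro: add polys_add\<close>)
  have "?P (ev Con Q Var)"
    unfolding ev_def mon_def
  proof (intro sum)
    fix e assume e: "e \<in> Poly_Mapping.keys Q"
    have "?P (\<Prod>i\<in>Poly_Mapping.keys e. Var i ^ Poly_Mapping.lookup e i)"
      by (intro prod pow) (use e assms(1) Var in \<open>auto simp: polys_def\<close>)
    then show "?P (Con (Poly_Mapping.lookup Q e) * (\<Prod>i\<in>Poly_Mapping.keys e. Var i ^ Poly_Mapping.lookup e i))"
      using mult Con polys_Con polys_mult by blast
  qed
  then show ?thesis by (simp add: ev_Con_Var)
qed

text \<open>Turns the sign of a weight into divisibility by a coordinate. The truncated subtraction
  of exponents is exact because every monomial contains \<open>Var i\<close>.\<close>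

lemma polys_factor_Var:
  assumes "Q \<in> polys N" "\<And>e. e \<in> Poly_Mapping.keys Q \<Longrightarrow> Poly_Mapping.lookup e i > 0"
  obtains H where "H \<in> polys N" "Q = Var i * H"
proof
  let ?k = Poly_Mapping.keys and ?l = Poly_Mapping.lookup
  let ?H = "\<Sum>e\<in>?k Q. Poly_Mapping.single (e - Poly_Mapping.single i (Suc 0)) (?l Q e)"
  have e: "Poly_Mapping.single i (Suc 0) + (e - Poly_Mapping.single i (Suc 0)) = e" if "e \<in> ?k Q" for e
    using assms(2)[OF that] by (intro poly_mapping_eqI) (auto simp: lookup_add lookup_minus lookup_single when_def)
  have "?k (e - Poly_Mapping.single i (Suc 0)) \<subseteq> ?k e" for e :: "nat \<Rightarrow>\<^sub>0 nat"
    by (auto simp: in_keys_iff lookup_minus)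
  then show "?H \<in> polys N"
    using assms(1) by (intro polys_sum polys_single) (fastforce simp: polys_def)
  have "Var i * ?H = (\<Sum>e\<in>?k Q. Poly_Mapping.single e (?l Q e))"
    unfolding sum_distrib_left mult_single by (intro sum.cong refl) (simp add: e)
  then show "Q = Var i * ?H" by (simp add: cpoly_sum_monomials)
qed

section \<open>Components of a polynomial with respect to a weight\<close>

definition wpart :: "((nat \<Rightarrow>\<^sub>0 nat) \<Rightarrow> int) \<Rightarrow> int \<Rightarrow> cpoly \<Rightarrow> cpoly" where
  "wpart \<omega> k Q = (\<Sum>e\<in>{e \<in> Poly_Mapping.keys Q. \<omega> e = k}. Poly_Mapping.single e (Poly_Mapping.lookup Q e))"

lemma keys_wpart: "e \<in> Poly_Mapping.keys (wpart \<omega> k Q) \<Longrightarrow> e \<in> Poly_Mapping.keys Q \<and> \<omega> e = k"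
  unfolding wpart_def
  using keys_sum[of "\<lambda>e. Poly_Mapping.single e (Poly_Mapping.lookup Q e)" "{e \<in> Poly_Mapping.keys Q. \<omega> e = k}"]
  by (auto split: if_splits)

lemma wpart_in_polys: "Q \<in> polys N \<Longrightarrow> wpart \<omega> k Q \<in> polys N"
  unfolding polys_def using keys_wpart by blast

lemma wpart_sum: "Q = (\<Sum>k\<in>\<omega> ` Poly_Mapping.keys Q. wpart \<omega> k Q)"
proof -
  have "(\<Sum>k\<in>\<omega> ` Poly_Mapping.keys Q. wpart \<omega> k Q) = (\<Sum>e\<in>Poly_Mapping.keys Q. Poly_Mapping.single e (Poly_Mapping.lookup Q e))"
    unfolding wpart_def by (rule sum.image_gen[symmetric]) simp
  then show ?thesis by (simp add: cpoly_sum_monomials)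
qed

lemma ev_homogeneous:
  assumes \<iota>: "rhom \<iota>" and "\<And>e. e \<in> Poly_Mapping.keys Q \<Longrightarrow> mon u e = c"
  shows "ev \<iota> Q (\<lambda>i. u i * p i) = c * ev \<iota> Q p"
proof -
  have "mon (\<lambda>i. u i * p i) e = mon u e * mon p e" for e
    by (simp add: mon_def power_mult_distrib prod.distrib)
  then show ?thesis using assms(2) by (simp add: ev_def sum_distrib_left mult_ac)
qed

text \<open>Kronecker substitution \<open>x\<^sub>i = t ^ B ^ i\<close> reduces to one variable.\<close>

lemma base_expansion_inj:
  fixes e e' :: "nat \<Rightarrow> nat"
  assumes "(\<Sum>i<N. e i * B ^ i) = (\<Sum>i<N. e' i * B ^ i)" "\<And>i. e i < B" "\<And>i. e' i < B" "i < N"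
  shows "e i = e' i"
  using assms
proof (induction N arbitrary: e e' i)
  case (Suc N)
  have *: "(\<Sum>i<Suc N. f i * B ^ i) = f 0 + B * (\<Sum>i<N. f (Suc i) * B ^ i)" for f :: "nat \<Rightarrow> nat"
    by (simp add: sum.lessThan_Suc_shift sum_distrib_left mult_ac del: sum.lessThan_Suc)
  have eq: "e 0 + B * (\<Sum>i<N. e (Suc i) * B ^ i) = e' 0 + B * (\<Sum>i<N. e' (Suc i) * B ^ i)"
    using Suc.prems(1) unfolding * .
  have 0: "e 0 = e' 0"
    using arg_cong[OF eq, of "\<lambda>a. a mod B"] Suc.prems(2,3) by simp
  have "B > 0" using Suc.prems(2)[of 0] by auto
  then have s: "(\<Sum>i<N. e (Suc i) * B ^ i) = (\<Sum>i<N. e' (Suc i) * B ^ i)"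
    using eq 0 by auto
  show ?case
    using Suc.IH[OF s] Suc.prems 0 by (cases i) auto
qed simp

lemma nonzero_at_torus_point:
  assumes "Q \<in> polys N" "Q \<noteq> 0"
  obtains p where "\<And>i. p i \<noteq> 0" "ev id Q p \<noteq> 0"
proof -
  let ?k = Poly_Mapping.keys and ?l = Poly_Mapping.lookup
  \<comment> \<open>Larger than every exponent that occurs, so that distinct monomials receive
    distinct exponents of t.\<close>
  define B where "B = Suc (\<Sum>e\<in>?k Q. \<Sum>i<N. ?l e i)"
  have B: "?l e i < B" if "e \<in> ?k Q" for e i
  proof (cases "i < N")
    case True
    have "?l e i \<le> (\<Sum>i<N. ?l e i)" using True by (intro member_le_sum) auto
    also have "\<dots> \<le> (\<Sum>e\<in>?k Q. \<Sum>i<N. ?l e i)"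
      using that by (intro member_le_sum[where f = "\<lambda>e. \<Sum>i<N. ?l e i"]) auto
    finally show ?thesis by (simp add: B_def)
  next
    case False
    then have "i \<notin> ?k e" using that assms(1) by (auto simp: polys_def)
    then show ?thesis by (simp add: B_def in_keys_iff)
  qed
  define E where "E = (\<lambda>e. \<Sum>i<N. ?l e i * B ^ i)"
  have inj: "e = e'" if "e \<in> ?k Q" "e' \<in> ?k Q" "E e = E e'" for e e'
  proof (rule poly_mapping_eqI)
    fix i
    show "?l e i = ?l e' i"
    proof (cases "i < N")
      case True
      then show ?thesis
        using base_expansion_inj[of "?l e" B N "?l e'" i] that B unfolding E_def by auto
    next
      case False
      then have "i \<notin> ?k e" "i \<notin> ?k e'" using that assms(1) by (auto simp: polys_def)
      then show ?thesis by (simp add: in_keys_iff)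
    qed
  qed
  define q where "q = (\<Sum>e\<in>?k Q. Polynomial.monom (?l Q e) (E e))"
  have mon: "mon (\<lambda>i. t ^ B ^ i) e = t ^ E e" if "e \<in> ?k Q" for t :: complex and e
  proof -
    have "mon (\<lambda>i. t ^ B ^ i) e = (\<Prod>i<N. (t ^ B ^ i) ^ ?l e i)"
      by (rule mon_superset) (use that assms(1) in \<open>auto simp: polys_def\<close>)
    also have "\<dots> = t ^ E e"
      by (simp add: E_def power_sum power_mult[symmetric] mult.commute)
    finally show ?thesis .
  qed
  have q: "poly q t = ev id Q (\<lambda>i. t ^ B ^ i)" for t
    unfolding q_def ev_def by (simp add: poly_sum poly_monom mon)
  obtain e where e: "e \<in> ?k Q" using assms(2) by (metis all_not_in_conv keys_eq_empty)
  have "coeff q (E e) = (\<Sum>e'\<in>?k Q. if e' = e then ?l Q e' else 0)"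
    unfolding q_def coeff_sum by (intro sum.cong refl) (use inj e in \<open>auto simp: coeff_monom\<close>)
  then have "q \<noteq> 0" using e by (auto simp: in_keys_iff)
  then have "finite ({t. poly q t = 0} \<union> {0})" by (simp add: poly_roots_finite)
  then obtain t where "t \<notin> {t. poly q t = 0} \<union> {0}"
    using ex_new_if_finite infinite_UNIV_char_0 by blast
  then show ?thesis using that[of "\<lambda>i. t ^ B ^ i"] q by auto
qed

subsection \<open>Points of the hypersurface over arbitrary algebras\<close>

lemma rhom_fract: "rhom (\<lambda>Q. Fract Q (1::'a::idom))"
  by (rule rhomI) (auto simp: One_fract_def)

lemma fract_eq_0_iff: "Fract (Q::'a::idom) 1 = 0 \<longleftrightarrow> Q = 0"
  by (simp add: Zero_fract_def eq_fract)

abbreviation fcon :: "complex \<Rightarrow> cpoly fract" where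
  "fcon c \<equiv> Fract (Con c) 1"

lemma rhom_fcon: "rhom fcon"
  using rhom_comp[OF rhom_fract rhom_Con] by (simp add: o_def)

locale hypersurface =
  fixes n :: nat and m :: "nat \<Rightarrow> nat" and r :: nat and lam :: "nat \<Rightarrow> complex"
  assumes n1: "n \<ge> 1" and r2: "r \<ge> 2" and m1: "\<And>i. i < n \<Longrightarrow> m i > 1"
    and inj: "inj_on lam {..<r}"
begin

definition xm :: "(nat \<Rightarrow> 'a::comm_ring_1) \<Rightarrow> 'a" where
  "xm p = (\<Prod>i<n. p i ^ m i)"

definition pol :: "(complex \<Rightarrow> 'a::comm_ring_1) \<Rightarrow> 'a \<Rightarrow> 'a" where
  "pol \<iota> y = (\<Prod>j<r. (y - \<iota> (lam j)))"

definition onX :: "(complex \<Rightarrow> 'a::comm_ring_1) \<Rightarrow> (nat \<Rightarrow> 'a) \<Rightarrow> bool" where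
  "onX \<iota> p \<longleftrightarrow> xm p * p (Suc n) = pol \<iota> (p n)"

definition J :: cpoly where
  "J = xm Var * Var (Suc n) - pol Con (Var n)"

text \<open>The ideal of the complex points. The points may be arbitrary functions, since
  polynomials in \<open>polys (n + 2)\<close> see only the first \<open>n + 2\<close>
  coordinates.\<close>

definition IX :: "cpoly set" where
  "IX = {Q \<in> polys (n + 2). \<forall>p. onX id p \<longrightarrow> ev id Q p = 0}"

text \<open>The parametrisation by x and t of the piece y = lam k + x^m t: one factor of P(y) is x^m
  t, so x^m cancels and the other factors give z.\<close>

definition chart :: "(complex \<Rightarrow> 'a::comm_ring_1) \<Rightarrow> nat \<Rightarrow> (nat \<Rightarrow> 'a) \<Rightarrow> nat \<Rightarrow> 'a" where
  "chart \<iota> k q = q(n := \<iota> (lam k) + xm q * q n,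
     Suc n := q n * (\<Prod>j\<in>{..<r} - {k}. (\<iota> (lam k) - \<iota> (lam j) + xm q * q n)))"

lemma xm_hom: "rhom h \<Longrightarrow> h (xm p) = xm (\<lambda>i. h (p i))"
  by (simp add: xm_def rhom_simps)

lemma xm_cong: "(\<And>i. i < n \<Longrightarrow> p i = q i) \<Longrightarrow> xm p = xm q"
  by (simp add: xm_def)

lemma xm_upd [simp]: "i \<ge> n \<Longrightarrow> xm (p(i := a)) = xm p"
  by (rule xm_cong) auto

lemma xm_nonzero: "(\<And>i. i < n \<Longrightarrow> p i \<noteq> 0) \<Longrightarrow> xm p \<noteq> (0::'a::idom)"
  by (simp add: xm_def)

lemma xm_eq_0_iff: "xm p = (0::'a::idom) \<longleftrightarrow> (\<exists>i<n. p i = 0)"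
  using m1 by (fastforce simp: xm_def)

lemma pol_hom: "rhom h \<Longrightarrow> h (pol \<iota> y) = pol (\<lambda>c. h (\<iota> c)) (h y)"
  by (simp add: pol_def rhom_simps)

lemma pol_eq_0_iff: "pol \<iota> y = (0::'a::idom) \<longleftrightarrow> (\<exists>j<r. y = \<iota> (lam j))"
  by (auto simp: pol_def)

lemma xm_in_polys: "(\<And>i. i < n \<Longrightarrow> p i \<in> polys N) \<Longrightarrow> xm p \<in> polys N"
  unfolding xm_def by (intro polys_intros) auto

lemma pol_in_polys: "y \<in> polys N \<Longrightarrow> pol Con y \<in> polys N"
  unfolding pol_def by (intro polys_intros)

lemma onX_hom: "rhom h \<Longrightarrow> onX \<iota> p \<Longrightarrow> onX (\<lambda>c. h (\<iota> c)) (\<lambda>i. h (p i))"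
  unfolding onX_def by (metis rhom_mult xm_hom pol_hom)

lemma onX_cong: "(\<And>i. i < n + 2 \<Longrightarrow> p i = q i) \<Longrightarrow> onX \<iota> p \<longleftrightarrow> onX \<iota> q"
  unfolding onX_def using xm_cong[of p q] by simp

lemma ev_xm: "rhom \<iota> \<Longrightarrow> ev \<iota> (xm Var) p = xm p"
  by (simp add: xm_def ev_simps)

lemma ev_J: "rhom \<iota> \<Longrightarrow> ev \<iota> J p = xm p * p (Suc n) - pol \<iota> (p n)"
  by (simp add: J_def ev_simps ev_xm pol_def)

lemma J_in_polys: "J \<in> polys (n + 2)"
  unfolding J_def by (intro polys_intros xm_in_polys pol_in_polys) auto

lemma J_in_IX: "J \<in> IX"
  using J_in_polys by (auto simp: IX_def ev_J[OF rhom_id] onX_def)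

lemma pol_split: "k < r \<Longrightarrow> pol \<iota> y = (y - \<iota> (lam k)) * (\<Prod>j\<in>{..<r} - {k}. (y - \<iota> (lam j)))"
  by (simp add: pol_def prod.remove)

lemma chart_onX: "k < r \<Longrightarrow> onX \<iota> (chart \<iota> k q)"
  by (simp add: onX_def chart_def pol_split[of k] algebra_simps)

lemma chart_lt: "i < n \<Longrightarrow> chart \<iota> k q i = q i"
  by (simp add: chart_def)

lemma chart_in_polys: "i < n + 2 \<Longrightarrow> chart Con k Var i \<in> polys (n + 1)"
  unfolding chart_def by (auto intro!: polys_intros xm_in_polys)

lemma ev_chart:
  assumes "rhom \<iota>"
  shows "ev \<iota> (chart Con k Var i) q = chart \<iota> k q i"
  using assms by (auto simp: chart_def ev_simps ev_xm)

text \<open>Modulo \<open>J\<close>, the product x^m z equals P(y), so a power of x^m removes every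
  z from \<open>Q\<close>; the remainder \<open>G\<close> involves x and y only.\<close>

lemma clear_denominator:
  assumes "Q \<in> polys (n + 2)"
  shows "\<exists>N G H. G \<in> polys (n + 1) \<and> xm Var ^ N * Q = G + J * H"
  using assms
proof (induction rule: polys_induct)
  case (Con c)
  show ?case by (rule exI[of _ 0], rule exI[of _ "Con c"], rule exI[of _ 0]) (simp add: polys_Con)
next
  case (Var i)
  show ?case
  proof (cases "i < n + 1")
    case True
    then show ?thesis
      by (intro exI[of _ 0] exI[of _ "Var i"]) (simp add: polys_Var del: One_nat_def)
  next
    case False
    then have "i = Suc n" using Var by simp
    then show ?thesis
      by (intro exI[of _ 1] exI[of _ "pol Con (Var n)"])
        (auto simp: J_def intro!: pol_in_polys polys_Var)
  qed
next
  case (add Q R)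
  then obtain N G H N' G' H' where *: "G \<in> polys (n + 1)" "xm Var ^ N * Q = G + J * H"
    "G' \<in> polys (n + 1)" "xm Var ^ N' * R = G' + J * H'" by blast
  have "xm Var ^ (N + N') * (Q + R) = xm Var ^ N' * (xm Var ^ N * Q) + xm Var ^ N * (xm Var ^ N' * R)"
    by (simp add: power_add algebra_simps)
  also have "\<dots> = (xm Var ^ N' * G + xm Var ^ N * G') + J * (xm Var ^ N' * H + xm Var ^ N * H')"
    unfolding * by (simp add: algebra_simps)
  finally have eq: "xm Var ^ (N + N') * (Q + R) = \<dots>" .
  have "xm Var ^ N' * G + xm Var ^ N * G' \<in> polys (n + 1)"
    by (intro polys_intros xm_in_polys *) simp_all
  with eq show ?case by blast
next
  case (mult Q R)
  then obtain N G H N' G' H' where *: "G \<in> polys (n + 1)" "xm Var ^ N * Q = G + J * H"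
    "G' \<in> polys (n + 1)" "xm Var ^ N' * R = G' + J * H'" by blast
  have "xm Var ^ (N + N') * (Q * R) = (xm Var ^ N * Q) * (xm Var ^ N' * R)"
    by (simp add: power_add algebra_simps)
  also have "\<dots> = G * G' + J * (H * G' + G * H' + J * H * H')"
    unfolding * by (simp add: algebra_simps)
  finally have eq: "xm Var ^ (N + N') * (Q * R) = \<dots>" .
  have "G * G' \<in> polys (n + 1)"
    by (intro polys_mult *)
  with eq show ?case by blast
qed

text \<open>A point with some x_i = 0 lies on a sheet y = lam k, and the chart there deforms it into
  points with all x_i nonzero; continuity carries the equation to the limit. Coordinates beyond z
  stay fixed, so this also serves the cylinders.\<close>

lemma torus_dense:
  assumes Q: "\<And>p. onX id p \<Longrightarrow> (\<And>i. i < n \<Longrightarrow> p i \<noteq> 0) \<Longrightarrow> ev id Q p = 0"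
    and p: "onX id p"
  shows "ev id Q p = (0::complex)"
proof (cases "\<exists>i<n. p i = 0")
  case True
  then have x0: "xm p = 0" by (simp add: xm_eq_0_iff)
  then have "pol id (p n) = 0" using p by (simp add: onX_def)
  then obtain k where k: "k < r" "p n = lam k" by (auto simp: pol_eq_0_iff)
  define d where "d = (\<Prod>j\<in>{..<r} - {k}. (lam k - lam j))"
  have d: "d \<noteq> 0" using inj k by (auto simp: d_def inj_on_def)
  \<comment> \<open>At x^m = 0 the remaining factors multiply to \<open>d\<close>, so
    \<open>p (Suc n) / d\<close> is the chart parameter that reproduces z.\<close>
  define q where "q \<epsilon> = (\<lambda>i. if i < n \<and> p i = 0 then \<epsilon> else if i = n then p (Suc n) / d else p i)" for \<epsilon> :: complex
  have "xm (q 0) = xm p" by (rule xm_cong) (auto simp: q_def)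
  then have c0: "chart id k (q 0) = p"
    using x0 k d by (auto simp: chart_def q_def d_def[symmetric] fun_eq_iff)
  define f where "f \<epsilon> = ev id Q (chart id k (q \<epsilon>))" for \<epsilon>
  have q_cont: "isCont (\<lambda>\<epsilon>. q \<epsilon> i) 0" for i
    unfolding q_def by (cases "i < n \<and> p i = 0") auto
  have "isCont (\<lambda>\<epsilon>. chart id k (q \<epsilon>) i) 0" for i
  proof -
    have "isCont (\<lambda>\<epsilon>. if i = Suc n then q \<epsilon> n * (\<Prod>j\<in>{..<r} - {k}. (lam k - lam j + xm (q \<epsilon>) * q \<epsilon> n))
        else if i = n then lam k + xm (q \<epsilon>) * q \<epsilon> n else q \<epsilon> i) 0"
      unfolding xm_def by (cases "i = Suc n"; cases "i = n") (auto intro!: continuous_intros q_cont)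
    then show ?thesis unfolding chart_def fun_upd_def id_apply by simp
  qed
  then have "isCont f 0"
    unfolding f_def ev_def mon_def by (auto intro!: continuous_intros)
  then have lim: "f \<midarrow>0\<rightarrow> f 0" by (simp add: isCont_def)
  have "f \<epsilon> = 0" if "\<epsilon> \<noteq> 0" for \<epsilon>
    unfolding f_def
    by (rule Q) (use k that in \<open>auto simp: chart_onX chart_lt q_def\<close>)
  then have "f \<midarrow>0\<rightarrow> 0"
    by (intro tendsto_eventually) (auto simp: eventually_at_filter)
  with lim have "f 0 = 0" by (metis LIM_unique)
  then show ?thesis by (simp add: f_def c0)
qed (use Q p in auto)

text \<open>Transfers identities from complex points to every integral domain. The remainder
  \<open>G\<close> vanishes at all complex points with nonzero coordinates, hence is the zero
  polynomial, and then the power of x^m can be cancelled.\<close>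

lemma IX_vanish:
  assumes \<iota>: "rhom \<iota>" and Q: "Q \<in> IX" and \<xi>: "onX \<iota> \<xi>" "\<And>i. i < n \<Longrightarrow> \<xi> i \<noteq> 0"
  shows "ev \<iota> Q \<xi> = (0::'a::idom)"
proof -
  obtain N G H where G: "G \<in> polys (n + 1)" "xm Var ^ N * Q = G + J * H"
    using clear_denominator[of Q] Q unfolding IX_def by blast
  have "G = 0"
  proof (rule ccontr)
    assume "G \<noteq> 0"
    then obtain p :: "nat \<Rightarrow> complex" where p: "\<And>i. p i \<noteq> 0" "ev id G p \<noteq> 0"
      using nonzero_at_torus_point[OF G(1)] by blast
    define p' where "p' = p(Suc n := pol id (p n) / xm p)"
    have "onX id p'"
      using p(1) by (simp add: onX_def p'_def xm_nonzero)
    moreover have "ev id G p = ev id G p'"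
      by (rule ev_cong[OF G(1)]) (auto simp: p'_def)
    ultimately show False
      using p(2) arg_cong[OF G(2), of "\<lambda>Q. ev id Q p'"] Q
      by (simp add: ev_simps[OF rhom_id] ev_J[OF rhom_id] IX_def onX_def)
  qed
  then show ?thesis
    using arg_cong[OF G(2), of "\<lambda>Q. ev \<iota> Q \<xi>"] \<xi>
    by (simp add: ev_simps[OF \<iota>] ev_J[OF \<iota>] ev_xm[OF \<iota>] onX_def xm_nonzero)
qed

text \<open>The generic point: x and y are independent variables, and the equation forces z.\<close>

definition gen :: "nat \<Rightarrow> cpoly fract" where
  "gen = (\<lambda>i. Fract (Var i) 1)(Suc n := pol fcon (Fract (Var n) 1) / xm (\<lambda>i. Fract (Var i) 1))"

lemma gen_nonzero: "i \<le> n \<Longrightarrow> gen i \<noteq> 0"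
  by (simp add: gen_def fract_eq_0_iff) (metis single_zero keys_single insert_not_empty one_neq_zero keys_zero)

lemma gen_xm_nonzero: "xm (\<lambda>i. Fract (Var i) (1::cpoly)) \<noteq> 0"
  using gen_nonzero by (intro xm_nonzero) (auto simp: gen_def split: if_splits)

lemma gen_onX: "onX fcon gen"
  using gen_xm_nonzero by (simp add: onX_def gen_def)

text \<open>Once z is eliminated, a relation at \<open>gen\<close> is a relation between independent
  variables and hence trivial. It then holds on the torus part by cancellation and everywhere by
  density.\<close>

lemma gen_vanish_IX:
  assumes Q: "Q \<in> polys (n + 2)" and 0: "ev fcon Q gen = 0"
  shows "Q \<in> IX"
proof -
  obtain N G H where G: "G \<in> polys (n + 1)" "xm Var ^ N * Q = G + J * H"
    using clear_denominator[OF Q] by blast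
  have "ev fcon G gen = 0"
    using arg_cong[OF G(2), of "\<lambda>Q. ev fcon Q gen"] 0 gen_onX
    by (simp add: ev_simps[OF rhom_fcon] ev_J[OF rhom_fcon] onX_def)
  also have "ev fcon G gen = ev fcon G (\<lambda>i. Fract (Var i) 1)"
    by (rule ev_cong[OF G(1)]) (auto simp: gen_def)
  also have "\<dots> = Fract (ev Con G Var) 1"
    using rhom_ev_apply[OF rhom_Con rhom_fract, of G Var] by (simp add: o_def)
  finally have "G = 0" by (simp add: ev_Con_Var fract_eq_0_iff)
  then have "ev id Q p = 0" if "onX id p" "\<And>i. i < n \<Longrightarrow> p i \<noteq> 0" for p
    using arg_cong[OF G(2), of "\<lambda>Q. ev id Q p"] that xm_nonzero[of p]
    by (simp add: ev_simps[OF rhom_id] ev_J[OF rhom_id] ev_xm[OF rhom_id] onX_def)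
  then show ?thesis
    using torus_dense Q by (auto simp: IX_def)
qed

end

subsection \<open>Curves in a fibre with constant \<open>z\<close>\<close>

lemma rhom_const_poly: "rhom (\<lambda>c. [:c:])"
  by (rule rhomI) (auto simp: one_pCons)

lemma rhom_poly: "rhom (\<lambda>p. poly p a)"
  by (rule rhomI) auto

lemma rhom_map_poly:
  assumes "rhom h"
  shows "rhom (map_poly h)"
  by (rule rhomI)
    (auto simp: rhom_simps[OF assms] coeff_map_poly coeff_mult intro!: poly_eqI)

lemma rhom_pcompose: "rhom (\<lambda>p. pcompose p q)"
  by (rule rhomI) (auto simp: pcompose_1 pcompose_add pcompose_mult)

lemma rhom_fls_const: "rhom fls_const"
  by (rule rhomI) (auto simp: fls_plus_const)

lemma rhom_fps_to_fls: "rhom fps_to_fls"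
  by (rule rhomI) (auto simp: fls_times_fps_to_fls)

lemma rhom_fps_nth_0: "rhom (\<lambda>f. fps_nth f 0)"
  by (rule rhomI) auto

lemma rhom_fls_compose_power: "d > 0 \<Longrightarrow> rhom (\<lambda>f :: 'a::idom fls. fls_compose_power f d)"
  by (rule rhomI) auto

abbreviation cev :: "(complex \<Rightarrow> 'a::comm_ring_1) \<Rightarrow> complex poly \<Rightarrow> 'a \<Rightarrow> 'a" where
  "cev \<iota> q y \<equiv> poly (map_poly \<iota> q) y"

lemma rhom_cev: "rhom \<iota> \<Longrightarrow> rhom (\<lambda>q. cev \<iota> q y)"
  using rhom_comp[OF rhom_poly rhom_map_poly] by (simp add: o_def)

lemma cev_pCons: "rhom \<iota> \<Longrightarrow> cev \<iota> (pCons c q) y = \<iota> c + y * cev \<iota> q y"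
  by (cases "c = 0 \<and> q = 0") (auto simp: map_poly_pCons rhom_0)

lemma cev_linear: "rhom \<iota> \<Longrightarrow> cev \<iota> [:- c, 1:] y = y - \<iota> c"
  by (simp add: cev_pCons rhom_simps)

text \<open>Differentiation lowers the multiplicity of each factor by at most one.\<close>

lemma prod_power_dvd_pderiv:
  fixes X :: "'b \<Rightarrow> 'a::idom poly"
  shows "(\<Prod>i\<in>A. X i ^ (k i - 1)) dvd pderiv (\<Prod>i\<in>A. X i ^ k i)"
proof (induction A rule: infinite_finite_induct)
  case (insert a A)
  let ?W = "\<Prod>i\<in>A. X i ^ (k i - 1)" and ?R = "\<Prod>i\<in>A. X i ^ k i"
  have "?W dvd ?R"
    by (intro prod_dvd_prod le_imp_power_dvd) simp
  moreover have "X a ^ (k a - 1) dvd X a ^ k a"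
    by (intro le_imp_power_dvd) simp
  moreover have "X a ^ (k a - 1) dvd pderiv (X a ^ k a)"
    by (cases "k a") (auto simp: pderiv_power_Suc dvd_smult simp del: power_Suc)
  ultimately have "X a ^ (k a - 1) * ?W dvd X a ^ k a * pderiv ?R + ?R * pderiv (X a ^ k a)"
    using insert.IH by (intro dvd_add) (auto intro: mult_dvd_mono simp: mult.commute)
  then show ?case using insert by (simp add: pderiv_mult)
qed auto

lemma linear_factors_dvd:
  fixes q :: "'a::idom poly"
  assumes "finite A" "inj_on a A" "\<And>j. j \<in> A \<Longrightarrow> poly q (a j) = 0"
  shows "(\<Prod>j\<in>A. [:- a j, 1:]) dvd q"
  using assms
proof (induction A arbitrary: q rule: finite_induct)
  case (insert x A)
  obtain q' where q': "q = [:- a x, 1:] * q'"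
    using insert.prems(2)[of x] by (auto simp: poly_eq_0_iff_dvd)
  have "poly q' (a j) = 0" if "j \<in> A" for j
  proof -
    have "a j \<noteq> a x" using that insert by (auto simp: inj_on_def)
    then show ?thesis using insert.prems(2)[of j] that by (simp add: q')
  qed
  then have "(\<Prod>j\<in>A. [:- a j, 1:]) dvd q'"
    using insert by (intro insert.IH) auto
  then show ?case
    unfolding q' prod.insert[OF insert.hyps] by (rule mult_dvd_mono[OF dvd_refl])
qed simp

context hypersurface
begin

definition cpol :: "complex poly" where
  "cpol = (\<Prod>j<r. [:- lam j, 1:])"

lemma cev_cpol: "rhom \<iota> \<Longrightarrow> cev \<iota> cpol y = pol \<iota> y"
  unfolding cpol_def pol_def by (simp add: rhom_prod[OF rhom_cev] cev_linear)

lemma poly_cpol: "poly cpol y = pol id y"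
  using cev_cpol[OF rhom_id] by simp

lemma degree_cpol: "degree cpol = r"
  unfolding cpol_def by (subst degree_prod_sum_eq) auto

lemma pderiv_cpol: "pderiv cpol = (\<Sum>j<r. \<Prod>k\<in>{..<r} - {j}. [:- lam k, 1:])"
  unfolding cpol_def by (simp add: pderiv_prod pderiv_pCons)

text \<open>The roots of P are simple, so P' is invertible modulo P.\<close>

lemma bezout:
  obtains A B where "A * cpol + B * pderiv cpol = 1"
proof -
  define d where "d j = (\<Prod>k\<in>{..<r} - {j}. (lam j - lam k))" for j
  have d: "d j \<noteq> 0" if "j < r" for j
    using that inj by (auto simp: d_def inj_on_def)
  let ?L = "\<lambda>j. \<Prod>k\<in>{..<r} - {j}. [:- lam k, 1:]"
  have L: "poly (?L j) (lam i) = (if j = i then d i else 0)" if "i < r" "j < r" for i j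
    using that unfolding poly_prod d_def by auto
  \<comment> \<open>Lagrange interpolation: the square in the denominator makes \<open>B\<close>
    take the value \<open>1 / d j\<close> at \<open>lam j\<close>, the inverse of P' there.\<close>
  define B where "B = (\<Sum>j<r. smult (1 / (d j)\<^sup>2) (?L j))"
  have "poly (1 - B * pderiv cpol) (lam i) = 0" if "i < r" for i
  proof -
    have "poly B (lam i) = (\<Sum>j<r. if j = i then 1 / d i else 0)"
      unfolding B_def poly_sum poly_smult
      by (intro sum.cong refl) (use that d in \<open>auto simp: L power2_eq_square\<close>)
    moreover have "poly (pderiv cpol) (lam i) = (\<Sum>j<r. if j = i then d i else 0)"
      unfolding pderiv_cpol poly_sum by (intro sum.cong refl) (use that in \<open>auto simp: L\<close>)
    ultimately show ?thesis using that d by simp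
  qed
  then have "cpol dvd 1 - B * pderiv cpol"
    unfolding cpol_def using inj by (intro linear_factors_dvd) auto
  then obtain A where "1 - B * pderiv cpol = cpol * A" by auto
  then have "A * cpol + B * pderiv cpol = 1" by (simp add: algebra_simps)
  then show ?thesis using that by blast
qed

text \<open>
  The fibre equation \<open>x^m z = P(y)\<close> with constant \<open>z \<noteq> 0\<close> has no nonconstant polynomial solutions:
  \<open>x^(m-1)\<close> divides both \<open>P(y)\<close> and \<open>P'(y) y'\<close>, hence \<open>y'\<close>, which is too big a divisor.
\<close>

lemma no_curve_with_constant_z:
  fixes X :: "nat \<Rightarrow> 'a::idom poly"
  assumes \<iota>: "rhom \<iota>" "\<And>c. \<iota> c = 0 \<Longrightarrow> c = 0"
    and X: "onX (\<lambda>c. [:\<iota> c:]) X" and z: "X (Suc n) \<noteq> 0" "degree (X (Suc n)) = 0"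
    and nz: "pol (\<lambda>c. [:\<iota> c:]) (X n) \<noteq> 0"
  shows "\<And>i. i < n + 2 \<Longrightarrow> degree (X i) = 0"
proof -
  let ?c = "\<lambda>c. [:\<iota> c:]"
  have rc: "rhom ?c" using rhom_comp[OF rhom_const_poly \<iota>(1)] by (simp add: o_def)
  define Y where "Y = X n"
  define W where "W = (\<Prod>i<n. X i ^ (m i - 1))"
  have eq: "xm X * X (Suc n) = pol ?c Y" using X by (simp add: onX_def Y_def)
  then have "xm X \<noteq> 0" using nz by (auto simp: Y_def)
  then have Xi: "X i \<noteq> 0" if "i < n" for i using that by (auto simp: xm_eq_0_iff)
  have Wx: "W dvd xm X"
    unfolding W_def xm_def by (intro prod_dvd_prod le_imp_power_dvd) simp
  then have W1: "W dvd pol ?c Y" by (metis eq dvd_mult2)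
  have "W dvd pderiv (xm X)"
    unfolding W_def xm_def by (rule prod_power_dvd_pderiv)
  with Wx have "W dvd pderiv (pol ?c Y)"
    unfolding eq[symmetric] pderiv_mult by (intro dvd_add dvd_mult dvd_mult2) (auto simp: mult.commute)
  also have "pderiv (pol ?c Y) = cev ?c (pderiv cpol) Y * pderiv Y"
    unfolding pderiv_cpol pol_def
    by (simp add: rhom_sum[OF rhom_cev[OF rc]] rhom_prod[OF rhom_cev[OF rc]] cev_linear[OF rc]
        pderiv_prod pderiv_diff pderiv_pCons sum_distrib_right)
  finally have W2: "W dvd cev ?c (pderiv cpol) Y * pderiv Y" .
  obtain A B where "A * cpol + B * pderiv cpol = 1" by (rule bezout)
  from arg_cong[OF this, of "\<lambda>q. cev ?c q Y"]
  have "cev ?c A Y * pol ?c Y + cev ?c B Y * cev ?c (pderiv cpol) Y = 1"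
    by (simp only: rhom_simps[OF rhom_cev[OF rc]] cev_cpol[OF rc])
  then have "pderiv Y = (cev ?c A Y * pol ?c Y + cev ?c B Y * cev ?c (pderiv cpol) Y) * pderiv Y"
    by simp
  also have "\<dots> = pderiv Y * cev ?c A Y * pol ?c Y + cev ?c B Y * (cev ?c (pderiv cpol) Y * pderiv Y)"
    by (simp only: algebra_simps)
  also have "W dvd \<dots>" by (intro dvd_add dvd_mult W1 W2)
  finally have dvd: "W dvd pderiv Y" .
  have dW: "degree W = (\<Sum>i<n. (m i - 1) * degree (X i))"
    unfolding W_def by (subst degree_prod_sum_eq) (auto simp: Xi degree_power_eq)
  have deg_shift: "degree (Y - ?c a) = degree Y" for a
  proof (cases "degree Y = 0")
    case True
    then obtain b where "Y = [:b:]" by (metis degree_0_id)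
    then show ?thesis by simp
  next
    case False
    have "degree (Y - [:\<iota> a:]) = degree (Y + [:- \<iota> a:])"
      by (simp only: diff_conv_add_uminus minus_pCons minus_zero)
    also have "\<dots> = degree Y" using False by (intro degree_add_eq_left) simp
    finally show ?thesis .
  qed
  have "degree (pol ?c Y) = (\<Sum>j<r. degree (Y - ?c (lam j)))"
    unfolding pol_def by (rule degree_prod_sum_eq) (use nz in \<open>auto simp: pol_eq_0_iff Y_def\<close>)
  then have "r * degree Y = degree (pol ?c Y)" by (simp add: deg_shift)
  also have "\<dots> = degree (xm X)"
    unfolding eq[symmetric] using \<open>xm X \<noteq> 0\<close> z by (simp add: degree_mult_eq)
  also have "\<dots> = (\<Sum>i<n. m i * degree (X i))"
    unfolding xm_def by (subst degree_prod_sum_eq) (auto simp: Xi degree_power_eq)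
  finally have deg: "r * degree Y = (\<Sum>i<n. m i * degree (X i))" .
  have Y0: "degree Y = 0"
  proof (rule ccontr)
    assume pos: "degree Y \<noteq> 0"
    then obtain d where d: "degree Y = Suc d" by (cases "degree Y") auto
    \<comment> \<open>Characteristic zero is inherited through the injectivity of \<iota>, so the
      leading coefficient of Y survives differentiation.\<close>
    have "\<iota> (of_nat (Suc d)) \<noteq> 0" using \<iota>(2)[of "of_nat (Suc d)"] of_nat_neq_0 by blast
    then have "(of_nat (Suc d) :: 'a) \<noteq> 0" by (simp only: rhom_of_nat[OF \<iota>(1)] not_False_eq_True)
    moreover have "lead_coeff Y \<noteq> 0" using pos by auto
    ultimately have "coeff (pderiv Y) d \<noteq> 0"
      by (simp add: coeff_pderiv d)
    then have "pderiv Y \<noteq> 0" by auto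
    then have "degree W \<le> degree (pderiv Y)" using dvd by (rule dvd_imp_degree_le[rotated])
    also have "degree (pderiv Y) \<le> d"
      by (rule degree_le) (simp add: coeff_pderiv coeff_eq_0 d)
    also have "d < degree Y" by (simp add: d)
    finally have lt: "degree W < degree Y" .
    \<comment> \<open>As m_i is at least 2, replacing m_i by m_i - 1 at most halves the degree. With
      r at least 2 this contradicts deg W < deg Y.\<close>
    have "m i * degree (X i) \<le> 2 * ((m i - 1) * degree (X i))" if "i < n" for i
    proof -
      have "m i \<le> 2 * (m i - 1)" using m1[OF that] by simp
      then show ?thesis unfolding mult.assoc[symmetric] by (rule mult_right_mono) simp
    qed
    then have "r * degree Y \<le> 2 * degree W"
      unfolding deg dW sum_distrib_left by (intro sum_mono) auto
    moreover have "2 * degree Y \<le> r * degree Y" using r2 by simp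
    ultimately show False using lt by linarith
  qed
  show "degree (X i) = 0" if i: "i < n + 2" for i
  proof -
    consider "i < n" | "i = n" | "i = Suc n" using i by linarith
    then show ?thesis
    proof cases
      case 1
      then have "m i * degree (X i) = 0" using deg Y0 by simp
      then show ?thesis using m1[OF 1] by simp
    qed (use Y0 z in \<open>auto simp: Y_def\<close>)
  qed
qed

end

subsection \<open>The generic point and its torus action\<close>

text \<open>The power s^k of the Laurent variable; integer exponents allow the negative weight of
  z.\<close>

definition spow :: "int \<Rightarrow> 'a::field fls" where
  "spow k = fls_X_intpow k"

lemma spow_0 [simp]: "spow 0 = 1" and spow_nonzero [simp]: "spow k \<noteq> 0"
  by (simp_all add: spow_def)

lemma spow_add: "spow (j + k) = spow j * spow k"
  unfolding spow_def by (rule fls_X_intpow_times_fls_X_intpow[symmetric])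

lemma spow_inverse: "spow k * spow (- k) = (1 :: 'a::field fls)"
  using spow_add[of k "- k", where 'a = 'a] by simp

lemma spow_mult_nat: "spow (k * int j) = spow k ^ j"
  unfolding spow_def by (subst fls_X_intpow_power) (simp add: mult.commute)

lemma spow_sum: "spow (sum f A) = (\<Prod>i\<in>A. spow (f i))"
  by (induction A rule: infinite_finite_induct) (auto simp: spow_add)

lemma nth_spow_mult: "fls_nth (spow k * f) j = fls_nth f (j - k)"
  by (simp_all add: spow_def fls_X_intpow_times_conv_shift)

lemma nth_spow: "fls_nth (spow k) j = (if j = k then 1 else 0)"
  by (simp add: spow_def)

abbreviation lcon :: "complex \<Rightarrow> cpoly fract fls" where
  "lcon c \<equiv> fls_const (fcon c)"

abbreviation pcon :: "complex \<Rightarrow> cpoly fract fls poly" where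
  "pcon c \<equiv> [:lcon c:]"

lemma rhom_lcon: "rhom lcon"
  using rhom_comp[OF rhom_fls_const rhom_fcon] by (simp add: o_def)

lemma rhom_pcon: "rhom pcon"
  using rhom_comp[OF rhom_const_poly rhom_lcon] by (simp add: o_def)

context hypersurface
begin

text \<open>For \<open>i0 < n\<close> the weights of x^m and z cancel and y has weight zero, so the
  equation of X is homogeneous of weight zero.\<close>

definition wt :: "nat \<Rightarrow> nat \<Rightarrow> int" where
  "wt i0 i = (if i = i0 then 1 else if i = Suc n then - int (m i0) else 0)"

definition mwt :: "nat \<Rightarrow> (nat \<Rightarrow>\<^sub>0 nat) \<Rightarrow> int" where
  "mwt i0 e = (\<Sum>i\<in>Poly_Mapping.keys e. wt i0 i * int (Poly_Mapping.lookup e i))"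

text \<open>The generic point moved by the multiplicative group acting with weights \<open>wt i0\<close>.\<close>

definition geta :: "nat \<Rightarrow> nat \<Rightarrow> cpoly fract fls" where
  "geta i0 i = spow (wt i0 i) * fls_const (gen i)"

lemma mon_spow: "mon (\<lambda>i. spow (a * wt i0 i)) e = spow (a * mwt i0 e)"
  unfolding mon_def mwt_def sum_distrib_left
  by (simp add: spow_sum mult.assoc[symmetric] spow_mult_nat)

lemma mon_const_spow: "mon (\<lambda>i. [:spow (a * wt i0 i):]) e = [:spow (a * mwt i0 e):]"
  using arg_cong[OF mon_spow[of a i0 e], of "\<lambda>c. [:c:]"]
  by (simp add: mon_def rhom_simps[OF rhom_const_poly])

text \<open>Only \<open>i0\<close> carries a positive weight, and only z a negative one. Zeros and
  poles in s thereby become divisibility by a coordinate.\<close>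

lemma mwt_pos:
  assumes "mwt i0 e > 0" shows "Poly_Mapping.lookup e i0 > 0"
proof (rule ccontr)
  assume "\<not> Poly_Mapping.lookup e i0 > 0"
  then have "mwt i0 e \<le> 0"
    unfolding mwt_def by (intro sum_nonpos) (auto simp: wt_def)
  then show False using assms by simp
qed

lemma mwt_neg:
  assumes "mwt i0 e < 0" shows "Poly_Mapping.lookup e (Suc n) > 0"
proof (rule ccontr)
  assume "\<not> Poly_Mapping.lookup e (Suc n) > 0"
  then have "mwt i0 e \<ge> 0"
    unfolding mwt_def by (intro sum_nonneg) (auto simp: wt_def)
  then show False using assms by simp
qed

text \<open>The torus multiplies the component of weight j by s^j, so the Laurent expansion along
  the orbit separates the components.\<close>

lemma nth_ev_geta: "fls_nth (ev lcon Q (geta i0)) k = ev fcon (wpart (mwt i0) k Q) gen"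
proof -
  let ?W = "mwt i0 ` Poly_Mapping.keys Q"
  have *: "ev lcon (wpart (mwt i0) j Q) (geta i0) = spow j * fls_const (ev fcon (wpart (mwt i0) j Q) gen)" for j
  proof -
    have "ev lcon (wpart (mwt i0) j Q) (geta i0) = spow j * ev lcon (wpart (mwt i0) j Q) (\<lambda>i. fls_const (gen i))"
      unfolding geta_def
      by (rule ev_homogeneous[OF rhom_lcon]) (use mon_spow[of 1 i0] in \<open>auto dest: keys_wpart\<close>)
    then show ?thesis
      using rhom_ev_apply[OF rhom_fcon rhom_fls_const, of _ gen] by (simp add: o_def)
  qed
  have "ev lcon Q (geta i0) = (\<Sum>j\<in>?W. spow j * fls_const (ev fcon (wpart (mwt i0) j Q) gen))"
    by (subst wpart_sum[of Q "mwt i0"]) (simp add: ev_sum[OF rhom_lcon] *)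
  then have "fls_nth (ev lcon Q (geta i0)) k = (\<Sum>j\<in>?W. if j = k then ev fcon (wpart (mwt i0) k Q) gen else 0)"
    by (simp only: fls_nth_sum) (intro sum.cong refl, simp add: nth_spow)
  also have "\<dots> = ev fcon (wpart (mwt i0) k Q) gen"
  proof (cases "k \<in> ?W")
    case False
    then have "{e \<in> Poly_Mapping.keys Q. mwt i0 e = k} = {}" by auto
    then have "wpart (mwt i0) k Q = 0" unfolding wpart_def by (simp only: sum.empty)
    then show ?thesis using False by (auto simp: ev_def)
  qed simp
  finally show ?thesis .
qed

lemma geta_nonzero: "i < n \<Longrightarrow> geta i0 i \<noteq> 0"
  using gen_nonzero[of i] by (simp add: geta_def)

lemma geta_onX:
  assumes "i0 < n" shows "onX lcon (geta i0)"
proof -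
  have "fls_nth (ev lcon J (geta i0)) k = 0" for k
  proof -
    have "ev fcon J gen = 0" using gen_onX by (simp add: ev_J[OF rhom_fcon] onX_def)
    have xmS: "xm (\<lambda>i. spow (wt i0 i) :: cpoly fract fls) = spow (int (m i0))"
      unfolding xm_def using assms
      by (subst prod.remove[of _ i0]) (auto simp: wt_def spow_mult_nat[of 1, simplified])
    have "xm (geta i0) = spow (int (m i0)) * xm (\<lambda>i. fls_const (gen i))"
      unfolding xmS[symmetric] by (simp add: xm_def geta_def power_mult_distrib prod.distrib)
    then have "xm (geta i0) * geta i0 (Suc n) = xm (\<lambda>i. fls_const (gen i)) * fls_const (gen (Suc n))"
      using assms spow_inverse[of "int (m i0)", where ?'a = "cpoly fract"]
      by (simp add: geta_def[of _ "Suc n"] wt_def mult_ac)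
    moreover have "geta i0 n = fls_const (gen n)" using assms by (simp add: geta_def wt_def)
    moreover have "onX lcon (\<lambda>i. fls_const (gen i))" using onX_hom[OF rhom_fls_const gen_onX] .
    ultimately show ?thesis
      by (simp add: ev_J[OF rhom_lcon] onX_def)
  qed
  then have "ev lcon J (geta i0) = 0" by (intro fls_eqI) simp
  then show ?thesis by (simp add: ev_J[OF rhom_lcon] onX_def)
qed

lemma geta_vanish_IX:
  assumes "Q \<in> polys (n + 2)" "ev lcon Q (geta i0) = 0"
  shows "Q \<in> IX"
proof (rule gen_vanish_IX[OF assms(1)])
  have "ev fcon (wpart (mwt i0) k Q) gen = 0" for k
    using nth_ev_geta[of Q i0 k] assms(2) by simp
  then show "ev fcon Q gen = 0"
    by (subst wpart_sum[of Q "mwt i0"]) (simp add: ev_sum[OF rhom_fcon])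
qed

lemma gen_n_neq: "gen n \<noteq> fcon c"
proof
  assume "gen n = fcon c"
  then have "Var n = Con c" by (simp add: gen_def eq_fract)
  then have "Poly_Mapping.lookup (Var n) (Poly_Mapping.single n (Suc 0))
      = Poly_Mapping.lookup (Con c) (Poly_Mapping.single n (Suc 0))" by simp
  then show False by (simp add: lookup_single when_def) (metis keys_single insert_not_empty keys_zero One_nat_def zero_neq_one)
qed

end

subsection \<open>Degeneration of families of curves\<close>

lemma map_poly_fls_const_0: "rhom h \<Longrightarrow> map_poly h [:c:] = [:h c:]"
  by (cases "c = 0") (auto simp: map_poly_pCons rhom_0)

lemma degree_eq_0_iff_coeffs: "degree p = 0 \<longleftrightarrow> (\<forall>j>0. coeff p j = 0)"
  by (metis coeff_eq_0 leading_coeff_0_iff neq0_conv degree_0)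

lemma rhom_fps_const: "rhom fps_const"
  by (rule rhomI) auto

context hypersurface
begin

lemma IX_vanish_extension:
  assumes \<xi>: "onX pcon \<xi>" "\<And>i. i < n + 2 \<Longrightarrow> coeff (\<xi> i) 0 = geta i0 i" and Q: "Q \<in> IX"
  shows "ev pcon Q \<xi> = 0"
proof (rule IX_vanish[OF rhom_pcon Q \<xi>(1)])
  show "\<xi> i \<noteq> 0" if "i < n" for i
    using \<xi>(2)[of i] geta_nonzero[OF that, of i0] that by auto
qed

lemma ev_geta_eq_coeff_0:
  assumes \<xi>: "\<And>i. i < n + 2 \<Longrightarrow> coeff (\<xi> i) 0 = geta i0 i" and Q: "Q \<in> polys (n + 2)"
  shows "poly (ev pcon Q \<xi>) 0 = ev lcon Q (geta i0)"
proof -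
  have "poly (ev pcon Q \<xi>) 0 = ev lcon Q (\<lambda>i. poly (\<xi> i) 0)"
    using rhom_ev_apply[OF rhom_pcon rhom_poly, of Q \<xi> 0] by (simp add: o_def)
  also have "\<dots> = ev lcon Q (geta i0)"
    by (rule ev_cong[OF Q]) (use \<xi> in \<open>auto simp: poly_0_coeff_0\<close>)
  finally show ?thesis .
qed

text \<open>
  Substituting \<open>s \<mapsto> s ^ p\<close>, \<open>T \<mapsto> s ^ q * T\<close> for the largest slope \<open>q / p\<close> makes the rescaled family
  integral with a nonconstant reduction at \<open>s = 0\<close>. An invariant function with a pole forces the
  \<open>z\<close>-coordinate of the reduction to be constant.
\<close>

lemma degeneration:
  assumes i0: "i0 < n" and \<xi>: "onX pcon \<xi>" "\<And>i. i < n + 2 \<Longrightarrow> coeff (\<xi> i) 0 = geta i0 i"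
    and Q: "Q \<in> polys (n + 2)" "ev pcon Q \<xi> = [:f:]" and f: "f \<noteq> 0" "fls_subdegree f < 0"
  shows "\<forall>i<n+2. degree (\<xi> i) = 0"
proof (rule ccontr)
  assume nonconst: "\<not> (\<forall>i<n+2. degree (\<xi> i) = 0)"
  define w where "w = wt i0"
  define sd where "sd i j = fls_subdegree (coeff (\<xi> i) j)" for i j
  define B where "B = {(i, j). i < n + 2 \<and> 0 < j \<and> coeff (\<xi> i) j \<noteq> 0}"
  have "B \<subseteq> (SIGMA i:{..<n+2}. {..degree (\<xi> i)})"
    by (auto simp: B_def intro: le_degree)
  then have finB: "finite B" by (rule finite_subset) simp
  have "B \<noteq> {}" using nonconst by (auto simp: B_def degree_eq_0_iff_coeffs)
  \<comment> \<open>After the substitution the coefficient of T^j in coordinate i has order p sd + q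
    j. This is at least p w exactly if q / p is at least \<open>slope\<close>; taking the maximum
    keeps everything integral and gives equality at one nonconstant coefficient.\<close>
  define slope where "slope = (\<lambda>(i, j). real_of_int (w i - sd i j) / real j)"
  have "Max (slope ` B) \<in> slope ` B" using finB \<open>B \<noteq> {}\<close> by (intro Max_in) auto
  then obtain b1 where b1: "b1 \<in> B" "slope b1 = Max (slope ` B)" by force
  obtain i1 j1 where ij: "b1 = (i1, j1)" by (cases b1)
  have B1: "(i1, j1) \<in> B" using b1 ij by simp
  have "slope b \<le> slope (i1, j1)" if "b \<in> B" for b
    using that finB b1(2) by (simp add: ij[symmetric])
  then have max: "real_of_int (w i - sd i j) / real j \<le> real_of_int (w i1 - sd i1 j1) / real j1"
    if "(i, j) \<in> B" for i j
    using that by (fastforce simp: slope_def)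
  define p where "p = j1"
  define q where "q = w i1 - sd i1 j1"
  have p: "p > 0" using B1 by (simp add: p_def B_def)
  have slope: "int p * (w i - sd i j) \<le> q * int j" if "(i, j) \<in> B" for i j
  proof -
    have "j > 0" using that by (simp add: B_def)
    then have "real_of_int (w i - sd i j) * real p \<le> real_of_int q * real j"
      using max[OF that] p by (simp add: p_def q_def field_simps)
    then have "real_of_int ((w i - sd i j) * int p) \<le> real_of_int (q * int j)" by simp
    then show ?thesis by (simp only: of_int_le_iff mult.commute)
  qed

  define h where "h = (\<lambda>g :: cpoly fract fls. fls_compose_power g p)"
  have rh: "rhom h" unfolding h_def by (rule rhom_fls_compose_power[OF p])
  define hm where "hm = (\<lambda>F. pcompose (map_poly h F) [:0, spow q:])"
  have rhm: "rhom hm"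
    using rhom_comp[OF rhom_pcompose rhom_map_poly[OF rh]] unfolding hm_def o_def .
  have hm_const: "hm [:g:] = [:h g:]" for g
    by (simp add: hm_def map_poly_fls_const_0[OF rh])
  have h_nth: "fls_nth (h g) k = (if int p dvd k then fls_nth g (k div int p) else 0)" for g k
    unfolding h_def using p by (simp add: fls_nth_compose_power)
  have hm_nth: "fls_nth (coeff (hm F) j) k = fls_nth (h (coeff F j)) (k - q * int j)" for F j k
    by (simp add: hm_def coeff_pcompose_linear spow_mult_nat[symmetric] nth_spow_mult coeff_map_poly rhom_0[OF rh])

  \<comment> \<open>For j = 0 the order is exactly w i by the shape of \<open>geta\<close>; for j >
    0 the choice of the slope applies.\<close>
  have integral: "fls_nth (coeff (hm (\<xi> i)) j) k = 0" if i: "i < n + 2" and k: "k < int p * w i" for i j k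
  proof (cases "int p dvd (k - q * int j)")
    case True
    then obtain l where l: "k - q * int j = int p * l" by auto
    have "fls_nth (coeff (\<xi> i) j) l = 0"
    proof (cases "coeff (\<xi> i) j = 0")
      case False
      have "int p * w i \<le> int p * sd i j + q * int j"
      proof (cases "j = 0")
        case True
        then have "coeff (\<xi> i) j = spow (w i) * fls_const (gen i)"
          using \<xi>(2)[OF i] by (simp add: geta_def w_def)
        moreover have "gen i \<noteq> 0" using False calculation by auto
        ultimately have "sd i j = w i" by (simp add: sd_def spow_def)
        then show ?thesis using True by simp
      next
        case False
        then have "(i, j) \<in> B" using i \<open>coeff (\<xi> i) j \<noteq> 0\<close> by (simp add: B_def)
        from slope[OF this] show ?thesis by (simp add: algebra_simps)
      qed
      then have "int p * l < int p * sd i j" using l k by linarith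
      then have "l < sd i j" using p by simp
      then show ?thesis by (simp add: sd_def)
    qed simp
    then show ?thesis using p by (simp add: hm_nth h_nth l)
  qed (simp add: hm_nth h_nth)

  \<comment> \<open>Embeds families over power series, where s = 0 can be substituted, into families
    over Laurent series.\<close>
  define Fl where "Fl = map_poly (fps_to_fls :: cpoly fract fps \<Rightarrow> _)"
  have rFl: "rhom Fl" unfolding Fl_def by (rule rhom_map_poly[OF rhom_fps_to_fls])
  have Fl_nth: "fls_nth (coeff (Fl F) j) k = (if k < 0 then 0 else fps_nth (coeff F j) (nat k))" for F j k
    by (simp add: Fl_def coeff_map_poly)
  have Fl_inj: "F = G" if "Fl F = Fl G" for F G
    using that by (auto simp: Fl_def poly_eq_iff coeff_map_poly)
  define \<theta> where "\<theta> i = map_poly (\<lambda>g. fls_regpart (spow (- int p * w i) * g)) (hm (\<xi> i))" for i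
  have hm_\<theta>: "hm (\<xi> i) = [:spow (int p * w i):] * Fl (\<theta> i)" if i: "i < n + 2" for i
  proof (rule poly_eqI, rule fls_eqI)
    fix j k
    have "fls_nth (coeff ([:spow (int p * w i):] * Fl (\<theta> i)) j) k
        = fls_nth (coeff (Fl (\<theta> i)) j) (k - int p * w i)"
      by (simp add: nth_spow_mult)
    also have "\<dots> = fls_nth (coeff (hm (\<xi> i)) j) k"
      using integral[OF i, of k j] by (simp add: Fl_nth \<theta>_def coeff_map_poly nth_spow_mult)
    finally show "fls_nth (coeff (hm (\<xi> i)) j) k = fls_nth (coeff ([:spow (int p * w i):] * Fl (\<theta> i)) j) k" ..
  qed

  define \<kappa> where "\<kappa> c = [:fps_const (fcon c):]" for c
  have r\<kappa>: "rhom \<kappa>"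
    using rhom_comp[OF rhom_const_poly rhom_comp[OF rhom_fps_const rhom_fcon]]
    by (simp add: \<kappa>_def[abs_def] o_def)
  have Fl_\<kappa>: "Fl (\<kappa> c) = pcon c" for c
    by (simp add: Fl_def \<kappa>_def map_poly_fls_const_0[OF rhom_fps_to_fls])
  have hm_pcon: "hm (pcon c) = pcon c" for c
    using p by (simp add: hm_const h_def)
  have Fl_ev: "Fl (ev \<kappa> R \<theta>) = ev pcon R (\<lambda>i. Fl (\<theta> i))" for R
    using rhom_ev_apply[OF r\<kappa> rFl, of R \<theta>] by (simp add: o_def Fl_\<kappa>)
  define Qk where "Qk k = wpart (mwt i0) k Q" for k
  have Qk: "Qk k \<in> polys (n + 2)" for k
    unfolding Qk_def by (rule wpart_in_polys[OF Q(1)])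
  have hm_ev: "hm (ev pcon (Qk k) \<xi>) = [:spow (int p * k):] * Fl (ev \<kappa> (Qk k) \<theta>)" for k
  proof -
    have "hm (ev pcon (Qk k) \<xi>) = ev pcon (Qk k) (\<lambda>i. hm (\<xi> i))"
      using rhom_ev_apply[OF rhom_pcon rhm, of "Qk k" \<xi>] by (simp add: o_def hm_pcon)
    also have "\<dots> = ev pcon (Qk k) (\<lambda>i. [:spow (int p * w i):] * Fl (\<theta> i))"
      by (rule ev_cong[OF Qk]) (use hm_\<theta> in auto)
    also have "\<dots> = [:spow (int p * k):] * ev pcon (Qk k) (\<lambda>i. Fl (\<theta> i))"
      by (rule ev_homogeneous[OF rhom_pcon]) (use mon_const_spow[of "int p" i0] in \<open>auto simp: Qk_def w_def dest!: keys_wpart\<close>)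
    finally show ?thesis by (simp add: Fl_ev)
  qed

  define kf where "kf = fls_subdegree f"
  have Qeta: "ev lcon Q (geta i0) = f"
    using ev_geta_eq_coeff_0[OF \<xi>(2) Q(1)] Q(2) by simp
  \<comment> \<open>Components of weight below the order of \<open>f\<close> vanish at the generic
    point, hence on all of X and along the whole family.\<close>
  have low: "ev \<kappa> (Qk k) \<theta> = 0" if "k < kf" for k
  proof -
    have "ev fcon (Qk k) gen = fls_nth f k"
      using nth_ev_geta[of Q i0 k] by (simp only: Qk_def Qeta)
    then have "Qk k \<in> IX" using that by (intro gen_vanish_IX[OF Qk]) (simp add: kf_def)
    then have "ev pcon (Qk k) \<xi> = 0" using IX_vanish_extension[of \<xi> i0] \<xi> by blast
    then have "[:spow (int p * k):] * Fl (ev \<kappa> (Qk k) \<theta>) = 0"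
      using hm_ev[of k] by (simp add: rhom_0[OF rhm])
    then have "Fl (ev \<kappa> (Qk k) \<theta>) = 0" by simp
    then show ?thesis using Fl_inj[of _ 0] rhom_0[OF rFl] by simp
  qed
  define red where "red = map_poly (\<lambda>g :: cpoly fract fps. fps_nth g 0)"
  have rred: "rhom red" unfolding red_def by (rule rhom_map_poly[OF rhom_fps_nth_0])
  have red_coeff: "coeff (red F) j = fps_nth (coeff F j) 0" for F j
    by (simp add: red_def coeff_map_poly)
  \<comment> \<open>In the coefficient of s^(p kf), lower components are zero and higher ones
    contribute only higher powers of s, so the component of weight \<open>kf\<close> alone accounts
    for the leading term of \<open>f\<close>.\<close>
  have red_top: "red (ev \<kappa> (Qk kf) \<theta>) = [:fls_nth f kf:]"
  proof (rule poly_eqI)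
    fix j
    let ?W = "mwt i0 ` Poly_Mapping.keys Q"
    have "hm [:f:] = (\<Sum>k\<in>?W. [:spow (int p * k):] * Fl (ev \<kappa> (Qk k) \<theta>))"
      unfolding Q(2)[symmetric] hm_ev[symmetric]
      by (subst wpart_sum[of Q "mwt i0"]) (simp add: ev_sum[OF rhom_pcon] rhom_sum[OF rhm] Qk_def)
    then have "fls_nth (coeff (hm [:f:]) j) (int p * kf)
        = (\<Sum>k\<in>?W. fls_nth (coeff (Fl (ev \<kappa> (Qk k) \<theta>)) j) (int p * (kf - k)))"
      by (simp add: coeff_sum fls_nth_sum nth_spow_mult right_diff_distrib)
    also have "\<dots> = (\<Sum>k\<in>?W. if k = kf then coeff (red (ev \<kappa> (Qk kf) \<theta>)) j else 0)"
    proof (intro sum.cong refl)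
      fix k
      consider "k < kf" | "k = kf" | "k > kf" by linarith
      then show "fls_nth (coeff (Fl (ev \<kappa> (Qk k) \<theta>)) j) (int p * (kf - k))
          = (if k = kf then coeff (red (ev \<kappa> (Qk kf) \<theta>)) j else 0)"
      proof cases
        case 3
        then have "int p * (kf - k) < 0" using p by (simp add: mult_pos_neg)
        then show ?thesis using 3 by (simp add: Fl_nth)
      qed (auto simp: low rhom_0[OF rFl] Fl_nth red_coeff)
    qed
    also have "\<dots> = coeff (red (ev \<kappa> (Qk kf) \<theta>)) j"
    proof (cases "kf \<in> ?W")
      case False
      then have "{e \<in> Poly_Mapping.keys Q. mwt i0 e = kf} = {}" by auto
      then have "Qk kf = 0" unfolding Qk_def wpart_def by (simp only: sum.empty)
      then show ?thesis using False by (auto simp: ev_def rhom_0[OF rred])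
    qed simp
    finally show "coeff (red (ev \<kappa> (Qk kf) \<theta>)) j = coeff [:fls_nth f kf:] j"
      using p by (cases j) (simp_all add: hm_const h_nth)
  qed

  define X where "X i = red (\<theta> i)" for i
  have red_\<kappa>: "red (\<kappa> c) = [:fcon c:]" for c
    by (simp add: red_def \<kappa>_def map_poly_fls_const_0[OF rhom_fps_nth_0])
  have fkf: "fls_nth f kf \<noteq> 0" using f by (simp add: kf_def)
  \<comment> \<open>\<open>kf\<close> is negative, so every monomial of this component contains z.
    After reduction z divides a nonzero constant.\<close>
  obtain H where "Qk kf = Var (Suc n) * H"
    by (rule polys_factor_Var[OF Qk[of kf], of "Suc n"])
      (use f in \<open>auto simp: Qk_def kf_def dest!: keys_wpart intro!: mwt_neg[of i0]\<close>)
  then have XH: "X (Suc n) * red (ev \<kappa> H \<theta>) = [:fls_nth f kf:]"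
    using red_top by (simp add: X_def ev_simps[OF r\<kappa>] rhom_mult[OF rred])
  then have "X (Suc n) \<noteq> 0" "red (ev \<kappa> H \<theta>) \<noteq> 0" using fkf by auto
  then have Xz: "X (Suc n) \<noteq> 0" "degree (X (Suc n)) = 0"
    using arg_cong[OF XH, of degree] by (auto simp: degree_mult_eq)

  have "onX \<kappa> \<theta>"
  proof -
    \<comment> \<open>Rescaling by \<open>u\<close> preserves the equation because the weights of
      x^m and z cancel; this passes the equation on to \<theta>.\<close>
    define u :: "nat \<Rightarrow> cpoly fract fls poly" where "u i = [:spow (int p * w i):]" for i
    have "w n = 0" using i0 by (simp add: w_def wt_def)
    then have un: "u n = 1" by (simp add: u_def one_pCons)
    have "xm u = (\<Prod>i<n. if i = i0 then [:spow (int p * int (m i0)):] else 1)"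
      unfolding xm_def u_def
      by (intro prod.cong refl)
        (auto simp: w_def wt_def spow_mult_nat rhom_power[OF rhom_const_poly] one_pCons[symmetric])
    then have xu: "xm u = [:spow (int p * int (m i0)):]" using i0 by simp
    have "u (Suc n) = [:spow (- (int p * int (m i0))):]" using i0 by (simp add: u_def w_def wt_def)
    then have u1: "xm u * u (Suc n) = 1" using spow_inverse by (simp add: xu one_pCons mult.commute)
    have "onX pcon (\<lambda>i. hm (\<xi> i))" using onX_hom[OF rhm \<xi>(1)] by (simp add: hm_pcon)
    then have "onX pcon (\<lambda>i. u i * Fl (\<theta> i))"
      using onX_cong[of "\<lambda>i. hm (\<xi> i)" "\<lambda>i. u i * Fl (\<theta> i)"] hm_\<theta> by (simp add: u_def)
    moreover have "xm (\<lambda>i. u i * Fl (\<theta> i)) = xm u * xm (\<lambda>i. Fl (\<theta> i))"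
      by (simp add: xm_def power_mult_distrib prod.distrib)
    ultimately have "(xm u * u (Suc n)) * (xm (\<lambda>i. Fl (\<theta> i)) * Fl (\<theta> (Suc n))) = pol pcon (Fl (\<theta> n))"
      by (simp add: onX_def un mult_ac)
    then have "Fl (xm \<theta> * \<theta> (Suc n)) = Fl (pol \<kappa> (\<theta> n))"
      by (simp add: u1 rhom_mult[OF rFl] xm_hom[OF rFl] pol_hom[OF rFl] Fl_\<kappa>)
    then show ?thesis unfolding onX_def by (rule Fl_inj)
  qed
  then have X_on: "onX (\<lambda>c. [:fcon c:]) X"
    using onX_hom[OF rred, of \<kappa> \<theta>] by (simp add: red_\<kappa> X_def[abs_def])
  have X_coeff: "coeff (X i) j = fls_nth (h (coeff (\<xi> i) j)) (int p * w i - q * int j)" if "i < n + 2" for i j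
    by (simp add: X_def red_coeff \<theta>_def coeff_map_poly nth_spow_mult hm_nth)
  \<comment> \<open>Since y has weight zero, the reduced y still starts with the generic y, which is
    no root of P.\<close>
  have "w n = 0" using i0 by (simp add: w_def wt_def)
  then have "coeff (X n) 0 = gen n"
    using X_coeff[of n 0] \<xi>(2)[of n] p i0 by (simp add: h_nth geta_def wt_def)
  then have "X n \<noteq> [:fcon (lam j):]" for j
    using gen_n_neq by (metis coeff_pCons_0)
  then have nz: "pol (\<lambda>c. [:fcon c:]) (X n) \<noteq> 0"
    by (simp add: pol_eq_0_iff)
  have "fcon c = 0 \<Longrightarrow> c = 0" for c
    by (metis fract_eq_0_iff lookup_single_eq lookup_zero)
  from no_curve_with_constant_z[OF rhom_fcon this X_on Xz nz]
  have "degree (X i1) = 0" using B1 by (simp add: B_def)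
  then have "coeff (X i1) j1 = 0"
    using B1 by (auto simp: degree_eq_0_iff_coeffs B_def)
  \<comment> \<open>The maximal slope is attained here, so the reduction keeps the leading
    coefficient in s, which is nonzero.\<close>
  moreover have "coeff (X i1) j1 = fls_nth (coeff (\<xi> i1) j1) (sd i1 j1)"
  proof -
    have "int p * w i1 - q * int j1 = int p * sd i1 j1"
      by (simp add: p_def q_def algebra_simps)
    then show ?thesis using X_coeff[of i1 j1] B1 p by (simp add: h_nth B_def)
  qed
  ultimately show False using B1 by (simp add: sd_def B_def)
qed

end

subsection \<open>Invariance of the coordinates \<open>x\<^sub>i\<close> under isomorphisms\<close>

lemma subdegree_spow: "fls_subdegree (spow k) = k"
  by (simp add: spow_def)

text \<open>Regards \<open>Q\<close> as a polynomial in the last coordinate, with the coefficients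
  recorded as values of polynomials in the others, so that their orders can be controlled.\<close>

lemma polys_univariate_in_last:
  assumes "Q \<in> polys (Suc N)" and \<iota>: "rhom \<iota>"
  shows "\<exists>p. (\<forall>j. \<exists>F\<in>polys N. coeff p j = ev \<iota> F w) \<and> poly p (w N) = ev \<iota> Q w"
  using assms(1)
proof (induction rule: polys_induct)
  case (Con c)
  have "\<exists>F\<in>polys N. coeff [:\<iota> c:] j = ev \<iota> F w" for j
    by (cases j) (auto intro: bexI[of _ "Con c"] bexI[of _ 0] simp: polys_Con polys_0 ev_simps[OF \<iota>])
  then show ?case by (intro exI[of _ "[:\<iota> c:]"]) (simp add: ev_simps[OF \<iota>])
next
  case (Var i)
  show ?case
  proof (cases "i = N")
    case True
    have "\<exists>F\<in>polys N. coeff [:0, 1:] j = ev \<iota> F w" for j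
      by (cases "j = 1") (auto intro: bexI[of _ 1] bexI[of _ 0] simp: polys_1 polys_0 ev_simps[OF \<iota>] coeff_pCons split: nat.splits)
    then show ?thesis using True by (intro exI[of _ "[:0, 1:]"]) (simp add: ev_simps[OF \<iota>])
  next
    case False
    then have i: "i < N" using Var by simp
    have "\<exists>F\<in>polys N. coeff [:w i:] j = ev \<iota> F w" for j
      by (cases j) (use i in \<open>auto intro: bexI[of _ "Var i"] bexI[of _ 0] simp: polys_Var polys_0 ev_simps[OF \<iota>]\<close>)
    then show ?thesis by (intro exI[of _ "[:w i:]"]) (simp add: ev_simps[OF \<iota>])
  qed
next
  case (add Q R)
  then obtain p q where p: "\<forall>j. \<exists>F\<in>polys N. coeff p j = ev \<iota> F w" "poly p (w N) = ev \<iota> Q w"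
    and q: "\<forall>j. \<exists>F\<in>polys N. coeff q j = ev \<iota> F w" "poly q (w N) = ev \<iota> R w" by blast
  have "\<exists>F\<in>polys N. coeff (p + q) j = ev \<iota> F w" for j
    using p(1) q(1) by (metis polys_add coeff_add ev_add[OF \<iota>])
  then show ?case using p q by (intro exI[of _ "p + q"]) (simp add: ev_simps[OF \<iota>])
next
  case (mult Q R)
  then obtain p q where p: "\<forall>j. \<exists>F\<in>polys N. coeff p j = ev \<iota> F w" "poly p (w N) = ev \<iota> Q w"
    and q: "\<forall>j. \<exists>F\<in>polys N. coeff q j = ev \<iota> F w" "poly q (w N) = ev \<iota> R w" by blast
  obtain F G where F: "\<And>j. F j \<in> polys N \<and> coeff p j = ev \<iota> (F j) w"
    and G: "\<And>j. G j \<in> polys N \<and> coeff q j = ev \<iota> (G j) w"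
    using p(1) q(1) by metis
  have "\<exists>F\<in>polys N. coeff (p * q) j = ev \<iota> F w" for j
  proof
    show "coeff (p * q) j = ev \<iota> (\<Sum>i\<le>j. F i * G (j - i)) w"
      using F G by (simp add: coeff_mult ev_simps[OF \<iota>])
    show "(\<Sum>i\<le>j. F i * G (j - i)) \<in> polys N"
      using F G by (intro polys_sum polys_mult) auto
  qed
  then show ?case using p q by (intro exI[of _ "p * q"]) (simp add: ev_simps[OF \<iota>])
qed

lemma subdegree_poly_at_pole:
  fixes p :: "'a::field fls poly"
  assumes "p \<noteq> 0" "\<And>j. fls_subdegree (coeff p j) = 0" "fls_subdegree v < 0"
  shows "poly p v \<noteq> 0 \<and> fls_subdegree (poly p v) \<le> 0"
  using assms(1,2)
proof (induction p)
  case (pCons a p)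
  have a: "fls_subdegree a = 0" using pCons.prems(2)[of 0] by simp
  show ?case
  proof (cases "p = 0")
    case True
    then show ?thesis using pCons.prems(1) a by simp
  next
    case False
    have "fls_subdegree (coeff p j) = 0" for j using pCons.prems(2)[of "Suc j"] by simp
    then have IH: "poly p v \<noteq> 0" "fls_subdegree (poly p v) \<le> 0" using pCons.IH False by auto
    have "v \<noteq> 0" using assms(3) by auto
    then have lt: "fls_subdegree (v * poly p v) < 0" using IH assms(3) by simp
    then have nz: "fls_nth (v * poly p v) (fls_subdegree (v * poly p v)) \<noteq> 0"
      using IH \<open>v \<noteq> 0\<close> by (simp del: fls_subdegree_mult)
    moreover have "fls_nth a (fls_subdegree (v * poly p v)) = 0"
      using lt a by (intro fls_eq0_below_subdegree) simp
    ultimately have nz': "fls_nth (poly (pCons a p) v) (fls_subdegree (v * poly p v)) \<noteq> 0" by simp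
    then have "fls_subdegree (poly (pCons a p) v) \<le> fls_subdegree (v * poly p v)"
      by (rule fls_subdegree_leI)
    moreover have "poly (pCons a p) v \<noteq> 0" using nz' by (metis fls_zero_nth)
    ultimately show ?thesis using lt by linarith
  qed
qed simp

text \<open>\<Phi> and \<Psi> are polynomial representatives of the two maps; they are determined
  only modulo the ideals, so the identities are required only at points of the
  hypersurfaces.\<close>

locale hypersurface_iso =
  X: hypersurface n m r lam + X': hypersurface n m' r lam
  for n :: nat and m m' :: "nat \<Rightarrow> nat" and r :: nat and lam :: "nat \<Rightarrow> complex" +
  fixes \<Phi> \<Psi> :: "nat \<Rightarrow> cpoly"
  assumes \<Phi>_polys: "j < n + 2 \<Longrightarrow> \<Phi> j \<in> polys (n + 2)" and \<Psi>_polys: "j < n + 2 \<Longrightarrow> \<Psi> j \<in> polys (n + 2)"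
    and \<Phi>_on: "X.onX id p \<Longrightarrow> X'.onX id (\<lambda>j. ev id (\<Phi> j) p)"
    and \<Psi>_on: "X'.onX id q \<Longrightarrow> X.onX id (\<lambda>j. ev id (\<Psi> j) q)"
    and \<Psi>\<Phi>: "X.onX id p \<Longrightarrow> j < n + 2 \<Longrightarrow> ev id (\<Psi> j) (\<lambda>j. ev id (\<Phi> j) p) = p j"
    and \<Phi>\<Psi>: "X'.onX id q \<Longrightarrow> j < n + 2 \<Longrightarrow> ev id (\<Phi> j) (\<lambda>j. ev id (\<Psi> j) q) = q j"
begin

lemma swap: "hypersurface_iso n m' m r lam \<Psi> \<Phi>"
  by unfold_locales (use \<Phi>_polys \<Psi>_polys \<Phi>_on \<Psi>_on \<Psi>\<Phi> \<Phi>\<Psi> in auto)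

lemma pullback_polys: "Q \<in> polys N \<Longrightarrow> N \<le> n + 2 \<Longrightarrow> ev Con Q \<Phi> \<in> polys (n + 2)"
  by (rule ev_Con_in_polys) (auto intro!: \<Phi>_polys[simplified])

lemma pullback_IX: "Q \<in> X'.IX \<Longrightarrow> ev Con Q \<Phi> \<in> X.IX"
  unfolding X.IX_def X'.IX_def using pullback_polys[of Q "n + 2"] \<Phi>_on by (simp add: ev_ev[OF rhom_id])

text \<open>The pullback on functions is injective: compose once more with the inverse map.\<close>

lemma pullback_IX_D:
  assumes Q: "Q \<in> polys (n + 2)" and IX: "ev Con Q \<Phi> \<in> X.IX"
  shows "Q \<in> X'.IX"
proof -
  have "ev id Q q = 0" if q: "X'.onX id q" for q
  proof -
    have "ev id (ev Con Q \<Phi>) (\<lambda>j. ev id (\<Psi> j) q) = 0"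
      using IX \<Psi>_on[OF q] by (simp add: X.IX_def)
    then have "ev id Q (\<lambda>j. ev id (\<Phi> j) (\<lambda>j. ev id (\<Psi> j) q)) = 0"
      by (simp add: ev_ev[OF rhom_id])
    also have "ev id Q (\<lambda>j. ev id (\<Phi> j) (\<lambda>j. ev id (\<Psi> j) q)) = ev id Q q"
      by (rule ev_cong[OF Q]) (use \<Phi>\<Psi>[OF q] in auto)
    finally show ?thesis .
  qed
  then show ?thesis using Q by (simp add: X'.IX_def)
qed

context
  fixes \<iota> :: "complex \<Rightarrow> 'a::idom" and \<xi> :: "nat \<Rightarrow> 'a"
  assumes \<iota>: "rhom \<iota>" and \<xi>: "X.onX \<iota> \<xi>" "\<And>i. i < n \<Longrightarrow> \<xi> i \<noteq> 0"
begin

lemma image_on: "X'.onX \<iota> (\<lambda>j. ev \<iota> (\<Phi> j) \<xi>)"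
  using X.IX_vanish[OF \<iota> pullback_IX[OF X'.J_in_IX] \<xi>]
  by (simp add: ev_ev[OF \<iota>] X'.ev_J[OF \<iota>] X'.onX_def)

lemma image_inverse:
  assumes j: "j < n + 2"
  shows "ev \<iota> (\<Psi> j) (\<lambda>j. ev \<iota> (\<Phi> j) \<xi>) = \<xi> j"
proof -
  have "ev Con (\<Psi> j) \<Phi> - Var j \<in> X.IX"
    unfolding X.IX_def
    using pullback_polys[OF \<Psi>_polys[OF j]] \<Psi>\<Phi>[OF _ j] polys_Var[OF j]
    by (auto intro!: polys_diff simp: ev_simps[OF rhom_id] ev_ev[OF rhom_id])
  from X.IX_vanish[OF \<iota> this \<xi>] show ?thesis
    by (simp add: ev_simps[OF \<iota>] ev_ev[OF \<iota>])
qed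

end

text \<open>The section y = lam 0, z = 0. Restricting an invariant function to it writes the
  function as a polynomial in x alone.\<close>

definition sec :: "nat \<Rightarrow> cpoly" where
  "sec j = (if j < n then Var j else if j = n then Con (lam 0) else 0)"

lemma sec_polys: "sec j \<in> polys n"
  by (simp add: sec_def polys_Con polys_Var polys_0)

lemma ev_sec: "rhom \<iota> \<Longrightarrow> ev \<iota> (sec j) p = (if j < n then p j else if j = n then \<iota> (lam 0) else 0)"
  by (simp add: sec_def ev_simps)

lemma sec_onX: "rhom \<iota> \<Longrightarrow> X'.onX \<iota> (\<lambda>j. ev \<iota> (sec j) p)"
  using X.r2 X'.pol_split[of 0 \<iota>] by (simp add: X'.onX_def ev_sec)


text \<open>The additive orbit through the image \<open>w\<close> of the moved generic point is
  pulled back to a family \<xi> on X. Once coordinate \<open>i0\<close> of \<xi> is constant in T,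
  sliding to the section computes it from x' alone; genericity of \<open>e\<close> turns this into
  an identity on X'.\<close>

lemma coordinate_invariant:
  assumes i0: "i0 < n"
  shows "\<exists>g\<in>polys n. \<forall>q. X'.onX id q \<longrightarrow> ev id (\<Psi> i0) q = ev id g q"
proof -
  interpret sw: hypersurface_iso n m' m r lam \<Psi> \<Phi> by (rule swap)
  define e where "e = X.geta i0"
  have e_on: "X.onX lcon e" unfolding e_def by (rule X.geta_onX[OF i0])
  have e_nz: "e i \<noteq> 0" if "i < n" for i unfolding e_def using that by (rule X.geta_nonzero)
  have e_vanish: "Q \<in> X'.IX" if "Q \<in> polys (n + 2)" "ev lcon Q (\<lambda>j. ev lcon (\<Phi> j) e) = 0" for Q
    using that by (intro pullback_IX_D X.geta_vanish_IX[of _ i0] pullback_polys)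
      (auto simp: ev_ev[OF rhom_lcon] e_def)
  define w where "w j = ev lcon (\<Phi> j) e" for j
  have w_on: "X'.onX lcon w"
    unfolding w_def by (rule image_on[OF rhom_lcon e_on e_nz])
  have \<Psi>w: "ev lcon (\<Psi> j) w = e j" if "j < n + 2" for j
    unfolding w_def by (rule image_inverse[OF rhom_lcon e_on e_nz that])
  have w_nz: "w i \<noteq> 0" if i: "i < n" for i
  proof
    assume "w i = 0"
    then have "Var i \<in> X'.IX"
      using i by (intro e_vanish polys_Var) (auto simp: ev_simps[OF rhom_lcon] w_def)
    then show False
      using sec_onX[OF rhom_id, of "\<lambda>_. 1"] i
      by (auto simp: X'.IX_def ev_simps[OF rhom_id] ev_sec[OF rhom_id])
  qed
  have xw: "X'.xm w \<noteq> 0" using w_nz by (rule X'.xm_nonzero)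
  define v where "v = w n"
  \<comment> \<open>The orbit of \<open>w\<close> under the additive action with rescaled time: x'
    is fixed, y' is translated by T, and the equation dictates z'.\<close>
  define \<zeta> where "\<zeta> j = (if j < n then [:w j:] else if j = n then [:v, 1:]
      else smult (1 / X'.xm w) (X'.pol pcon [:v, 1:]))" for j
  have "X'.xm \<zeta> = X'.xm (\<lambda>i. [:w i:])" by (rule X'.xm_cong) (simp add: \<zeta>_def)
  also have "\<dots> = [:X'.xm w:]" by (rule X'.xm_hom[OF rhom_const_poly, symmetric])
  finally have \<zeta>_on: "X'.onX pcon \<zeta>" using xw by (simp add: X'.onX_def \<zeta>_def)
  have \<zeta>_nz: "\<zeta> i \<noteq> 0" if "i < n" for i using w_nz[OF that] that by (simp add: \<zeta>_def)
  define \<xi> where "\<xi> j = ev pcon (\<Psi> j) \<zeta>" for j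
  have \<xi>_on: "X.onX pcon \<xi>"
    unfolding \<xi>_def by (rule sw.image_on[OF rhom_pcon \<zeta>_on \<zeta>_nz])
  have \<Phi>\<xi>: "ev pcon (\<Phi> j) \<xi> = \<zeta> j" if "j < n + 2" for j
    unfolding \<xi>_def by (rule sw.image_inverse[OF rhom_pcon \<zeta>_on \<zeta>_nz that])
  have poly_\<xi>: "poly (\<xi> j) a = ev lcon (\<Psi> j) (\<lambda>i. poly (\<zeta> i) a)" for j a
    using rhom_ev_apply[OF rhom_pcon rhom_poly, of "\<Psi> j" \<zeta> a] by (simp add: \<xi>_def o_def)
  have poly_\<zeta>: "poly (\<zeta> j) a = (if j < n then w j else if j = n then v + a
      else X'.pol lcon (v + a) / X'.xm w)" for j a
    using X'.pol_hom[OF rhom_poly[of a], of pcon "[:v, 1:]"] by (simp add: \<zeta>_def)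
  have \<xi>0: "coeff (\<xi> j) 0 = X.geta i0 j" if j: "j < n + 2" for j
  proof -
    have "coeff (\<xi> j) 0 = ev lcon (\<Psi> j) (\<lambda>i. poly (\<zeta> i) 0)"
      using poly_\<xi>[of j 0] by (simp add: poly_0_coeff_0)
    also have "\<dots> = ev lcon (\<Psi> j) w"
    proof (rule ev_cong[OF \<Psi>_polys[OF j]])
      show "poly (\<zeta> i) 0 = w i" if "i < n + 2" for i
      proof -
        have "i < n \<or> i = n \<or> i = Suc n" using that by linarith
        then show ?thesis
          using w_on xw by (auto simp: poly_\<zeta> v_def X'.onX_def field_simps)
      qed
    qed
    finally show ?thesis using \<Psi>w[OF j] by (simp add: e_def)
  qed
  have "degree (\<xi> i0) = 0"
  \<comment> \<open>Some polynomial in x' has a pole or a zero in s at \<open>w\<close>, or all of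
    them have order 0. A nonzero \<open>fls_subdegree\<close> already implies that the value is
    nonzero.\<close>
  proof (cases "\<exists>F\<in>polys n. fls_subdegree (ev lcon F w) \<noteq> 0")
    case True
    then obtain F where F: "F \<in> polys n" "fls_subdegree (ev lcon F w) \<noteq> 0" by blast
    define f where "f = ev lcon F w"
    define Q where "Q = ev Con F \<Phi>"
    have Q: "Q \<in> polys (n + 2)" unfolding Q_def using F by (intro pullback_polys) auto
    have f0: "f \<noteq> 0" using F by (auto simp: f_def)
    have Q\<xi>: "ev pcon Q \<xi> = [:f:]"
    proof -
      have "ev pcon Q \<xi> = ev pcon F (\<lambda>j. [:w j:])"
        unfolding Q_def ev_ev[OF rhom_pcon]
        by (rule ev_cong[OF F(1)]) (simp add: \<Phi>\<xi> \<zeta>_def)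
      then show ?thesis
        using rhom_ev_apply[OF rhom_lcon rhom_const_poly, of F w] by (simp add: f_def o_def)
    qed
    have Qe: "ev lcon Q e = f"
      by (simp add: Q_def ev_ev[OF rhom_lcon] f_def w_def[abs_def])
    show ?thesis
    proof (cases "fls_subdegree f < 0")
      case True
      then show ?thesis
        using X.degeneration[OF i0 \<xi>_on \<xi>0 Q Q\<xi> f0] i0 by simp
    next
      case False
      then have pos: "fls_subdegree f > 0" using F by (simp add: f_def)
      \<comment> \<open>\<open>f\<close> has positive order, so components of weight at most 0
        vanish on X and the others are divisible by the coordinate \<open>i0\<close>.\<close>
      have "\<xi> i0 dvd ev pcon (wpart (X.mwt i0) k Q) \<xi>" for k
      proof (cases "k > 0")
        case True
        obtain H where "wpart (X.mwt i0) k Q = Var i0 * H"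
          by (rule polys_factor_Var[OF wpart_in_polys[OF Q], of "X.mwt i0" k i0])
            (use True in \<open>auto dest!: keys_wpart intro!: X.mwt_pos\<close>)
        then show ?thesis by (simp add: ev_simps[OF rhom_pcon])
      next
        case False
        have "ev fcon (wpart (X.mwt i0) k Q) X.gen = 0"
          using X.nth_ev_geta[of Q i0 k] Qe False pos by (simp add: e_def)
        then have "wpart (X.mwt i0) k Q \<in> X.IX"
          by (intro X.gen_vanish_IX wpart_in_polys Q)
        then have "ev pcon (wpart (X.mwt i0) k Q) \<xi> = 0"
          using X.IX_vanish_extension[of \<xi> i0] \<xi>_on \<xi>0 by blast
        then show ?thesis by simp
      qed
      then have "\<xi> i0 dvd [:f:]"
        unfolding Q\<xi>[symmetric]
        by (subst wpart_sum[of Q "X.mwt i0"]) (auto simp: ev_sum[OF rhom_pcon] intro!: dvd_sum)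
      then show ?thesis using dvd_imp_degree_le[of "\<xi> i0" "[:f:]"] f0 by simp
    qed
  next
    case False
    then have F0: "fls_subdegree (ev lcon F w) = 0" if "F \<in> polys n" for F using that by auto
    have "X'.xm w = ev lcon (X'.xm Var) w" by (simp add: X'.ev_xm[OF rhom_lcon])
    then have sx: "fls_subdegree (X'.xm w) = 0"
      using F0 X'.xm_in_polys[of Var n] by (simp add: polys_Var del: One_nat_def)
    show ?thesis
    \<comment> \<open>If y' has no pole, then all coordinates of \<open>w\<close> are power series
      and so is their image z; but z has order - m i0.\<close>
    proof (cases "fls_subdegree v \<ge> 0")
      case True
      have lift: "\<exists>F. f = fps_to_fls F" if "fls_subdegree f \<ge> 0" for f :: "cpoly fract fls"
        using that by (metis fls_regpart_to_fls_trivial)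
      obtain V where V: "v = fps_to_fls V" using lift[OF True] by blast
      have fcon_lift: "lcon c = fps_to_fls (fps_const (fcon c))" for c by simp
      have "X'.pol lcon v = fps_to_fls (X'.pol (\<lambda>c. fps_const (fcon c)) V)"
        unfolding V fcon_lift by (rule X'.pol_hom[OF rhom_fps_to_fls, symmetric])
      then have "fls_subdegree (X'.pol lcon v) \<ge> 0"
        by (simp only: fls_subdegree_fls_to_fps_gt0)
      moreover have "X'.xm w * w (Suc n) = X'.pol lcon v"
        using w_on by (simp add: X'.onX_def v_def)
      ultimately have su: "fls_subdegree (w (Suc n)) \<ge> 0"
        using xw sx by (cases "w (Suc n) = 0") (auto dest: arg_cong[of _ _ fls_subdegree])
      have "\<exists>F. w j = fps_to_fls F" if "j < n + 2" for j
      proof (rule lift)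
        have "j < n \<or> j = n \<or> j = Suc n" using that by linarith
        then show "fls_subdegree (w j) \<ge> 0"
          using F0[of "Var j"] True su by (auto simp: v_def polys_Var ev_simps[OF rhom_lcon] simp del: One_nat_def)
      qed
      then obtain W where W: "\<And>j. j < n + 2 \<Longrightarrow> w j = fps_to_fls (W j)" by metis
      have "e (Suc n) = ev lcon (\<Psi> (Suc n)) (\<lambda>j. fps_to_fls (W j))"
        unfolding \<Psi>w[of "Suc n", simplified, symmetric]
        by (rule ev_cong[OF \<Psi>_polys]) (use W in auto)
      also have "\<dots> = fps_to_fls (ev (\<lambda>c. fps_const (fcon c)) (\<Psi> (Suc n)) W)"
        using rhom_ev_apply[OF rhom_comp[OF rhom_fps_const rhom_fcon] rhom_fps_to_fls, of "\<Psi> (Suc n)" W]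
        by (simp add: o_def)
      finally have "fls_subdegree (e (Suc n)) \<ge> 0" by (simp only: fls_subdegree_fls_to_fps_gt0)
      moreover have "X.gen (Suc n) \<noteq> 0"
        using X.gen_onX X.gen_n_neq by (auto simp: X.onX_def X.pol_eq_0_iff dest: sym)
      then have "fls_subdegree (e (Suc n)) = - int (m i0)"
        using i0 by (simp add: e_def X.geta_def X.wt_def subdegree_spow)
      ultimately show ?thesis using X.m1[OF i0] by simp
    next
      case False
      \<comment> \<open>Up to a factor of order 0, coordinate \<open>i0\<close> is a polynomial in
        y' with coefficients of order 0. A pole of y' makes its order at most 0, whereas it is
        1.\<close>
      obtain N G H where G: "G \<in> polys (n + 1)" "X'.xm Var ^ N * \<Psi> i0 = G + X'.J * H"
        using X'.clear_denominator[OF \<Psi>_polys[of i0]] i0 by auto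
      from arg_cong[OF this(2), of "\<lambda>Q. ev lcon Q w"]
      have eq: "X'.xm w ^ N * e i0 = ev lcon G w"
        using w_on \<Psi>w[of i0] i0
        by (simp add: ev_simps[OF rhom_lcon] X'.ev_xm[OF rhom_lcon] X'.ev_J[OF rhom_lcon] X'.onX_def)
      obtain p where p: "\<And>j. \<exists>F\<in>polys n. coeff p j = ev lcon F w" "poly p v = ev lcon G w"
        using polys_univariate_in_last[of G n, OF _ rhom_lcon, of w] G(1) by (auto simp: v_def)
      have "ev lcon G w \<noteq> 0" using eq xw e_nz[OF i0] by (metis mult_eq_0_iff power_not_zero)
      then have "p \<noteq> 0" using p(2) by auto
      moreover have "fls_subdegree (coeff p j) = 0" for j using p(1)[of j] F0 by auto
      ultimately have "fls_subdegree (ev lcon G w) \<le> 0"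
        using subdegree_poly_at_pole[of p v] False p(2) by simp
      moreover have "fls_subdegree (ev lcon G w) = 1"
      proof -
        have "fls_subdegree (X'.xm w ^ N * e i0) = fls_subdegree (X'.xm w ^ N) + fls_subdegree (e i0)"
          by (rule fls_subdegree_mult) (use xw e_nz[OF i0] in auto)
        moreover have "fls_subdegree (e i0) = 1"
          using X.gen_nonzero[of i0] i0 by (simp add: e_def X.geta_def X.wt_def subdegree_spow)
        ultimately show ?thesis by (simp add: eq fls_subdegree_pow sx)
      qed
      ultimately show ?thesis by simp
    qed
  qed
  then obtain c where c: "\<xi> i0 = [:c:]" by (metis degree_0_id)
  have i2: "i0 < n + 2" using i0 by simp
  have ce: "c = e i0" using \<xi>0[OF i2] by (simp add: c e_def)
  define g where "g = ev Con (\<Psi> i0) sec"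
  have g: "g \<in> polys n" unfolding g_def by (rule ev_Con_in_polys[OF \<Psi>_polys[OF i2] sec_polys])
  have "ev lcon g w = e i0"
  proof -
    \<comment> \<open>At T = lam 0 - v the family meets the section: x' is unchanged, y' = lam 0 and
      z' = 0.\<close>
    have "e i0 = ev lcon (\<Psi> i0) (\<lambda>i. poly (\<zeta> i) (lcon (lam 0) - v))"
      unfolding poly_\<xi>[symmetric] by (simp add: c ce)
    also have "\<dots> = ev lcon (\<Psi> i0) (\<lambda>i. ev lcon (sec i) w)"
      using X.r2 X'.pol_split[of 0 lcon]
      by (intro arg_cong[of _ _ "ev lcon (\<Psi> i0)"] ext) (simp add: poly_\<zeta> ev_sec[OF rhom_lcon])
    finally show ?thesis by (simp add: g_def ev_ev[OF rhom_lcon])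
  qed
  then have "\<Psi> i0 - g \<in> X'.IX"
    using polys_mono[OF _ g, of "n + 2"] \<Psi>_polys[OF i2] \<Psi>w[OF i2]
    by (intro e_vanish polys_diff) (auto simp: ev_simps[OF rhom_lcon] w_def[symmetric, abs_def])
  then show ?thesis
    using g by (auto simp: X'.IX_def ev_simps[OF rhom_id])
qed

end

subsection \<open>The induced isomorphism of the bases\<close>

lemma evid_simps:
  "ev id (Con c) p = c" "ev id (Var i) p = p i" "ev id 0 p = 0" "ev id 1 p = 1"
  "ev id (Q + R) p = ev id Q p + ev id R p" "ev id (Q * R) p = ev id Q p * ev id R p"
  "ev id (Q - R) p = ev id Q p - ev id R p" "ev id (Q ^ k) p = ev id Q p ^ k"
  by (simp_all only: ev_simps[OF rhom_id] id_apply)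

section \<open>Factors of monomials\<close>

lemma lookup_mult_unique:
  fixes Q R :: cpoly
  assumes "\<And>a b. a \<in> Poly_Mapping.keys Q \<Longrightarrow> b \<in> Poly_Mapping.keys R \<Longrightarrow> a + b = e + e' \<Longrightarrow> a = e \<and> b = e'"
    and "e \<in> Poly_Mapping.keys Q" "e' \<in> Poly_Mapping.keys R"
  shows "Poly_Mapping.lookup (Q * R) (e + e') = Poly_Mapping.lookup Q e * Poly_Mapping.lookup R e'"
proof -
  let ?k = Poly_Mapping.keys and ?l = Poly_Mapping.lookup
  have "Q * R = (\<Sum>a\<in>?k Q. Poly_Mapping.single a (?l Q a)) * (\<Sum>b\<in>?k R. Poly_Mapping.single b (?l R b))"
    by (simp add: cpoly_sum_monomials)
  also have "\<dots> = (\<Sum>a\<in>?k Q. \<Sum>b\<in>?k R. Poly_Mapping.single (a + b) (?l Q a * ?l R b))"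
    by (simp add: sum_product mult_single)
  finally have "?l (Q * R) (e + e') = (\<Sum>a\<in>?k Q. \<Sum>b\<in>?k R. if a + b = e + e' then ?l Q a * ?l R b else 0)"
    by (simp add: lookup_sum lookup_single when_def eq_commute)
  also have "\<dots> = (\<Sum>a\<in>?k Q. \<Sum>b\<in>?k R. if a = e then if b = e' then ?l Q e * ?l R e' else 0 else 0)"
    using assms(1) by (intro sum.cong refl) auto
  also have "\<dots> = (\<Sum>a\<in>?k Q. if a = e then ?l Q e * ?l R e' else 0)"
    using assms(3) by (intro sum.cong refl) auto
  also have "\<dots> = ?l Q e * ?l R e'" using assms(2) by simp
  finally show ?thesis .
qed

text \<open>In the linear order on exponents, the top terms of the factors multiply to the top term
  of the product, and the bottom terms to the bottom term. For a monomial these coincide, which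
  leaves only one exponent in \<open>Q\<close>.\<close>

lemma factor_of_monomial:
  fixes Q R :: cpoly
  assumes QR: "Q * R = Poly_Mapping.single e c" and c: "c \<noteq> 0"
  obtains a d where "Q = Poly_Mapping.single a d" "d \<noteq> 0"
proof -
  let ?k = Poly_Mapping.keys and ?l = Poly_Mapping.lookup
  have "Q * R \<noteq> 0" using QR c by (metis lookup_single_eq lookup_zero)
  then have ne: "?k Q \<noteq> {}" "?k R \<noteq> {}" by auto
  have mx: "a = Max (?k Q) \<and> b = Max (?k R)"
    if "a \<in> ?k Q" "b \<in> ?k R" "a + b = Max (?k Q) + Max (?k R)" for a b
  proof -
    have "a \<le> Max (?k Q)" "b \<le> Max (?k R)" using that by auto
    then show ?thesis using that(3)
      by (metis add_le_less_mono add_less_le_mono order_le_less order_less_irrefl)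
  qed
  have mn: "a = Min (?k Q) \<and> b = Min (?k R)"
    if "a \<in> ?k Q" "b \<in> ?k R" "a + b = Min (?k Q) + Min (?k R)" for a b
  proof -
    have "Min (?k Q) \<le> a" "Min (?k R) \<le> b" using that by auto
    then show ?thesis using that(3)
      by (metis add_le_less_mono add_less_le_mono order_le_less order_less_irrefl)
  qed
  have "?l (Q * R) (Max (?k Q) + Max (?k R)) \<noteq> 0"
    using ne by (subst lookup_mult_unique) (auto dest: mx simp flip: in_keys_iff)
  moreover have "?l (Q * R) (Min (?k Q) + Min (?k R)) \<noteq> 0"
    using ne by (subst lookup_mult_unique) (auto dest: mn simp flip: in_keys_iff)
  ultimately have "Max (?k Q) + Max (?k R) = Min (?k Q) + Min (?k R)"
    by (simp add: QR lookup_single when_def split: if_splits)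
  then have "Max (?k Q) = Min (?k Q)" using mn[of "Max (?k Q)" "Max (?k R)"] ne by simp
  have "a = Max (?k Q)" if "a \<in> ?k Q" for a
  proof (rule antisym)
    show "a \<le> Max (?k Q)" using that by simp
    show "Max (?k Q) \<le> a" unfolding \<open>Max (?k Q) = Min (?k Q)\<close> using that by simp
  qed
  then obtain a where a: "?k Q = {a}" using ne by blast
  then have "Q = Poly_Mapping.single a (?l Q a)"
    using cpoly_sum_monomials[of Q] by simp
  then show ?thesis using that[of a "?l Q a"] a by (metis in_keys_iff singletonI)
qed

lemma prod_single:
  "(\<Prod>i\<in>A. Poly_Mapping.single (e i) (c i) ^ k i) =
    Poly_Mapping.single (\<Sum>i\<in>A. of_nat (k i) * e i) (\<Prod>i\<in>A. c i ^ k i :: complex)"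
  for e :: "nat \<Rightarrow> nat \<Rightarrow>\<^sub>0 nat" and A :: "nat set"
proof -
  have pow: "Poly_Mapping.single a d ^ j = Poly_Mapping.single (of_nat j * a) (d ^ j)"
    for a :: "nat \<Rightarrow>\<^sub>0 nat" and d :: complex and j
    by (induction j) (auto simp: mult_single algebra_simps)
  show ?thesis
    by (induction A rule: infinite_finite_induct) (auto simp: pow mult_single)
qed

lemma cpoly_eqI:
  assumes "Q \<in> polys N" "R \<in> polys N" "\<And>p. (\<And>i. p i \<noteq> 0) \<Longrightarrow> ev id Q p = ev id R p"
  shows "Q = R"
proof (rule ccontr)
  assume "Q \<noteq> R"
  then obtain p where "\<And>i. p i \<noteq> 0" "ev id (Q - R) p \<noteq> 0"
    using nonzero_at_torus_point[of "Q - R" N] polys_diff[OF assms(1,2)] by auto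
  then show False using assms(3)[of p] by (simp add: evid_simps)
qed

lemma cev_Con_in_polys: "C \<in> polys N \<Longrightarrow> cev Con q C \<in> polys N"
  by (induction q) (auto simp: cev_pCons[OF rhom_Con] intro: polys_intros)

lemma ev_cev_Con: "ev id (cev Con q C) p = poly q (ev id C p)"
proof (induction q)
  case 0
  show ?case by (simp only: map_poly_0 poly_0 evid_simps)
next
  case (pCons a q)
  then show ?case by (simp only: cev_pCons[OF rhom_Con] evid_simps poly_pCons)
qed

text \<open>Makes the first two Taylor coefficients along the chart parameter available as
  polynomials in x.\<close>

lemma linear_coefficient_polys:
  assumes "Q \<in> polys (Suc N)"
  shows "\<exists>D0\<in>polys N. \<exists>D\<in>polys N. \<forall>x. ev id Q (x(N := 0)) = ev id D0 x \<and>
    ((\<lambda>t. ev id Q (x(N := t))) has_field_derivative ev id D x) (at 0)"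
    (is "?P Q")
proof -
  have I: "?P Q" if "D0 \<in> polys N" "D \<in> polys N" "\<And>x. ev id Q (x(N := 0)) = ev id D0 x"
    "\<And>x. ((\<lambda>t. ev id Q (x(N := t))) has_field_derivative ev id D x) (at 0)" for Q D0 D
    using that by blast
  show ?thesis
    using assms
  proof (induction rule: polys_induct)
    case (Con c)
    show ?case
      by (rule I[OF polys_Con[of c] polys_0]) (simp_all only: evid_simps DERIV_const)
  next
    case (Var i)
    show ?case
    proof (cases "i = N")
      case True
      show ?thesis unfolding True
        by (rule I[OF polys_0 polys_1]) (simp_all only: evid_simps fun_upd_same DERIV_ident)
    next
      case False
      then have "i < N" using Var by simp
      with False show ?thesis
        by (intro I[OF polys_Var[of i] polys_0]) (simp_all only: evid_simps fun_upd_apply if_False DERIV_const)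
    qed
  next
    case (add Q R)
    then obtain D0 D E0 E where D: "D0 \<in> polys N" "D \<in> polys N"
      "\<forall>x. ev id Q (x(N := 0)) = ev id D0 x \<and>
        ((\<lambda>t. ev id Q (x(N := t))) has_field_derivative ev id D x) (at 0)"
      and E: "E0 \<in> polys N" "E \<in> polys N"
      "\<forall>x. ev id R (x(N := 0)) = ev id E0 x \<and>
        ((\<lambda>t. ev id R (x(N := t))) has_field_derivative ev id E x) (at 0)"
      by (elim bexE)
    show ?case
    proof (rule I[OF polys_add[OF D(1) E(1)] polys_add[OF D(2) E(2)]])
      fix x :: "nat \<Rightarrow> complex"
      show "ev id (Q + R) (x(N := 0)) = ev id (D0 + E0) x"
        using D(3) E(3) by (simp only: evid_simps)
      show "((\<lambda>t. ev id (Q + R) (x(N := t))) has_field_derivative ev id (D + E) x) (at 0)"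
        unfolding evid_simps by (rule DERIV_add) (use D(3) E(3) in blast)+
    qed
  next
    case (mult Q R)
    then obtain D0 D E0 E where D: "D0 \<in> polys N" "D \<in> polys N"
      "\<forall>x. ev id Q (x(N := 0)) = ev id D0 x \<and>
        ((\<lambda>t. ev id Q (x(N := t))) has_field_derivative ev id D x) (at 0)"
      and E: "E0 \<in> polys N" "E \<in> polys N"
      "\<forall>x. ev id R (x(N := 0)) = ev id E0 x \<and>
        ((\<lambda>t. ev id R (x(N := t))) has_field_derivative ev id E x) (at 0)"
      by (elim bexE)
    have "D * E0 + E * D0 \<in> polys N"
      by (intro polys_add polys_mult D E)
    then show ?case
    proof (rule I[OF polys_mult[OF D(1) E(1)]])
      fix x :: "nat \<Rightarrow> complex"
      have QR: "ev id Q (x(N := 0)) = ev id D0 x" "ev id R (x(N := 0)) = ev id E0 x"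
        "((\<lambda>t. ev id Q (x(N := t))) has_field_derivative ev id D x) (at 0)"
        "((\<lambda>t. ev id R (x(N := t))) has_field_derivative ev id E x) (at 0)"
        using D(3) E(3) by blast+
      show "ev id (Q * R) (x(N := 0)) = ev id (D0 * E0) x"
        by (simp only: evid_simps QR)
      show "((\<lambda>t. ev id (Q * R) (x(N := t))) has_field_derivative ev id (D * E0 + E * D0) x) (at 0)"
        using DERIV_mult[OF QR(3,4)] unfolding evid_simps QR(1,2) .
    qed
  qed
qed

text \<open>\<open>f\<close> and \<open>g\<close> come from the invariance of the coordinates and
  describe the isomorphism on the bases.\<close>

locale hypersurface_iso_base = hypersurface_iso +
  fixes f g :: "nat \<Rightarrow> cpoly"
  assumes f_polys: "i < n \<Longrightarrow> f i \<in> polys n" and g_polys: "i < n \<Longrightarrow> g i \<in> polys n"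
    and \<Phi>_f: "i < n \<Longrightarrow> X.onX id p \<Longrightarrow> ev id (\<Phi> i) p = ev id (f i) p"
    and \<Psi>_g: "i < n \<Longrightarrow> X'.onX id q \<Longrightarrow> ev id (\<Psi> i) q = ev id (g i) q"
begin

lemma swap_base: "hypersurface_iso_base n m' m r lam \<Psi> \<Phi> g f"
  using swap unfolding hypersurface_iso_base_def hypersurface_iso_base_axioms_def
  using f_polys g_polys \<Phi>_f \<Psi>_g by auto

definition fp :: "(nat \<Rightarrow> complex) \<Rightarrow> nat \<Rightarrow> complex" where
  "fp x j = ev id (f j) x"

definition pt :: "(nat \<Rightarrow> complex) \<Rightarrow> complex \<Rightarrow> nat \<Rightarrow> complex" where
  "pt x y j = (if j < n then x j else if j = n then y else X.pol id y / X.xm x)"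

definition secp :: "nat \<Rightarrow> nat \<Rightarrow> cpoly" where
  "secp k j = (if j < n then Var j else if j = n then Con (lam k) else 0)"

text \<open>Over x with x^m nonzero the fibre is a line with coordinate y; \<open>V x\<close> is y'
  of the image point as a polynomial in that coordinate.\<close>

definition V :: "(nat \<Rightarrow> complex) \<Rightarrow> complex poly" where
  "V x = ev (\<lambda>c. [:c:]) (\<Phi> n)
    (\<lambda>j. if j < n then [:x j:] else if j = n then [:0, 1:] else smult (1 / X.xm x) X.cpol)"

lemma secp_onX: "k < r \<Longrightarrow> X.onX id (\<lambda>j. ev id (secp k j) x)"
  by (auto simp: X.onX_def secp_def evid_simps X.pol_eq_0_iff)

lemma poly_V: "poly (V x) y = ev id (\<Phi> n) (pt x y)"
proof -
  have "poly (V x) y = ev id (\<Phi> n) (\<lambda>j. poly (if j < n then [:x j:] else if j = n then [:0, 1:]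
      else smult (1 / X.xm x) X.cpol) y)"
    using rhom_ev_apply[OF rhom_const_poly rhom_poly, of "\<Phi> n" _ y]
    by (simp add: V_def o_def id_def)
  also have "(\<lambda>j. poly (if j < n then [:x j:] else if j = n then [:0, 1:]
      else smult (1 / X.xm x) X.cpol) y) = pt x y"
    by (auto simp: pt_def X.poly_cpol)
  finally show ?thesis .
qed

lemma X_eq_pt:
  assumes "X.onX id p" "\<And>j. j < n \<Longrightarrow> p j = x j" "X.xm x \<noteq> 0" "j < n + 2"
  shows "p j = pt x (p n) j"
proof -
  have "X.xm p = X.xm x" by (rule X.xm_cong) (rule assms(2))
  moreover have "j < n \<or> j = n \<or> j = Suc n" using assms(4) by linarith
  ultimately show ?thesis using assms by (auto simp: pt_def X.onX_def field_simps)
qed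

lemma \<Phi>_n_eq_V:
  assumes "X.onX id p" "\<And>j. j < n \<Longrightarrow> p j = x j" "X.xm x \<noteq> 0"
  shows "ev id (\<Phi> n) p = poly (V x) (p n)"
  unfolding poly_V by (rule ev_cong[OF \<Phi>_polys[of n]]) (simp, rule X_eq_pt[OF assms])

lemma V_lam:
  assumes "X.xm x \<noteq> 0" "k < r"
  shows "poly (V x) (lam k) = ev id (ev Con (\<Phi> n) (secp k)) x"
  using \<Phi>_n_eq_V[OF secp_onX[OF assms(2), of x] _ assms(1)]
  by (simp add: ev_ev[OF rhom_id]) (simp add: secp_def evid_simps)

lemma pt_onX: "X.xm x \<noteq> 0 \<Longrightarrow> X.onX id (pt x y)"
  using X.xm_cong[of "pt x y" x] by (simp add: X.onX_def pt_def)

lemma g_f: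
  assumes i: "i < n"
  shows "ev id (g i) (fp x) = x i"
proof -
  define p where "p = (\<lambda>j. ev id (secp 0 j) x)"
  have p: "X.onX id p" unfolding p_def using X.r2 by (intro secp_onX) simp
  have px: "p j = x j" if "j < n" for j using that by (simp add: p_def secp_def evid_simps)
  have "x i = ev id (\<Psi> i) (\<lambda>j. ev id (\<Phi> j) p)"
    using \<Psi>\<Phi>[OF p, of i] i px by simp
  also have "\<dots> = ev id (g i) (\<lambda>j. ev id (\<Phi> j) p)"
    by (rule \<Psi>_g[OF i \<Phi>_on[OF p]])
  also have "\<dots> = ev id (g i) (fp x)"
  proof (rule ev_cong[OF g_polys[OF i]])
    fix j assume j: "j < n"
    have "ev id (\<Phi> j) p = ev id (f j) p" by (rule \<Phi>_f[OF j p])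
    also have "\<dots> = fp x j" unfolding fp_def by (rule ev_cong[OF f_polys[OF j]]) (rule px)
    finally show "ev id (\<Phi> j) p = fp x j" .
  qed
  finally show ?thesis ..
qed

lemma \<Phi>_fp:
  assumes "X.onX id p" "\<And>j. j < n \<Longrightarrow> p j = x j" "i < n"
  shows "ev id (\<Phi> i) p = fp x i"
  using \<Phi>_f[OF assms(3,1)] ev_cong[OF f_polys[OF assms(3)], of p x id] assms(2)
  by (simp add: fp_def)

text \<open>Where x'^m' = 0, the coordinate y' is a root of P, so it would be constant along the
  fibre over x. But pulling back points with y' = lam 0 and y' = lam 1 shows that it takes both
  values on that fibre.\<close>

lemma fp_torus:
  assumes x: "X.xm x \<noteq> 0"
  shows "X'.xm (fp x) \<noteq> 0"
proof
  interpret sw: hypersurface_iso_base n m' m r lam \<Psi> \<Phi> g f by (rule swap_base)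
  assume 0: "X'.xm (fp x) = 0"
  have "poly (pcompose X.cpol (V x)) y = 0" for y
  proof -
    have on: "X.onX id (pt x y)" by (rule pt_onX[OF x])
    have "X'.xm (\<lambda>j. ev id (\<Phi> j) (pt x y)) = X'.xm (fp x)"
      by (intro X'.xm_cong \<Phi>_fp on) (auto simp: pt_def)
    then have "X.pol id (ev id (\<Phi> n) (pt x y)) = 0"
      using \<Phi>_on[OF on] 0 by (simp add: X'.onX_def)
    then show ?thesis by (simp add: poly_pcompose X.poly_cpol poly_V)
  qed
  then have "pcompose X.cpol (V x) = 0" using poly_all_0_iff_0 by blast
  moreover have "X.cpol \<noteq> 0" using X.degree_cpol X.r2 by auto
  ultimately have deg: "degree (V x) = 0" using pcompose_eq_0 by blast
  have "\<exists>y. poly (V x) y = lam k" if k: "k < r" for k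
  proof -
    define q where "q = (\<lambda>j. ev id (sw.secp k j) (fp x))"
    have q: "X'.onX id q" unfolding q_def by (rule sw.secp_onX[OF k])
    define p where "p = (\<lambda>j. ev id (\<Psi> j) q)"
    have p: "X.onX id p" unfolding p_def by (rule \<Psi>_on[OF q])
    have "p j = x j" if "j < n" for j
    proof -
      have "p j = ev id (g j) q" unfolding p_def by (rule \<Psi>_g[OF that q])
      also have "\<dots> = ev id (g j) (fp x)"
        by (rule ev_cong[OF g_polys[OF that]]) (simp add: q_def sw.secp_def evid_simps)
      finally show ?thesis using g_f[OF that] by simp
    qed
    then have "poly (V x) (p n) = ev id (\<Phi> n) p" using \<Phi>_n_eq_V[OF p _ x] by simp
    also have "\<dots> = q n" unfolding p_def by (rule \<Phi>\<Psi>[OF q]) simp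
    also have "\<dots> = lam k" by (simp add: q_def sw.secp_def evid_simps)
    finally show ?thesis by blast
  qed
  from this[of 0] this[of 1] obtain y0 y1 where "poly (V x) y0 = lam 0" "poly (V x) y1 = lam 1"
    using X.r2 by auto
  moreover obtain c where "V x = [:c:]" using deg by (metis degree_0_id)
  ultimately have "lam 0 = lam 1" by simp
  then show False using inj_onD[OF X.inj, of 0 1] X.r2 by simp
qed

end

context hypersurface_iso_base
begin

text \<open>The inverse isomorphism inverts the fibre maps. Degrees multiply under composition,
  which will make both maps affine.\<close>

lemma V_inverse:
  assumes x: "X.xm x \<noteq> 0"
  shows "pcompose (hypersurface_iso_base.V n m' r lam \<Psi> (fp x)) (V x) = [:0, 1:]"
proof -
  interpret sw: hypersurface_iso_base n m' m r lam \<Psi> \<Phi> g f by (rule swap_base)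
  have "poly (pcompose (sw.V (fp x)) (V x)) y = poly [:0, 1:] y" for y
  proof -
    define q where "q = (\<lambda>j. ev id (\<Phi> j) (pt x y))"
    have on: "X.onX id (pt x y)" by (rule pt_onX[OF x])
    have q: "X'.onX id q" unfolding q_def by (rule \<Phi>_on[OF on])
    have "q j = fp x j" if "j < n" for j
      unfolding q_def by (rule \<Phi>_fp[OF on _ that]) (simp add: pt_def)
    then have "ev id (\<Psi> n) q = poly (sw.V (fp x)) (q n)"
      by (rule sw.\<Phi>_n_eq_V[OF q _ fp_torus[OF x]])
    moreover have "ev id (\<Psi> n) q = pt x y n" unfolding q_def by (rule \<Psi>\<Phi>[OF on]) simp
    ultimately show ?thesis by (simp add: poly_pcompose poly_V q_def) (simp add: pt_def)
  qed
  then show ?thesis using poly_eq_poly_eq_iff by blast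
qed

lemma V_degree:
  assumes x: "X.xm x \<noteq> 0"
  shows "degree (V x) = 1" "degree (hypersurface_iso_base.V n m' r lam \<Psi> (fp x)) = 1"
  using arg_cong[OF V_inverse[OF x], of degree] by (auto simp: degree_pcompose)

text \<open>The slope of \<open>V x\<close> as a difference quotient between two sections, which
  exhibits it as a polynomial in x.\<close>

definition A :: cpoly where
  "A = Con (1 / (lam 0 - lam 1)) * (ev Con (\<Phi> n) (secp 0) - ev Con (\<Phi> n) (secp 1))"

lemma secp_polys: "secp k j \<in> polys n"
  by (auto simp: secp_def intro: polys_intros)

lemma \<Phi>_secp_polys: "j < n + 2 \<Longrightarrow> ev Con (\<Phi> j) (secp k) \<in> polys n"
  by (rule ev_Con_in_polys[OF \<Phi>_polys secp_polys])

lemma A_polys: "A \<in> polys n"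
  unfolding A_def by (intro polys_intros \<Phi>_secp_polys) simp_all

lemma degree_1_eq: "degree p = 1 \<Longrightarrow> p = [:coeff p 0, coeff p 1:]"
  by (intro poly_eqI) (auto simp: coeff_pCons coeff_eq_0 split: nat.splits)

lemma ev_A:
  assumes x: "X.xm x \<noteq> 0"
  shows "ev id A x = coeff (V x) 1"
proof -
  have lam: "lam 0 - lam 1 \<noteq> 0" using inj_onD[OF X.inj, of 0 1] X.r2 by auto
  have "ev id A x = (poly (V x) (lam 0) - poly (V x) (lam 1)) / (lam 0 - lam 1)"
    using V_lam[OF x, of 0] V_lam[OF x, of 1] X.r2 unfolding A_def evid_simps by simp
  also have "\<dots> = coeff (V x) 1"
    by (subst (1 2) degree_1_eq[OF V_degree(1)[OF x]]) (use lam in \<open>simp add: field_simps\<close>)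
  finally show ?thesis .
qed

lemma A_unit:
  assumes x: "X.xm x \<noteq> 0"
  shows "ev id A x * ev id (hypersurface_iso_base.A n lam \<Psi>) (fp x) = 1"
proof -
  interpret sw: hypersurface_iso_base n m' m r lam \<Psi> \<Phi> g f by (rule swap_base)
  have "coeff (pcompose (sw.V (fp x)) (V x)) 1 = coeff (sw.V (fp x)) 1 * coeff (V x) 1"
    by (subst degree_1_eq[OF V_degree(1)[OF x]], subst degree_1_eq[OF V_degree(2)[OF x]])
      (simp add: pcompose_pCons)
  then show ?thesis
    using ev_A[OF x] sw.ev_A[OF fp_torus[OF x]] by (simp add: V_inverse[OF x] mult.commute)
qed

text \<open>
  Along the chart \<open>y = lam 0 + x^m t\<close> both \<open>P(V) / f^m'\<close> and its derivative
  \<open>P'(V) a x^m / f^m'\<close> at \<open>t = 0\<close> are polynomials in \<open>x\<close>; as \<open>P\<close> and \<open>P'\<close> generate the unit ideal,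
  so is \<open>a x^m / f^m'\<close>, and \<open>a\<close> is a unit.
\<close>

lemma xm_divisible:
  obtains R where "R \<in> polys n" "X.xm Var = X'.xm f * R"
proof -
  define K where "K = ev Con (\<Phi> (Suc n)) (X.chart Con 0 Var)"
  have "K \<in> polys (Suc n)"
    unfolding K_def using ev_Con_in_polys[OF \<Phi>_polys X.chart_in_polys] by simp
  from linear_coefficient_polys[OF this] obtain D0 D where D: "D0 \<in> polys n" "D \<in> polys n"
    "\<And>x. ev id K (x(n := 0)) = ev id D0 x"
    "\<And>x. ((\<lambda>t. ev id K (x(n := t))) has_field_derivative ev id D x) (at 0)" by blast
  obtain A0 B0 where bez: "A0 * X.cpol + B0 * pderiv X.cpol = 1" by (rule X.bezout)
  define C where "C = ev Con (\<Phi> n) (secp 0)"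
  have C: "C \<in> polys n" unfolding C_def by (rule \<Phi>_secp_polys) simp
  define A' where "A' = hypersurface_iso_base.A n lam \<Psi>"
  have "A' \<in> polys n"
    unfolding A'_def by (rule hypersurface_iso_base.A_polys[OF swap_base])
  then have A'f: "ev Con A' f \<in> polys n" by (rule ev_Con_in_polys[OF _ f_polys])
  \<comment> \<open>With M = f^m', the Taylor coefficients satisfy M D0 = P(c) and M D = P'(c) a
    x^m. The Bezout combination yields a x^m, and the last factor is the inverse of a, by
    \<open>A_unit\<close>.\<close>
  define R where "R = (A * X.xm Var * cev Con A0 C * D0 + cev Con B0 C * D) * ev Con A' f"
  have R: "R \<in> polys n"
    unfolding R_def by (intro polys_add polys_mult A'f D cev_Con_in_polys C A_polys X.xm_in_polys polys_Var)
  have "X.xm Var = X'.xm f * R"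
  proof (rule cpoly_eqI)
    show "X.xm Var \<in> polys n" by (intro X.xm_in_polys polys_Var)
    show "X'.xm f * R \<in> polys n" by (intro polys_mult R X'.xm_in_polys f_polys)
    fix x :: "nat \<Rightarrow> complex" assume nz: "\<And>i. x i \<noteq> 0"
    then have x: "X.xm x \<noteq> 0" by (intro X.xm_nonzero)
    define M where "M = X'.xm (fp x)"
    define a where "a = coeff (V x) 1"
    define c where "c = poly (V x) (lam 0)"
    \<comment> \<open>The equation of X' at the image of a chart point: y' is affine in the chart
      parameter, with slope a x^m.\<close>
    have key: "M * ev id K (x(n := t)) = poly X.cpol (c + a * X.xm x * t)" for t
    proof -
      define p where "p = X.chart id 0 (x(n := t))"
      have p: "X.onX id p" unfolding p_def using X.r2 by (intro X.chart_onX) simp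
      have px: "p j = x j" if "j < n" for j using that by (simp add: p_def X.chart_lt)
      have "X'.xm (\<lambda>j. ev id (\<Phi> j) p) = M"
        unfolding M_def by (rule X'.xm_cong) (rule \<Phi>_fp[OF p px])
      then have "M * ev id (\<Phi> (Suc n)) p = X.pol id (ev id (\<Phi> n) p)"
        using \<Phi>_on[OF p] by (simp add: X'.onX_def)
      moreover have "ev id (\<Phi> (Suc n)) p = ev id K (x(n := t))"
        unfolding K_def ev_ev[OF rhom_id] X.ev_chart[OF rhom_id] p_def ..
      moreover have "ev id (\<Phi> n) p = poly (V x) (p n)" by (rule \<Phi>_n_eq_V[OF p px x])
      moreover have "poly (V x) (p n) = c + a * X.xm x * t"
      proof -
        have "p n = lam 0 + X.xm x * t" by (simp add: p_def X.chart_def)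
        moreover have "V x = [:coeff (V x) 0, a:]" unfolding a_def by (rule degree_1_eq[OF V_degree(1)[OF x]])
        then have "poly (V x) y = poly [:coeff (V x) 0, a:] y" for y
          by (rule arg_cong)
        then have "poly (V x) y = coeff (V x) 0 + a * y" for y
          by (simp only: poly_pCons poly_0 mult_zero_right add_0_right mult.commute)
        ultimately show ?thesis by (simp add: c_def algebra_simps)
      qed
      ultimately show ?thesis by (simp add: X.poly_cpol)
    qed
    have k0: "M * ev id D0 x = poly X.cpol c" using key[of 0] by (simp add: D(3))
    have "((\<lambda>t. M * ev id K (x(n := t))) has_field_derivative M * ev id D x) (at 0)"
      by (rule DERIV_cmult[OF D(4)])
    moreover have "((\<lambda>t. poly X.cpol (c + a * X.xm x * t)) has_field_derivative
        poly (pderiv X.cpol) (c + a * X.xm x * 0) * (a * X.xm x)) (at 0)"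
      by (rule DERIV_chain2[OF poly_DERIV]) (auto intro!: derivative_eq_intros)
    ultimately have k1: "M * ev id D x = poly (pderiv X.cpol) c * (a * X.xm x)"
      unfolding key by (auto dest: DERIV_unique)
    have evC: "ev id C x = c" unfolding C_def c_def using V_lam[OF x, of 0] X.r2 by simp
    have evA: "ev id A x = a" unfolding a_def by (rule ev_A[OF x])
    have evA': "ev id (ev Con A' f) x = ev id A' (fp x)"
      unfolding ev_ev[OF rhom_id] fp_def ..
    have unit: "a * ev id A' (fp x) = 1" unfolding A'_def evA[symmetric] by (rule A_unit[OF x])
    have bez': "poly A0 c * poly X.cpol c + poly B0 c * poly (pderiv X.cpol) c = 1"
      using arg_cong[OF bez, of "\<lambda>q. poly q c"] by simp
    have "M * ev id R x = (a * X.xm x * poly A0 c * (M * ev id D0 x) + poly B0 c * (M * ev id D x)) * ev id A' (fp x)"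
      unfolding R_def evid_simps ev_cev_Con evC evA evA' X.ev_xm[OF rhom_id] by (simp add: algebra_simps)
    also have "\<dots> = X.xm x * (a * ev id A' (fp x)) *
        (poly A0 c * poly X.cpol c + poly B0 c * poly (pderiv X.cpol) c)"
      unfolding k0 k1 by (simp add: algebra_simps)
    also have "\<dots> = X.xm x" unfolding unit bez' by simp
    finally have "M * ev id R x = X.xm x" .
    moreover have "ev id (X'.xm f) x = M"
      unfolding M_def using X'.xm_hom[OF rhom_ev[OF rhom_id, of x], of f] by (simp add: fp_def[abs_def])
    ultimately show "ev id (X.xm Var) x = ev id (X'.xm f * R) x"
      unfolding evid_simps X.ev_xm[OF rhom_id] by simp
  qed
  then show ?thesis using that R by blast
qed

text \<open>Each f_i divides the monomial x^m, so it is a monomial up to a scalar. As g inverts f,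
  every x_j is one of these up to a scalar; comparing exponents of x_j in f^m' and x^m gives the
  inequality.\<close>

lemma exponent_matching:
  obtains \<tau> where "inj_on \<tau> {..<n}" "\<tau> ` {..<n} \<subseteq> {..<n}" "\<And>j. j < n \<Longrightarrow> m' (\<tau> j) \<le> m j"
proof -
  let ?l = Poly_Mapping.lookup
  obtain R where R: "R \<in> polys n" "X.xm Var = X'.xm f * R" by (rule xm_divisible)
  define \<mu> where "\<mu> = (\<Sum>i<n. of_nat (m i) * Poly_Mapping.single i (Suc 0))"
  have \<mu>: "?l \<mu> j = m j" if "j < n" for j
  proof -
    have "?l (of_nat k * Poly_Mapping.single i (Suc 0)) j = (if i = j then k else 0)" for k i
      by (induction k) (auto simp: lookup_add lookup_single when_def distrib_right)
    then show ?thesis using that by (simp add: \<mu>_def lookup_sum)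
  qed
  have xm: "X.xm Var = Poly_Mapping.single \<mu> 1"
    unfolding X.xm_def \<mu>_def using prod_single[of "\<lambda>i. Poly_Mapping.single i (Suc 0)" "\<lambda>_. 1" m "{..<n}"] by simp
  have "\<exists>k d. f i = Poly_Mapping.single k d \<and> d \<noteq> 0" if i: "i < n" for i
  proof -
    have "f i ^ m' i = f i * f i ^ (m' i - 1)"
      using X'.m1[OF i] by (metis Suc_diff_1 less_trans zero_less_one power_Suc)
    then have "X'.xm f = f i * (f i ^ (m' i - 1) * (\<Prod>j\<in>{..<n} - {i}. f j ^ m' j))"
      unfolding X'.xm_def using i by (simp add: prod.remove[of _ i] mult.assoc)
    then have "f i * (f i ^ (m' i - 1) * (\<Prod>j\<in>{..<n} - {i}. f j ^ m' j) * R) = Poly_Mapping.single \<mu> 1"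
      using R(2) xm by (simp add: mult.assoc)
    then show ?thesis by (metis factor_of_monomial zero_neq_one)
  qed
  then obtain k d where kd: "\<And>i. i < n \<Longrightarrow> f i = Poly_Mapping.single (k i) (d i) \<and> d i \<noteq> 0" by metis
  define \<nu> where "\<nu> = (\<Sum>i<n. of_nat (m' i) * k i)"
  have "X'.xm f = (\<Prod>i<n. Poly_Mapping.single (k i) (d i) ^ m' i)"
    unfolding X'.xm_def by (intro prod.cong refl) (use kd in auto)
  then have xf: "X'.xm f = Poly_Mapping.single \<nu> (\<Prod>i<n. d i ^ m' i)" by (simp add: prod_single \<nu>_def)
  have "R * X'.xm f = Poly_Mapping.single \<mu> 1" using R(2) xm by (simp add: mult.commute)
  then obtain e c where e: "R = Poly_Mapping.single e c" by (metis factor_of_monomial zero_neq_one)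
  have "Poly_Mapping.single \<mu> (1::complex) = Poly_Mapping.single (\<nu> + e) ((\<Prod>i<n. d i ^ m' i) * c)"
    using R(2) xm xf e by (simp add: mult_single)
  from arg_cong[OF this, of "\<lambda>q. ?l q \<mu>"] have \<nu>e: "\<mu> = \<nu> + e"
    by (auto simp: lookup_single when_def split: if_splits)
  have lookup_of_nat: "?l (of_nat a * b) j = a * ?l b j" for a j and b :: "nat \<Rightarrow>\<^sub>0 nat"
    by (induction a) (auto simp: lookup_add distrib_right)

  \<comment> \<open>Substituting monomials, some monomial of \<open>g j\<close> must become a
    multiple of x_j. A unit vector is a sum of natural multiples of exponent vectors only if one of
    these is the unit vector itself.\<close>
  have "\<exists>i<n. k i = Poly_Mapping.single j (Suc 0)" if j: "j < n" for j
  proof -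
    have "ev Con (g j) f = Var j"
    proof (rule cpoly_eqI)
      show "ev Con (g j) f \<in> polys n" by (rule ev_Con_in_polys[OF g_polys[OF j] f_polys])
      show "Var j \<in> polys n" by (rule polys_Var[OF j])
      show "ev id (ev Con (g j) f) p = ev id (Var j) p" for p
        using g_f[OF j, of p] unfolding ev_ev[OF rhom_id] evid_simps fp_def[abs_def] .
    qed
    moreover have "ev Con (g j) f = (\<Sum>a\<in>Poly_Mapping.keys (g j).
        Poly_Mapping.single (\<Sum>i\<in>Poly_Mapping.keys a. of_nat (?l a i) * k i)
          (?l (g j) a * (\<Prod>i\<in>Poly_Mapping.keys a. d i ^ ?l a i)))"
      unfolding ev_def
    proof (intro sum.cong refl)
      fix a assume a: "a \<in> Poly_Mapping.keys (g j)"
      have "mon f a = (\<Prod>i\<in>Poly_Mapping.keys a. Poly_Mapping.single (k i) (d i) ^ ?l a i)"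
        unfolding mon_def
      proof (intro prod.cong refl)
        fix i assume "i \<in> Poly_Mapping.keys a"
        then have "i < n" using a g_polys[OF j] by (auto simp: polys_def)
        then show "f i ^ ?l a i = Poly_Mapping.single (k i) (d i) ^ ?l a i" using kd by simp
      qed
      then show "Con (?l (g j) a) * mon f a = Poly_Mapping.single (\<Sum>i\<in>Poly_Mapping.keys a. of_nat (?l a i) * k i)
          (?l (g j) a * (\<Prod>i\<in>Poly_Mapping.keys a. d i ^ ?l a i))"
        by (simp add: prod_single mult_single)
    qed
    ultimately have "?l (\<Sum>a\<in>Poly_Mapping.keys (g j).
        Poly_Mapping.single (\<Sum>i\<in>Poly_Mapping.keys a. of_nat (?l a i) * k i)
          (?l (g j) a * (\<Prod>i\<in>Poly_Mapping.keys a. d i ^ ?l a i))) (Poly_Mapping.single j (Suc 0)) \<noteq> 0"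
      by (simp add: lookup_single)
    then obtain a where a: "a \<in> Poly_Mapping.keys (g j)"
      and "?l (Poly_Mapping.single (\<Sum>i\<in>Poly_Mapping.keys a. of_nat (?l a i) * k i)
          (?l (g j) a * (\<Prod>i\<in>Poly_Mapping.keys a. d i ^ ?l a i))) (Poly_Mapping.single j (Suc 0)) \<noteq> 0"
      unfolding lookup_sum by (rule sum.not_neutral_contains_not_neutral)
    then have sj: "(\<Sum>i\<in>Poly_Mapping.keys a. of_nat (?l a i) * k i) = Poly_Mapping.single j (Suc 0)"
      by (simp only: lookup_single when_def split: if_splits)
    have eq: "(\<Sum>i\<in>Poly_Mapping.keys a. ?l a i * ?l (k i) l) = (if l = j then 1 else 0)" for l
      using arg_cong[OF sj, of "\<lambda>q. ?l q l"]
      by (simp add: lookup_sum lookup_of_nat lookup_single when_def)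
    obtain i where i: "i \<in> Poly_Mapping.keys a" "?l a i * ?l (k i) j \<noteq> 0"
      using sum.not_neutral_contains_not_neutral[of "\<lambda>i. ?l a i * ?l (k i) j" "Poly_Mapping.keys a"] eq[of j] by auto
    have "?l (k i) l = (if l = j then 1 else 0)" for l
    proof -
      have "?l (k i) l \<le> ?l a i * ?l (k i) l" using i by (simp add: in_keys_iff)
      also have "\<dots> \<le> (if l = j then 1 else 0)"
        unfolding eq[of l, symmetric] by (rule member_le_sum) (use i in auto)
      finally show ?thesis using i(2) by (cases "l = j") auto
    qed
    then have "k i = Poly_Mapping.single j (Suc 0)"
      by (intro poly_mapping_eqI) (simp add: lookup_single when_def)
    moreover have "i < n" using a i g_polys[OF j] by (auto simp: polys_def)
    ultimately show ?thesis by blast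
  qed
  then obtain \<tau> where \<tau>: "\<And>j. j < n \<Longrightarrow> \<tau> j < n \<and> k (\<tau> j) = Poly_Mapping.single j (Suc 0)" by metis
  have "inj_on \<tau> {..<n}"
  proof (rule inj_onI)
    fix i j assume ij: "i \<in> {..<n}" "j \<in> {..<n}" "\<tau> i = \<tau> j"
    then have "Poly_Mapping.single i (Suc 0) = Poly_Mapping.single j (Suc 0)" using \<tau> by (metis lessThan_iff)
    from arg_cong[OF this, of "\<lambda>q. ?l q i"] show "i = j"
      by (auto simp: lookup_single when_def split: if_splits)
  qed
  moreover have "m' (\<tau> j) \<le> m j" if j: "j < n" for j
  proof -
    have "m' (\<tau> j) * ?l (k (\<tau> j)) j \<le> (\<Sum>i<n. m' i * ?l (k i) j)"
      by (rule member_le_sum[where f = "\<lambda>i. m' i * ?l (k i) j"]) (use \<tau>[OF j] in auto)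
    also have "\<dots> = ?l \<nu> j" by (simp add: \<nu>_def lookup_sum lookup_of_nat)
    also have "\<dots> \<le> ?l \<mu> j" by (simp add: \<nu>e lookup_add)
    finally show ?thesis using \<tau>[OF j] \<mu>[OF j] by (simp add: lookup_single)
  qed
  ultimately show ?thesis using that \<tau> by blast
qed

text \<open>Injections of a finite index set into itself are permutations. Summing the inequalities
  in both directions gives equal totals, which forces equality in every term.\<close>

lemma same_exponents: "m ` {..<n} = m' ` {..<n}"
proof -
  interpret sw: hypersurface_iso_base n m' m r lam \<Psi> \<Phi> g f by (rule swap_base)
  obtain \<tau> where \<tau>: "inj_on \<tau> {..<n}" "\<tau> ` {..<n} \<subseteq> {..<n}" "\<And>j. j < n \<Longrightarrow> m' (\<tau> j) \<le> m j"
    using exponent_matching by blast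
  obtain \<sigma> where \<sigma>: "inj_on \<sigma> {..<n}" "\<sigma> ` {..<n} \<subseteq> {..<n}" "\<And>j. j < n \<Longrightarrow> m (\<sigma> j) \<le> m' j"
    using sw.exponent_matching by blast
  have \<tau>': "\<tau> ` {..<n} = {..<n}" and \<sigma>': "\<sigma> ` {..<n} = {..<n}"
    using endo_inj_surj[OF _ \<tau>(2,1)] endo_inj_surj[OF _ \<sigma>(2,1)] by auto
  have "(\<Sum>j<n. m' (\<tau> j)) = (\<Sum>j<n. m' j)"
    using sum.reindex[OF \<tau>(1), of m'] by (simp add: \<tau>')
  moreover have "(\<Sum>j<n. m (\<sigma> j)) = (\<Sum>j<n. m j)"
    using sum.reindex[OF \<sigma>(1), of m] by (simp add: \<sigma>')
  moreover have "(\<Sum>j<n. m (\<sigma> j)) \<le> (\<Sum>j<n. m' j)" using \<sigma>(3) by (intro sum_mono) auto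
  ultimately have le: "(\<Sum>j<n. m j) \<le> (\<Sum>j<n. m' (\<tau> j))" by simp
  have "m' (\<tau> j) = m j" if "j < n" for j
  proof (rule ccontr)
    assume "m' (\<tau> j) \<noteq> m j"
    then have "(\<Sum>j<n. m' (\<tau> j)) < (\<Sum>j<n. m j)"
      using \<tau>(3) that by (intro sum_strict_mono_ex1) (auto intro!: bexI[of _ j] simp: le_neq_implies_less)
    then show False using le by simp
  qed
  then have "m ` {..<n} = m' ` (\<tau> ` {..<n})" by (auto simp: image_image)
  then show ?thesis by (simp add: \<tau>')
qed

end

lemma (in hypersurface_iso) equal_exponents: "m ` {..<n} = m' ` {..<n}"
proof -
  interpret sw: hypersurface_iso n m' m r lam \<Psi> \<Phi> by (rule swap)
  obtain g where g: "\<And>i. i < n \<Longrightarrow> g i \<in> polys n \<and> (\<forall>q. X'.onX id q \<longrightarrow> ev id (\<Psi> i) q = ev id (g i) q)"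
    using coordinate_invariant by metis
  obtain f where f: "\<And>i. i < n \<Longrightarrow> f i \<in> polys n \<and> (\<forall>p. X.onX id p \<longrightarrow> ev id (\<Phi> i) p = ev id (f i) p)"
    using sw.coordinate_invariant by metis
  interpret hypersurface_iso_base n m m' r lam \<Phi> \<Psi> f g
    by unfold_locales (use f g in auto)
  show ?thesis by (rule same_exponents)
qed

subsection \<open>Isomorphisms of cylinders\<close>

text \<open>The remainder is kept as a polynomial because it enters the coordinates of maps
  constructed later.\<close>

lemma taylor_2:
  assumes "y \<in> polys K" "e \<in> polys K"
  shows "\<exists>R\<in>polys K. cev Con q (y + e) = cev Con q y + e * cev Con (pderiv q) y + e\<^sup>2 * R"
proof (induction q)
  case 0
  show ?case by (rule bexI[of _ 0]) (auto simp: polys_0)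
next
  case (pCons c q)
  then obtain R where R: "R \<in> polys K"
    "cev Con q (y + e) = cev Con q y + e * cev Con (pderiv q) y + e\<^sup>2 * R" by blast
  have D: "cev Con (pderiv (pCons c q)) y = cev Con q y + y * cev Con (pderiv q) y"
    by (simp add: pderiv_pCons rhom_add[OF rhom_cev[OF rhom_Con]] cev_pCons[OF rhom_Con])
  have "cev Con (pCons c q) (y + e) = cev Con (pCons c q) y + e * cev Con (pderiv (pCons c q)) y
      + e\<^sup>2 * (cev Con (pderiv q) y + y * R + e * R)"
    unfolding D cev_pCons[OF rhom_Con] R(2) by (simp add: algebra_simps power2_eq_square)
  moreover have "cev Con (pderiv q) y + y * R + e * R \<in> polys K"
    by (intro polys_add polys_mult cev_Con_in_polys assms R)
  ultimately show ?case by blast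
qed

lemma taylor_1:
  assumes "y \<in> polys K" "e \<in> polys K"
  shows "\<exists>R\<in>polys K. cev Con q (y + e) = cev Con q y + e * R"
proof -
  obtain R where R: "R \<in> polys K" "cev Con q (y + e) = cev Con q y + e * cev Con (pderiv q) y + e\<^sup>2 * R"
    using taylor_2[OF assms] by blast
  have "cev Con q (y + e) = cev Con q y + e * (cev Con (pderiv q) y + e * R)"
    unfolding R(2) by (simp add: algebra_simps power2_eq_square)
  moreover have "cev Con (pderiv q) y + e * R \<in> polys K"
    by (intro polys_add polys_mult cev_Con_in_polys assms R)
  ultimately show ?thesis by blast
qed

lemma power_add_expand:
  assumes "a \<in> polys K" "b \<in> polys K"
  shows "\<exists>c\<in>polys K. (a + b) ^ N = b ^ N + a * c"
proof (induction N)
  case 0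
  show ?case by (rule bexI[of _ 0]) (auto simp: polys_0)
next
  case (Suc N)
  then obtain c where c: "c \<in> polys K" "(a + b) ^ N = b ^ N + a * c" by blast
  have "(a + b) ^ Suc N = b ^ Suc N + a * (b ^ N + a * c + b * c)"
    unfolding power_Suc c(2) by (simp add: algebra_simps)
  moreover have "b ^ N + a * c + b * c \<in> polys K"
    by (intro polys_add polys_mult polys_power assms c)
  ultimately show ?case by blast
qed

text \<open>
  One step of Newton's method for the roots of \<open>P\<close>, given \<open>A P + B P' = 1\<close>. Modulo \<open>P(y)\<close> it fixes \<open>y\<close>
  and squares the distance to \<open>y\<close>.
\<close>

definition newton :: "complex poly \<Rightarrow> complex poly \<Rightarrow> cpoly \<Rightarrow> cpoly" where
  "newton P B y = y - cev Con B y * cev Con P y"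

definition cnewton :: "complex poly \<Rightarrow> complex poly \<Rightarrow> complex \<Rightarrow> complex" where
  "cnewton P B y = y - poly B y * poly P y"

lemma newton_polys: "y \<in> polys K \<Longrightarrow> newton P B y \<in> polys K"
  unfolding newton_def by (intro polys_diff polys_mult cev_Con_in_polys)

lemma newton_iter_polys: "y \<in> polys K \<Longrightarrow> (newton P B ^^ k) y \<in> polys K"
  by (induction k) (auto intro: newton_polys)

lemma ev_newton_iter: "ev id ((newton P B ^^ k) y) p = (cnewton P B ^^ k) (ev id y p)"
proof (induction k)
  case (Suc k)
  then show ?case
    by (simp only: funpow.simps o_apply newton_def cnewton_def evid_simps ev_cev_Con)
qed simp

context
  fixes P A B :: "complex poly"
  assumes bez: "A * P + B * pderiv P = 1"
begin

lemma cev_bez: "cev Con A y * cev Con P y + cev Con B y * cev Con (pderiv P) y = 1"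
  using arg_cong[OF bez, of "\<lambda>q. cev Con q y"]
  by (simp only: rhom_simps[OF rhom_cev[OF rhom_Con]])

text \<open>By Bezout the derivative of Y - B P is (A - B') P, so the term linear in
  \<open>e\<close> vanishes modulo P(y).\<close>

lemma newton_step:
  assumes y: "y \<in> polys K" and e: "e \<in> polys K"
  shows "\<exists>R\<in>polys K. \<exists>T\<in>polys K. newton P B (y + e) = y + e\<^sup>2 * R + cev Con P y * T"
proof -
  define \<theta> where "\<theta> = [:0, 1:] - B * P"
  have ev: "cev Con \<theta> u = newton P B u" for u
    unfolding \<theta>_def newton_def
    by (simp add: rhom_simps[OF rhom_cev[OF rhom_Con]] cev_pCons[OF rhom_Con] rhom_0[OF rhom_Con])
  have "pderiv \<theta> = 1 - (B * pderiv P + P * pderiv B)"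
    by (simp add: \<theta>_def pderiv_diff pderiv_mult pderiv_pCons one_pCons)
  also have "\<dots> = (A * P + B * pderiv P) - (B * pderiv P + P * pderiv B)" by (simp only: bez)
  finally have d: "pderiv \<theta> = (A - pderiv B) * P" by (simp add: algebra_simps)
  obtain R where R: "R \<in> polys K" "newton P B (y + e) = newton P B y + e * cev Con (pderiv \<theta>) y + e\<^sup>2 * R"
    using taylor_2[OF y e, of \<theta>] unfolding ev by blast
  have "newton P B (y + e) = y + e\<^sup>2 * R + cev Con P y * (e * cev Con (A - pderiv B) y - cev Con B y)"
    unfolding R(2) d rhom_mult[OF rhom_cev[OF rhom_Con]] by (simp add: newton_def algebra_simps)
  moreover have "e * cev Con (A - pderiv B) y - cev Con B y \<in> polys K"
    by (intro polys_diff polys_mult cev_Con_in_polys y e)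
  ultimately show ?thesis using R(1) by blast
qed

lemma newton_iter:
  assumes y: "y \<in> polys K" and e: "e \<in> polys K"
  shows "\<exists>R\<in>polys K. \<exists>T\<in>polys K. (newton P B ^^ k) (y + e) = y + e ^ (2 ^ k) * R + cev Con P y * T"
proof (induction k)
  case 0
  show ?case by (rule bexI[of _ 1], rule bexI[of _ 0]) (auto simp: polys_0 polys_1)
next
  case (Suc k)
  let ?P = "cev Con P y"
  have Pk: "?P \<in> polys K" by (rule cev_Con_in_polys[OF y])
  from Suc obtain R T where RT: "R \<in> polys K" "T \<in> polys K"
    "(newton P B ^^ k) (y + e) = y + (e ^ (2 ^ k) * R + ?P * T)" by (auto simp: add.assoc)
  define e' where "e' = e ^ (2 ^ k) * R + ?P * T"
  have e': "e' \<in> polys K" unfolding e'_def by (intro polys_add polys_mult polys_power RT e Pk)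
  obtain R' T' where RT': "R' \<in> polys K" "T' \<in> polys K" "newton P B (y + e') = y + e'\<^sup>2 * R' + ?P * T'"
    using newton_step[OF y e'] by blast
  have dbl: "e ^ (2 ^ Suc k) = (e ^ (2 ^ k))\<^sup>2" by (simp add: power_mult[symmetric] mult.commute)
  have ring: "y + (d * R + p * T)\<^sup>2 * S + p * U =
      y + d\<^sup>2 * (R\<^sup>2 * S) + p * ((d * R * T + d * R * T + p * T\<^sup>2) * S + U)" for d p S U :: cpoly
    by (simp only: algebra_simps power2_eq_square)
  have "(newton P B ^^ Suc k) (y + e) = newton P B (y + e')"
    using RT(3) by (simp add: e'_def)
  also have "\<dots> = y + e ^ (2 ^ Suc k) * (R\<^sup>2 * R') + ?P * ((e ^ (2 ^ k) * R * T + e ^ (2 ^ k) * R * T + ?P * T\<^sup>2) * R' + T')"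
    unfolding RT'(3) unfolding e'_def dbl by (rule ring)
  finally have eq: "(newton P B ^^ Suc k) (y + e) = \<dots>" .
  have "(e ^ (2 ^ k) * R * T + e ^ (2 ^ k) * R * T + ?P * T\<^sup>2) * R' + T' \<in> polys K"
    by (intro polys_add polys_mult polys_power RT RT' e Pk)
  moreover have "R\<^sup>2 * R' \<in> polys K" by (intro polys_mult polys_power RT RT')
  ultimately show ?case using eq by blast
qed

text \<open>One step squares the value of P: in the Taylor expansion the coefficient 1 - B P' of the
  linear term equals A P.\<close>

lemma newton_iter_root:
  assumes y: "y \<in> polys K"
  shows "\<exists>E\<in>polys K. cev Con P ((newton P B ^^ k) y) = cev Con P y ^ (2 ^ k) * E"
proof (induction k)
  case 0
  show ?case by (rule bexI[of _ 1]) (auto simp: polys_1)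
next
  case (Suc k)
  then obtain E where E: "E \<in> polys K" "cev Con P ((newton P B ^^ k) y) = cev Con P y ^ (2 ^ k) * E" by blast
  define u where "u = (newton P B ^^ k) y"
  have u: "u \<in> polys K" unfolding u_def by (rule newton_iter_polys[OF y])
  have "- (cev Con B u * cev Con P u) \<in> polys K" by (intro polys_uminus polys_mult cev_Con_in_polys u)
  from taylor_2[OF u this, of P] obtain R where R: "R \<in> polys K"
    "cev Con P (u + - (cev Con B u * cev Con P u)) = cev Con P u
      + - (cev Con B u * cev Con P u) * cev Con (pderiv P) u + (- (cev Con B u * cev Con P u))\<^sup>2 * R" by blast
  have "cev Con P (newton P B u) = cev Con P u * (1 - cev Con B u * cev Con (pderiv P) u)
      + (cev Con P u)\<^sup>2 * ((cev Con B u)\<^sup>2 * R)"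
    using R(2) by (simp add: newton_def algebra_simps power2_eq_square)
  also have "1 - cev Con B u * cev Con (pderiv P) u = cev Con A u * cev Con P u"
    using cev_bez[of u] by (simp add: algebra_simps)
  finally have "cev Con P (newton P B u) = (cev Con P u)\<^sup>2 * (cev Con A u + (cev Con B u)\<^sup>2 * R)"
    by (simp add: algebra_simps power2_eq_square)
  also have "\<dots> = cev Con P y ^ (2 ^ Suc k) * (E\<^sup>2 * (cev Con A u + (cev Con B u)\<^sup>2 * R))"
    using E(2) by (simp add: u_def power_mult_distrib power_mult[symmetric] mult.commute mult.assoc)
  finally have "cev Con P ((newton P B ^^ Suc k) y) = \<dots>" by (simp add: u_def)
  moreover have "E\<^sup>2 * (cev Con A u + (cev Con B u)\<^sup>2 * R) \<in> polys K"
    by (intro polys_add polys_mult polys_power E R u cev_Con_in_polys)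
  ultimately show ?case by blast
qed

end

text \<open>\<open>k\<close> is so large that x^m and x^m' each divide the 2^k-th power of the
  other.\<close>

locale hypersurface_pair =
  X: hypersurface n m r lam + X': hypersurface n m' r lam
  for n :: nat and m m' :: "nat \<Rightarrow> nat" and r :: nat and lam :: "nat \<Rightarrow> complex" +
  fixes A B :: "complex poly" and k :: nat
  assumes bez: "A * X.cpol + B * pderiv X.cpol = 1"
    and k: "i < n \<Longrightarrow> m i \<le> 2 ^ k" "i < n \<Longrightarrow> m' i \<le> 2 ^ k"
begin

lemma swap: "hypersurface_pair n m' m r lam A B k"
  by unfold_locales (use bez k in auto)

definition \<theta> :: "complex \<Rightarrow> complex" where
  "\<theta> = (cnewton X.cpol B ^^ k)"

text \<open>The coordinate y' on the fibre product: the section \<theta>(y), translated by the fibre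
  coordinate t (index \<open>n + 2\<close>) times x^m'.\<close>

definition ynew :: cpoly where
  "ynew = (newton X.cpol B ^^ k) (Var n) + X'.xm Var * Var (n + 2)"

lemma ynew_polys: "ynew \<in> polys (n + 3)"
  unfolding ynew_def by (intro polys_add polys_mult newton_iter_polys X'.xm_in_polys polys_Var) simp_all

lemma ev_ynew: "ev id ynew p = \<theta> (p n) + X'.xm p * p (n + 2)"
  unfolding ynew_def \<theta>_def evid_simps ev_newton_iter X'.ev_xm[OF rhom_id] ..

lemma xm_power_factor:
  fixes p :: "nat \<Rightarrow> cpoly"
  assumes "\<And>i. i < n \<Longrightarrow> a i \<le> N * b i"
  shows "(\<Prod>i<n. p i ^ b i) ^ N = (\<Prod>i<n. p i ^ a i) * (\<Prod>i<n. p i ^ (N * b i - a i))"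
  unfolding prod_power_distrib prod.distrib[symmetric]
proof (intro prod.cong refl)
  fix i assume "i \<in> {..<n}"
  then have "a i + (N * b i - a i) = N * b i" using assms[of i] by simp
  then show "(p i ^ b i) ^ N = p i ^ a i * p i ^ (N * b i - a i)"
    by (metis mult.commute power_add power_mult)
qed

text \<open>\<open>Z\<close> becomes z' and \<open>W\<close> the new fibre coordinate. The second
  identity is the formula for \<open>ynew\<close> with the two varieties exchanged, so the same
  construction in the other direction recovers y.\<close>

lemma forward:
  obtains Z W where "Z \<in> polys (n + 3)" "W \<in> polys (n + 3)"
    "\<And>p. X.onX id p \<Longrightarrow> X'.xm p * ev id Z p = X'.pol id (ev id ynew p)"
    "\<And>p. X.onX id p \<Longrightarrow> p n = \<theta> (ev id ynew p) + X.xm p * ev id W p"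
proof -
  let ?K = "n + 3" and ?N = "2 ^ k :: nat" and ?P = "X.cpol"
  let ?y = "Var n" and ?z = "Var (Suc n)" and ?t = "Var (n + 2)"
  let ?M = "X.xm Var" and ?M' = "X'.xm Var"
  let ?T = "newton X.cpol B ^^ k"
  have v: "?y \<in> polys ?K" "?z \<in> polys ?K" "?t \<in> polys ?K" "?M \<in> polys ?K" "?M' \<in> polys ?K"
    by (auto intro!: polys_Var X.xm_in_polys X'.xm_in_polys)
  have Py: "cev Con ?P ?y \<in> polys ?K" by (rule cev_Con_in_polys[OF v(1)])
  have Ty: "?T ?y \<in> polys ?K" by (rule newton_iter_polys[OF v(1)])
  have Mt: "?M' * ?t \<in> polys ?K" by (intro polys_mult v)
  define L where "L = (\<Prod>i<n. Var i ^ (?N * m i - m' i))"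
  define L' where "L' = (\<Prod>i<n. Var i ^ (?N * m' i - m i))"
  have L: "L \<in> polys ?K" "L' \<in> polys ?K"
    unfolding L_def L'_def by (intro polys_prod polys_power polys_Var; simp)+
  have le: "m' i \<le> ?N * m i" "m i \<le> ?N * m' i" if "i < n" for i
    using k(1)[OF that] k(2)[OF that] X.m1[OF that] X'.m1[OF that]
    by (metis One_nat_def le_trans less_imp_le mult.right_neutral mult_le_mono2)+
  have xmN: "?M ^ ?N = ?M' * L" unfolding X.xm_def X'.xm_def L_def by (rule xm_power_factor) (rule le)
  have xmN': "?M' ^ ?N = ?M * L'" unfolding X.xm_def X'.xm_def L'_def by (rule xm_power_factor) (rule le)
  have evP: "ev id (cev Con ?P u) p = X.pol id (ev id u p)" for u p
    unfolding ev_cev_Con X.poly_cpol ..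

  obtain E where E: "E \<in> polys ?K" "cev Con ?P (?T ?y) = cev Con ?P ?y ^ ?N * E"
    using newton_iter_root[OF bez v(1)] by blast
  obtain R1 where R1: "R1 \<in> polys ?K" "cev Con ?P (?T ?y + ?M' * ?t) = cev Con ?P (?T ?y) + ?M' * ?t * R1"
    using taylor_1[OF Ty Mt] by blast
  \<comment> \<open>On X, P(\<theta>(y)) is a multiple of P(y)^N = (x^m z)^N, hence of x^m', with
    cofactor involving \<open>L\<close>. The last summand accounts for the translation by x^m'
    t.\<close>
  define Z where "Z = L * ?z ^ ?N * E + ?t * R1"
  have Z: "Z \<in> polys ?K" unfolding Z_def by (intro polys_add polys_mult polys_power L v E R1)
  have Zeq: "X'.xm p * ev id Z p = X'.pol id (ev id ynew p)" if p: "X.onX id p" for p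
  proof -
    have "X'.pol id (ev id ynew p) = ev id (cev Con ?P ynew) p" unfolding evP ..
    also have "\<dots> = (ev id (cev Con ?P ?y) p) ^ ?N * ev id E p + X'.xm p * p (n + 2) * ev id R1 p"
      unfolding ynew_def R1(2) E(2) evid_simps X'.ev_xm[OF rhom_id] ..
    also have "ev id (cev Con ?P ?y) p = X.xm p * p (Suc n)"
      using p unfolding evP evid_simps X.onX_def by simp
    also have "(X.xm p * p (Suc n)) ^ ?N = X'.xm p * ev id L p * p (Suc n) ^ ?N"
      using arg_cong[OF xmN, of "\<lambda>Q. ev id Q p"]
      unfolding evid_simps X.ev_xm[OF rhom_id] X'.ev_xm[OF rhom_id] power_mult_distrib by simp
    finally have eq: "X'.pol id (ev id ynew p)
        = X'.xm p * ev id L p * p (Suc n) ^ ?N * ev id E p + X'.xm p * p (n + 2) * ev id R1 p" .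
    show ?thesis unfolding eq Z_def evid_simps by (simp only: algebra_simps)
  qed

  \<comment> \<open>Iteration from y itself: as 2^k is positive the error term is zero, so
    \<theta>(y) - y is a multiple of P(y).\<close>
  obtain R0 T0 where 0: "R0 \<in> polys ?K" "T0 \<in> polys ?K" "?T (?y + 0) = ?y + 0 ^ ?N * R0 + cev Con ?P ?y * T0"
    using newton_iter[OF bez v(1) polys_0] by blast
  define e where "e = cev Con ?P ?y * T0 + ?M' * ?t"
  have ynew_e: "ynew = ?y + e" using 0(3) by (simp add: ynew_def e_def)
  have e: "e \<in> polys ?K" unfolding e_def by (intro polys_add polys_mult Py 0 v)
  obtain R S where RS: "R \<in> polys ?K" "S \<in> polys ?K" "?T ynew = ?y + e ^ ?N * R + cev Con ?P ?y * S"
    using newton_iter[OF bez v(1) e, of k] unfolding ynew_e by blast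
  obtain S1 where S1: "S1 \<in> polys ?K" "e ^ ?N = (?M' * ?t) ^ ?N + cev Con ?P ?y * T0 * S1"
    using power_add_expand[OF polys_mult[OF Py 0(2)] Mt, of ?N] unfolding e_def by blast
  \<comment> \<open>Both error terms contain x^m on X: P(y) = x^m z, and (x^m' t)^N = x^m L'
    t^N.\<close>
  define W where "W = - (?z * (T0 * S1 * R + S) + L' * ?t ^ ?N * R)"
  have W: "W \<in> polys ?K"
    unfolding W_def by (intro polys_uminus polys_add polys_mult polys_power L v 0 S1 RS)
  have Weq: "p n = \<theta> (ev id ynew p) + X.xm p * ev id W p" if p: "X.onX id p" for p
  proof -
    have Pp: "ev id (cev Con ?P ?y) p = X.xm p * p (Suc n)"
      using p unfolding evP evid_simps X.onX_def by simp
    have "\<theta> (ev id ynew p) = ev id (?T ynew) p" unfolding \<theta>_def ev_newton_iter ..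
    also have "\<dots> = p n + ((X'.xm p ^ ?N * p (n + 2) ^ ?N) + X.xm p * p (Suc n) * ev id T0 p * ev id S1 p) * ev id R p
        + X.xm p * p (Suc n) * ev id S p"
      unfolding RS(3) S1(2) evid_simps Pp X'.ev_xm[OF rhom_id] power_mult_distrib ..
    also have "X'.xm p ^ ?N = X.xm p * ev id L' p"
      using arg_cong[OF xmN', of "\<lambda>Q. ev id Q p"]
      unfolding evid_simps X.ev_xm[OF rhom_id] X'.ev_xm[OF rhom_id] .
    finally have \<theta>: "\<theta> (ev id ynew p) = p n + (X.xm p * ev id L' p * p (n + 2) ^ ?N
        + X.xm p * p (Suc n) * ev id T0 p * ev id S1 p) * ev id R p + X.xm p * p (Suc n) * ev id S p" .
    have "ev id W p = - (p (Suc n) * (ev id T0 p * ev id S1 p * ev id R p + ev id S p)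
        + ev id L' p * p (n + 2) ^ ?N * ev id R p)"
      unfolding W_def rhom_minus[OF rhom_ev[OF rhom_id]] evid_simps ..
    moreover have "a = a + (x * l * t + x * z * c * s) * d + x * z * b + x * - (z * (c * s * d + b) + l * t * d)"
      for a b c d l s t x z :: complex by (simp add: algebra_simps)
    ultimately show ?thesis unfolding \<theta> by metis
  qed
  show ?thesis using that[OF Z W Zeq Weq] .
qed

text \<open>Where all x_i are nonzero, x^m and x^m' can be cancelled and the maps are visibly
  inverse to each other; density extends this to all points.\<close>

lemma cylinder_maps:
  obtains \<Phi> \<Psi> where "\<And>j. j < n + 3 \<Longrightarrow> \<Phi> j \<in> polys (n + 3)" "\<And>j. j < n + 3 \<Longrightarrow> \<Psi> j \<in> polys (n + 3)"
    "\<And>p. X.onX id p \<Longrightarrow> X'.onX id (\<lambda>j. ev id (\<Phi> j) p)"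
    "\<And>q. X'.onX id q \<Longrightarrow> X.onX id (\<lambda>j. ev id (\<Psi> j) q)"
    "\<And>p j. X.onX id p \<Longrightarrow> j < n + 3 \<Longrightarrow> ev id (\<Psi> j) (\<lambda>j. ev id (\<Phi> j) p) = p j"
    "\<And>q j. X'.onX id q \<Longrightarrow> j < n + 3 \<Longrightarrow> ev id (\<Phi> j) (\<lambda>j. ev id (\<Psi> j) q) = q j"
proof -
  interpret sw: hypersurface_pair n m' m r lam A B k by (rule swap)
  obtain Z W where ZW: "Z \<in> polys (n + 3)" "W \<in> polys (n + 3)"
    "\<And>p. X.onX id p \<Longrightarrow> X'.xm p * ev id Z p = X'.pol id (ev id ynew p)"
    "\<And>p. X.onX id p \<Longrightarrow> p n = \<theta> (ev id ynew p) + X.xm p * ev id W p"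
    using forward by blast
  obtain Z' W' where ZW': "Z' \<in> polys (n + 3)" "W' \<in> polys (n + 3)"
    "\<And>p. X'.onX id p \<Longrightarrow> X.xm p * ev id Z' p = X.pol id (ev id sw.ynew p)"
    "\<And>p. X'.onX id p \<Longrightarrow> p n = \<theta> (ev id sw.ynew p) + X'.xm p * ev id W' p"
    using sw.forward by blast
  define \<Phi> where "\<Phi> j = (if j < n then Var j else if j = n then ynew else if j = Suc n then Z else W)" for j
  define \<Psi> where "\<Psi> j = (if j < n then Var j else if j = n then sw.ynew else if j = Suc n then Z' else W')" for j
  have polys: "\<Phi> j \<in> polys (n + 3)" "\<Psi> j \<in> polys (n + 3)" if "j < n + 3" for j
    unfolding \<Phi>_def \<Psi>_def using that ZW(1,2) ZW'(1,2) ynew_polys sw.ynew_polys by (auto intro: polys_Var)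
  have xm\<Phi>: "X.xm (\<lambda>j. ev id (\<Phi> j) p) = X.xm p" "X'.xm (\<lambda>j. ev id (\<Phi> j) p) = X'.xm p"
    and xm\<Psi>: "X.xm (\<lambda>j. ev id (\<Psi> j) p) = X.xm p" "X'.xm (\<lambda>j. ev id (\<Psi> j) p) = X'.xm p" for p :: "nat \<Rightarrow> complex"
    by (rule X.xm_cong X'.xm_cong; simp add: \<Phi>_def \<Psi>_def evid_simps)+
  have on: "X'.onX id (\<lambda>j. ev id (\<Phi> j) p)" if "X.onX id p" for p
    unfolding X'.onX_def xm\<Phi> using ZW(3)[OF that] by (simp add: \<Phi>_def)
  have on': "X.onX id (\<lambda>j. ev id (\<Psi> j) p)" if "X'.onX id p" for p
    unfolding X.onX_def xm\<Psi> using ZW'(3)[OF that] by (simp add: \<Psi>_def)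
  have inv: "ev id (\<Psi> j) (\<lambda>j. ev id (\<Phi> j) p) = p j" if p: "X.onX id p" and j: "j < n + 3"
    and nz: "\<And>i. i < n \<Longrightarrow> p i \<noteq> 0" for p j
  proof -
    define q where "q = (\<lambda>j. ev id (\<Phi> j) p)"
    have q: "X'.onX id q" unfolding q_def by (rule on[OF p])
    have xq: "X.xm q = X.xm p" "X'.xm q = X'.xm p" unfolding q_def by (rule xm\<Phi>)+
    have xnz: "X.xm p \<noteq> 0" "X'.xm p \<noteq> 0" using X.xm_nonzero[of p, OF nz] X'.xm_nonzero[of p, OF nz] by blast+
    have qn: "q n = ev id ynew p" and qt: "q (n + 2) = ev id W p" by (auto simp: q_def \<Phi>_def)
    have y: "ev id sw.ynew q = p n"
      unfolding sw.ev_ynew xq qn qt using ZW(4)[OF p] by simp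
    have z: "ev id Z' q = p (Suc n)"
      using ZW'(3)[OF q] p xnz unfolding y xq X.onX_def by (metis mult_left_cancel)
    have "q n = \<theta> (p n) + X'.xm p * ev id W' q"
      using ZW'(4)[OF q] unfolding y xq .
    then have t: "ev id W' q = p (n + 2)"
      using xnz unfolding qn ev_ynew by simp
    have "j < n \<or> j = n \<or> j = Suc n \<or> j = n + 2" using j by linarith
    then show ?thesis
      unfolding q_def[symmetric] using y z t by (auto simp: \<Psi>_def evid_simps) (simp add: q_def \<Phi>_def evid_simps)
  qed
  have inv': "ev id (\<Phi> j) (\<lambda>j. ev id (\<Psi> j) p) = p j" if p: "X'.onX id p" and j: "j < n + 3"
    and nz: "\<And>i. i < n \<Longrightarrow> p i \<noteq> 0" for p j
  proof -
    define q where "q = (\<lambda>j. ev id (\<Psi> j) p)"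
    have q: "X.onX id q" unfolding q_def by (rule on'[OF p])
    have xq: "X.xm q = X.xm p" "X'.xm q = X'.xm p" unfolding q_def by (rule xm\<Psi>)+
    have xnz: "X.xm p \<noteq> 0" "X'.xm p \<noteq> 0" using X.xm_nonzero[of p, OF nz] X'.xm_nonzero[of p, OF nz] by blast+
    have qn: "q n = ev id sw.ynew p" and qt: "q (n + 2) = ev id W' p" by (auto simp: q_def \<Psi>_def)
    have y: "ev id ynew q = p n"
      unfolding ev_ynew xq qn qt using ZW'(4)[OF p] by simp
    have z: "ev id Z q = p (Suc n)"
      using ZW(3)[OF q] p xnz unfolding y xq X'.onX_def by (metis mult_left_cancel)
    have "q n = \<theta> (p n) + X.xm p * ev id W q"
      using ZW(4)[OF q] unfolding y xq .
    then have t: "ev id W q = p (n + 2)"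
      using xnz unfolding qn sw.ev_ynew by simp
    have "j < n \<or> j = n \<or> j = Suc n \<or> j = n + 2" using j by linarith
    then show ?thesis
      unfolding q_def[symmetric] using y z t by (auto simp: \<Phi>_def evid_simps) (simp add: q_def \<Psi>_def evid_simps)
  qed
  \<comment> \<open>\<open>X.onX\<close> does not constrain the coordinate \<open>n + 2\<close>, so
    density of the torus part applies to the cylinder unchanged.\<close>
  have INV: "ev id (\<Psi> j) (\<lambda>j. ev id (\<Phi> j) p) = p j" if "X.onX id p" "j < n + 3" for p j
    using X.torus_dense[of "ev Con (\<Psi> j) \<Phi> - Var j" p] inv[OF _ that(2)] that(1)
    unfolding evid_simps ev_ev[OF rhom_id] by simp
  have INV': "ev id (\<Phi> j) (\<lambda>j. ev id (\<Psi> j) p) = p j" if "X'.onX id p" "j < n + 3" for p j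
    using X'.torus_dense[of "ev Con (\<Phi> j) \<Psi> - Var j" p] inv'[OF _ that(2)] that(1)
    unfolding evid_simps ev_ev[OF rhom_id] by simp
  show ?thesis by (rule that[OF polys on on' INV INV'])
qed

end

subsection \<open>Bundle structure and nonsingularity\<close>

lemma affine_space_restrict: "restrict p {..<N} \<in> affine_space N"
  by (simp add: affine_space_def)

lemma affine_space_eqI:
  assumes "p \<in> affine_space N" "q \<in> affine_space N" "\<And>i. i < N \<Longrightarrow> p i = q i"
  shows "p = q"
proof
  fix i show "p i = q i"
    using assms by (cases "i < N") (auto simp: affine_space_def PiE_def extensional_def)
qed

lemma affine_space_cylinder:
  "cylinder N {p \<in> affine_space N. C p} = {p \<in> affine_space (Suc N). C (restrict p {..<N})}"
proof (intro equalityI subsetI)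
  fix p assume "p \<in> cylinder N {p \<in> affine_space N. C p}"
  then obtain q t where q: "p = q(N := t)" "q \<in> affine_space N" "C q"
    by (auto simp: cylinder_def)
  have "restrict p {..<N} = q"
    by (rule affine_space_eqI[of _ N]) (use q in \<open>auto simp: affine_space_restrict\<close>)
  moreover have "p \<in> affine_space (Suc N)"
    using q by (auto simp: affine_space_def PiE_def extensional_def)
  ultimately show "p \<in> {p \<in> affine_space (Suc N). C (restrict p {..<N})}" using q by simp
next
  fix p assume p: "p \<in> {p \<in> affine_space (Suc N). C (restrict p {..<N})}"
  have "p = (restrict p {..<N})(N := p N)"
    by (rule affine_space_eqI[of _ "Suc N"])
      (use p in \<open>auto simp: affine_space_def PiE_def extensional_def less_Suc_eq\<close>)
  then show "p \<in> cylinder N {p \<in> affine_space N. C p}"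
    unfolding cylinder_def using p affine_space_restrict[of p N] by blast
qed

lemma peval_restrict: "P \<in> polys N \<Longrightarrow> N \<le> M \<Longrightarrow> peval P (restrict p {..<M}) = ev id P p"
  unfolding peval_ev by (rule ev_cong) auto

text \<open>Points of affine space are padded with \<open>undefined\<close>, while the algebra works
  with arbitrary functions. Conditions on the first \<open>N\<close> coordinates pass between the
  two by restriction.\<close>

lemma isomorphicI:
  assumes C: "\<And>p q. (\<And>i. i < N \<Longrightarrow> p i = q i) \<Longrightarrow> C p \<Longrightarrow> C q"
    and C': "\<And>p q. (\<And>i. i < N \<Longrightarrow> p i = q i) \<Longrightarrow> C' p \<Longrightarrow> C' q"
    and \<Phi>: "\<And>j. j < N \<Longrightarrow> \<Phi> j \<in> polys N" "\<And>p. C p \<Longrightarrow> C' (\<lambda>j. ev id (\<Phi> j) p)"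
    and \<Psi>: "\<And>j. j < N \<Longrightarrow> \<Psi> j \<in> polys N" "\<And>p. C' p \<Longrightarrow> C (\<lambda>j. ev id (\<Psi> j) p)"
    and inv: "\<And>p j. C p \<Longrightarrow> j < N \<Longrightarrow> ev id (\<Psi> j) (\<lambda>j. ev id (\<Phi> j) p) = p j"
      "\<And>q j. C' q \<Longrightarrow> j < N \<Longrightarrow> ev id (\<Phi> j) (\<lambda>j. ev id (\<Psi> j) q) = q j"
  shows "isomorphic N {p \<in> affine_space N. C p} N {p \<in> affine_space N. C' p}"
proof -
  define \<phi> where "\<phi> p = restrict (\<lambda>j. ev id (\<Phi> j) p) {..<N}" for p
  define \<psi> where "\<psi> p = restrict (\<lambda>j. ev id (\<Psi> j) p) {..<N}" for p
  have "C' (\<phi> p)" if "C p" for p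
    by (rule C'[OF _ \<Phi>(2)[OF that]]) (simp add: \<phi>_def)
  then have 1: "morphism N {p \<in> affine_space N. C p} N {p \<in> affine_space N. C' p} \<phi>"
    unfolding morphism_def using \<Phi>(1)
    by (auto simp: \<phi>_def affine_space_restrict peval_ev intro!: bexI[of _ "\<Phi> _"])
  have "C (\<psi> p)" if "C' p" for p
    by (rule C[OF _ \<Psi>(2)[OF that]]) (simp add: \<psi>_def)
  then have 2: "morphism N {p \<in> affine_space N. C' p} N {p \<in> affine_space N. C p} \<psi>"
    unfolding morphism_def using \<Psi>(1)
    by (auto simp: \<psi>_def affine_space_restrict peval_ev intro!: bexI[of _ "\<Psi> _"])
  have 3: "\<psi> (\<phi> p) = p" if "p \<in> affine_space N" "C p" for p
  proof (rule affine_space_eqI[of _ N])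
    fix i assume i: "i < N"
    have "\<psi> (\<phi> p) i = ev id (\<Psi> i) (\<phi> p)" using i by (simp add: \<psi>_def)
    also have "\<dots> = ev id (\<Psi> i) (\<lambda>j. ev id (\<Phi> j) p)" by (rule ev_cong[OF \<Psi>(1)[OF i]]) (simp add: \<phi>_def)
    finally show "\<psi> (\<phi> p) i = p i" using inv(1)[OF that(2) i] by simp
  qed (use that in \<open>auto simp: \<psi>_def affine_space_restrict\<close>)
  have 4: "\<phi> (\<psi> p) = p" if "p \<in> affine_space N" "C' p" for p
  proof (rule affine_space_eqI[of _ N])
    fix i assume i: "i < N"
    have "\<phi> (\<psi> p) i = ev id (\<Phi> i) (\<psi> p)" using i by (simp add: \<phi>_def)
    also have "\<dots> = ev id (\<Phi> i) (\<lambda>j. ev id (\<Psi> j) p)" by (rule ev_cong[OF \<Phi>(1)[OF i]]) (simp add: \<psi>_def)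
    finally show "\<phi> (\<psi> p) i = p i" using inv(2)[OF that(2) i] by simp
  qed (use that in \<open>auto simp: \<phi>_def affine_space_restrict\<close>)
  show ?thesis unfolding isomorphic_def using 1 2 3 4 by blast
qed

lemma isomorphicE:
  assumes "isomorphic N {p \<in> affine_space N. C p} N {p \<in> affine_space N. C' p}"
    and C: "\<And>p q. (\<And>i. i < N \<Longrightarrow> p i = q i) \<Longrightarrow> C p \<Longrightarrow> C q"
    and C': "\<And>p q. (\<And>i. i < N \<Longrightarrow> p i = q i) \<Longrightarrow> C' p \<Longrightarrow> C' q"
  obtains \<Phi> \<Psi> where "\<And>j. j < N \<Longrightarrow> \<Phi> j \<in> polys N" "\<And>j. j < N \<Longrightarrow> \<Psi> j \<in> polys N"
    "\<And>p. C p \<Longrightarrow> C' (\<lambda>j. ev id (\<Phi> j) p)" "\<And>p. C' p \<Longrightarrow> C (\<lambda>j. ev id (\<Psi> j) p)"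
    "\<And>p j. C p \<Longrightarrow> j < N \<Longrightarrow> ev id (\<Psi> j) (\<lambda>j. ev id (\<Phi> j) p) = p j"
    "\<And>q j. C' q \<Longrightarrow> j < N \<Longrightarrow> ev id (\<Phi> j) (\<lambda>j. ev id (\<Psi> j) q) = q j"
proof -
  let ?X = "{p \<in> affine_space N. C p}" and ?Y = "{p \<in> affine_space N. C' p}"
  obtain \<phi> \<psi> where \<phi>: "\<phi> \<in> ?X \<rightarrow> ?Y" "\<forall>j<N. \<exists>P\<in>polys N. \<forall>p\<in>?X. \<phi> p j = peval P p"
    and \<psi>: "\<psi> \<in> ?Y \<rightarrow> ?X" "\<forall>j<N. \<exists>P\<in>polys N. \<forall>p\<in>?Y. \<psi> p j = peval P p"
    and inv: "\<forall>p\<in>?X. \<psi> (\<phi> p) = p" "\<forall>q\<in>?Y. \<phi> (\<psi> q) = q"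
    using assms(1) unfolding isomorphic_def morphism_def by blast
  obtain \<Phi> where \<Phi>: "\<And>j. j < N \<Longrightarrow> \<Phi> j \<in> polys N \<and> (\<forall>p\<in>?X. \<phi> p j = peval (\<Phi> j) p)"
    using \<phi>(2) by metis
  obtain \<Psi> where \<Psi>: "\<And>j. j < N \<Longrightarrow> \<Psi> j \<in> polys N \<and> (\<forall>p\<in>?Y. \<psi> p j = peval (\<Psi> j) p)"
    using \<psi>(2) by metis
  have inX: "restrict p {..<N} \<in> ?X" if "C p" for p
    using C[OF _ that, of "restrict p {..<N}"] by (simp add: affine_space_restrict)
  have inY: "restrict p {..<N} \<in> ?Y" if "C' p" for p
    using C'[OF _ that, of "restrict p {..<N}"] by (simp add: affine_space_restrict)
  have \<phi>\<Phi>: "\<phi> (restrict p {..<N}) j = ev id (\<Phi> j) p" if "C p" "j < N" for p j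
    using \<Phi>[OF that(2)] inX[OF that(1)] peval_restrict[of "\<Phi> j" N N p] by simp
  have \<psi>\<Psi>: "\<psi> (restrict p {..<N}) j = ev id (\<Psi> j) p" if "C' p" "j < N" for p j
    using \<Psi>[OF that(2)] inY[OF that(1)] peval_restrict[of "\<Psi> j" N N p] by simp
  have on: "C' (\<lambda>j. ev id (\<Phi> j) p)" if "C p" for p
  proof (rule C')
    show "C' (\<phi> (restrict p {..<N}))" using \<phi>(1) inX[OF that] by blast
  qed (rule \<phi>\<Phi>[OF that])
  have on': "C (\<lambda>j. ev id (\<Psi> j) p)" if "C' p" for p
  proof (rule C)
    show "C (\<psi> (restrict p {..<N}))" using \<psi>(1) inY[OF that] by blast
  qed (rule \<psi>\<Psi>[OF that])
  have \<phi>_eq: "restrict (\<lambda>j. ev id (\<Phi> j) p) {..<N} = \<phi> (restrict p {..<N})" if "C p" for p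
    by (rule affine_space_eqI[of _ N]) (use \<phi>(1) inX[OF that] \<phi>\<Phi>[OF that] in \<open>auto simp: affine_space_restrict\<close>)
  have \<psi>_eq: "restrict (\<lambda>j. ev id (\<Psi> j) p) {..<N} = \<psi> (restrict p {..<N})" if "C' p" for p
    by (rule affine_space_eqI[of _ N]) (use \<psi>(1) inY[OF that] \<psi>\<Psi>[OF that] in \<open>auto simp: affine_space_restrict\<close>)
  have "ev id (\<Psi> j) (\<lambda>j. ev id (\<Phi> j) p) = p j" if "C p" "j < N" for p j
    using \<psi>\<Psi>[OF on[OF that(1)] that(2)] inv(1) inX[OF that(1)] that(2) by (simp only: \<phi>_eq[OF that(1)]) simp
  moreover have "ev id (\<Phi> j) (\<lambda>j. ev id (\<Psi> j) p) = p j" if "C' p" "j < N" for p j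
    using \<phi>\<Phi>[OF on'[OF that(1)] that(2)] inv(2) inY[OF that(1)] that(2) by (simp only: \<psi>_eq[OF that(1)]) simp
  ultimately show ?thesis using that[of \<Phi> \<Psi>] \<Phi> \<Psi> on on' by blast
qed

lemma hypersurface_eq:
  "danielewski_hypersurface n m r lam = {p \<in> affine_space (n + 2). hypersurface.onX n m r lam id p}"
  if "hypersurface n m r lam"
proof -
  interpret hypersurface n m r lam by (rule that)
  show ?thesis by (auto simp: danielewski_hypersurface_def onX_def xm_def pol_def)
qed

context hypersurface
begin

section \<open>Closedness and smoothness of the hypersurface\<close>

abbreviation X :: "point set" where
  "X \<equiv> {p \<in> affine_space (n + 2). onX id p}"

lemma X_eqI: "p \<in> X \<Longrightarrow> q \<in> X \<Longrightarrow> (\<And>i. i < n \<Longrightarrow> p i = q i) \<Longrightarrow> p n = q n \<Longrightarrow> p (Suc n) = q (Suc n) \<Longrightarrow> p = q"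
  by (rule affine_space_eqI[of _ "n + 2"]) (auto simp: less_Suc_eq)

lemma restrict_onX: "onX id (restrict p {..<n+2}) \<longleftrightarrow> onX id p"
  by (rule onX_cong) simp

lemma zariski_closed_X: "zariski_closed (n + 2) X"
  unfolding zariski_closed_def
proof (intro exI conjI)
  show "{J} \<subseteq> polys (n + 2)" using J_in_polys by simp
  show "X = {p \<in> affine_space (n + 2). \<forall>f\<in>{J}. peval f p = 0}"
    by (auto simp: peval_ev ev_J[OF rhom_id] onX_def)
qed

lemma pderiv_root_nonzero:
  assumes "pol id y = 0" shows "poly (pderiv cpol) y \<noteq> 0"
proof -
  obtain A B where "A * cpol + B * pderiv cpol = 1" by (rule bezout)
  from arg_cong[OF this, of "\<lambda>q. poly q y"] show ?thesis
    using assms by (auto simp: poly_cpol)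
qed

text \<open>The gradient of the equation has the entries x^m and - P'(y). Where x^m = 0, the value y
  is a simple root of P, so the second entry is nonzero.\<close>

lemma nonsingular_X: "nonsingular_of_dim (n + 2) (n + 1) X"
  unfolding nonsingular_of_dim_def
proof (intro conjI ballI)
  fix p assume p: "p \<in> X"
  have z: "partial_deriv J (Suc n) p = xm p"
  proof -
    have "((\<lambda>t. xm p * t - pol id (p n)) has_field_derivative xm p) (at (p (Suc n)))"
      by (auto intro!: derivative_eq_intros)
    then show ?thesis
      unfolding partial_deriv_def peval_ev ev_J[OF rhom_id]
      by (simp add: DERIV_imp_deriv)
  qed
  have y: "partial_deriv J n p = - poly (pderiv cpol) (p n)"
  proof -
    have "((\<lambda>t. xm p * p (Suc n) - poly cpol t) has_field_derivative - poly (pderiv cpol) (p n)) (at (p n))"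
      by (auto intro!: derivative_eq_intros poly_DERIV)
    then show ?thesis
      unfolding partial_deriv_def peval_ev ev_J[OF rhom_id] poly_cpol[symmetric]
      by (simp add: DERIV_imp_deriv)
  qed
  have nz: "xm p \<noteq> 0 \<or> poly (pderiv cpol) (p n) \<noteq> 0"
    using p pderiv_root_nonzero[of "p n"] by (auto simp: onX_def)
  show "\<exists>f. \<exists>h\<in>polys (n + 2). (\<forall>k<n + 2 - (n + 1). f k \<in> polys (n + 2)) \<and> peval h p \<noteq> 0 \<and>
      {q \<in> X. peval h q \<noteq> 0} = {q \<in> affine_space (n + 2). peval h q \<noteq> 0 \<and> (\<forall>k<n + 2 - (n + 1). peval (f k) q = 0)} \<and>
      (\<forall>c::nat \<Rightarrow> complex. (\<forall>i<n + 2. (\<Sum>k<n + 2 - (n + 1). c k * partial_deriv (f k) i p) = 0) \<longrightarrow>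
        (\<forall>k<n + 2 - (n + 1). c k = 0))"
  proof (rule exI[of _ "\<lambda>_. J"], rule bexI[of _ 1], intro conjI)
    show "{q \<in> X. peval 1 q \<noteq> 0} = {q \<in> affine_space (n + 2). peval 1 q \<noteq> 0 \<and> (\<forall>k<n + 2 - (n + 1). peval J q = 0)}"
      unfolding peval_ev ev_J[OF rhom_id] onX_def by auto
    show "\<forall>c::nat \<Rightarrow> complex. (\<forall>i<n + 2. (\<Sum>k<n + 2 - (n + 1). c k * partial_deriv J i p) = 0) \<longrightarrow>
        (\<forall>k<n + 2 - (n + 1). c k = 0)"
    proof (intro allI impI)
      fix c :: "nat \<Rightarrow> complex" and k
      assume c: "\<forall>i<n + 2. (\<Sum>k<n + 2 - (n + 1). c k * partial_deriv J i p) = 0" and k: "k < n + 2 - (n + 1)"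
      have "c 0 * xm p = 0" using c[rule_format, of "Suc n"] by (simp add: z)
      moreover have "c 0 * poly (pderiv cpol) (p n) = 0" using c[rule_format, of n] by (simp add: y)
      ultimately show "c k = 0" using nz k by auto
    qed
  qed (auto simp: J_in_polys[simplified] peval_ev evid_simps polys_1)
qed simp

end

section \<open>Points of the glued scheme\<close>

lemma Z_chart_eq:
  assumes "i < r" "x \<in> affine_space n"
  shows "Z_chart n r i x = {(j, y). j < r \<and> y = x \<and> (i = j \<or> x \<in> torus n)}"
  using assms by (auto simp: Z_chart_def glue_rel_def)

lemma Z_chart_eq_iff:
  assumes "i < r" "x \<in> affine_space n" "j < r" "y \<in> affine_space n"
  shows "Z_chart n r i x = Z_chart n r j y \<longleftrightarrow> x = y \<and> (i = j \<or> x \<in> torus n)"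
  using assms by (auto simp: Z_chart_eq set_eq_iff)

lemma Z_chart_in_space: "i < r \<Longrightarrow> x \<in> affine_space n \<Longrightarrow> Z_chart n r i x \<in> Z_space n r"
  by (auto simp: Z_chart_def Z_space_def intro: quotientI)

lemma Z_space_E:
  assumes "\<zeta> \<in> Z_space n r"
  obtains i x where "i < r" "x \<in> affine_space n" "\<zeta> = Z_chart n r i x"
  using assms by (auto simp: Z_space_def Z_chart_def elim!: quotientE)

context hypersurface
begin

text \<open>The sheet of a point. Over the torus all charts agree, so 0 is as good as any index;
  elsewhere y is one of the distinct \<open>lam k\<close>.\<close>

definition idx :: "point \<Rightarrow> nat" where
  "idx p = (if xm p \<noteq> 0 then 0 else SOME k. k < r \<and> p n = lam k)"

definition base :: "point \<Rightarrow> point" where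
  "base p = restrict p {..<n}"

definition proj :: "point \<Rightarrow> (nat \<times> point) set" where
  "proj p = Z_chart n r (idx p) (base p)"

lemma base_affine: "base p \<in> affine_space n"
  unfolding base_def by (rule affine_space_restrict)

lemma base_torus: "base p \<in> torus n \<longleftrightarrow> xm p \<noteq> 0"
  using base_affine by (auto simp: torus_def xm_eq_0_iff base_def)

lemma idx_props:
  assumes "onX id p"
  shows "idx p < r" "xm p = 0 \<Longrightarrow> p n = lam (idx p)"
proof -
  have *: "idx p < r \<and> p n = lam (idx p)" if "xm p = 0"
  proof -
    have "pol id (p n) = 0" using assms that by (simp add: onX_def)
    then have "\<exists>k. k < r \<and> p n = lam k" by (auto simp: pol_eq_0_iff)
    then show ?thesis using that someI_ex[of "\<lambda>k. k < r \<and> p n = lam k"] by (simp add: idx_def)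
  qed
  then show "p n = lam (idx p)" if "xm p = 0" using that by blast
  show "idx p < r"
  proof (cases "xm p = 0")
    case False
    then have "idx p = 0" by (simp only: idx_def if_True not_False_eq_True)
    then show ?thesis using r2 by simp
  qed (use * in blast)
qed

lemma proj_eq_chart:
  assumes p: "onX id p" and i: "i < r" and x: "x \<in> affine_space n"
  shows "proj p = Z_chart n r i x \<longleftrightarrow> base p = x \<and> (xm p \<noteq> 0 \<or> p n = lam i)"
proof -
  have "idx p = i \<longleftrightarrow> p n = lam i" if "xm p = 0"
    using idx_props[OF p] that i inj_onD[OF inj, of "idx p" i] by auto
  then show ?thesis
    unfolding proj_def using Z_chart_eq_iff[OF idx_props(1)[OF p] base_affine i x] base_torus[of p] by auto
qed

definition piece :: "nat \<Rightarrow> point set" where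
  "piece i = {p \<in> X. xm p \<noteq> 0 \<or> p n = lam i}"

lemma piece_eq:
  assumes "i < r"
  shows "{p \<in> X. proj p \<in> Z_chart n r i ` affine_space n} = piece i"
  unfolding piece_def using proj_eq_chart[OF _ assms] base_affine by (auto simp: image_iff)

definition cof :: "nat \<Rightarrow> complex \<Rightarrow> complex" where
  "cof i y = (\<Prod>k\<in>{..<r} - {i}. (y - lam k))"

definition pcof :: "nat \<Rightarrow> cpoly" where
  "pcof i = (\<Prod>k\<in>{..<r} - {i}. (Var n - Con (lam k)))"

lemma pcof_polys: "pcof i \<in> polys (n + 2)"
  unfolding pcof_def by (intro polys_prod polys_diff polys_Var polys_Con) simp

lemma peval_pcof: "peval (pcof i) p = cof i (p n)"
  unfolding peval_ev pcof_def cof_def rhom_prod[OF rhom_ev[OF rhom_id]] evid_simps ..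

lemma peval_xm: "peval (xm Var) p = xm p"
  unfolding peval_ev by (rule ev_xm[OF rhom_id])

lemma xm_Var_polys: "N \<ge> n \<Longrightarrow> xm Var \<in> polys N"
  by (intro xm_in_polys polys_Var) simp

lemma onX_cof: "i < r \<Longrightarrow> onX id p \<longleftrightarrow> xm p * p (Suc n) = (p n - lam i) * cof i (p n)"
  by (simp add: onX_def pol_split cof_def)

lemma cof_lam_nonzero: "i < r \<Longrightarrow> cof i (lam i) \<noteq> 0"
  using inj by (auto simp: cof_def inj_on_def)

lemma cof_zero: "k < r \<Longrightarrow> k \<noteq> i \<Longrightarrow> cof i (lam k) = 0"
  by (auto simp: cof_def)

text \<open>On X with x^m = 0 the value y is a root of P, so excluding the other roots by a
  nonvanishing cofactor leaves y = lam i.\<close>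

lemma piece_open:
  assumes i: "i < r"
  shows "zariski_open_in (n + 2) X (piece i)"
  unfolding zariski_open_in_def
proof (intro exI conjI)
  show "{xm Var, pcof i} \<subseteq> polys (n + 2)" using xm_Var_polys pcof_polys by auto
  have "p n = lam i \<longleftrightarrow> cof i (p n) \<noteq> 0" if "onX id p" "xm p = 0" for p
    using idx_props[OF that(1)] that(2) cof_lam_nonzero[OF i] cof_zero[of "idx p" i]
    by (metis (no_types, lifting))
  then show "piece i = {p \<in> X. \<exists>f\<in>{xm Var, pcof i}. peval f p \<noteq> 0}"
    unfolding piece_def by (auto simp: peval_xm peval_pcof)
qed

lemma regular_functionI:
  assumes "P \<in> polys N" "\<And>p. p \<in> U \<Longrightarrow> f p = ev id P p"
  shows "regular_function N U f"
  unfolding regular_function_def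
  by (intro ballI bexI[of _ P] bexI[of _ 1]) (use assms in \<open>auto simp: peval_ev evid_simps polys_1\<close>)

lemma morphism_to_Z_proj: "morphism_to_Z (n + 2) X n r proj"
  unfolding morphism_to_Z_def Let_def
proof (intro conjI allI impI)
  show "proj \<in> X \<rightarrow> Z_space n r"
    unfolding proj_def using idx_props base_affine by (auto intro: Z_chart_in_space)
  fix i assume i: "i < r"
  show "zariski_open_in (n + 2) X {p \<in> X. proj p \<in> Z_chart n r i ` affine_space n}"
    unfolding piece_eq[OF i] by (rule piece_open[OF i])
  show "\<exists>\<xi>. regular_map (n + 2) {p \<in> X. proj p \<in> Z_chart n r i ` affine_space n} n (affine_space n) \<xi> \<and>
      (\<forall>p\<in>{p \<in> X. proj p \<in> Z_chart n r i ` affine_space n}. proj p = Z_chart n r i (\<xi> p))"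
    unfolding piece_eq[OF i]
  proof (intro exI[of _ base] conjI ballI)
    show "regular_map (n + 2) (piece i) n (affine_space n) base"
      unfolding regular_map_def
    proof (intro conjI allI impI)
      show "regular_function (n + 2) (piece i) (\<lambda>p. base p j)" if "j < n" for j
        by (rule regular_functionI[OF polys_Var[of j]]) (use that in \<open>auto simp: base_def evid_simps\<close>)
    qed (auto simp: base_affine)
    show "proj p = Z_chart n r i (base p)" if "p \<in> piece i" for p
      using that proj_eq_chart[OF _ i base_affine, of p p] by (auto simp: piece_def)
  qed
qed

end

section \<open>Local trivialisations and the additive action\<close>

context hypersurface
begin

lemma peval_Var: "peval (Var j) p = p j"
  unfolding peval_ev evid_simps ..

lemma X_eqI_torus:
  assumes p: "p \<in> X" and q: "q \<in> X" and "\<And>i. i < n \<Longrightarrow> p i = q i" "p n = q n" and nz: "xm p \<noteq> 0"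
  shows "p = q"
proof (rule X_eqI[OF p q])
  have "xm q = xm p" by (rule xm_cong) (use assms in auto)
  then have "xm p * p (Suc n) = xm p * q (Suc n)" using assms by (simp add: onX_def)
  then show "p (Suc n) = q (Suc n)" using nz by simp
qed fact+

text \<open>The fibre coordinate of a chart. The two fractions agree where both denominators are
  nonzero, by the equation, and their domains cover the piece; hence the coordinate is
  regular.\<close>

definition tparam :: "nat \<Rightarrow> point \<Rightarrow> complex" where
  "tparam i p = (if xm p \<noteq> 0 then (p n - lam i) / xm p else p (Suc n) / cof i (p n))"

lemma tparam_alt:
  assumes i: "i < r" and p: "p \<in> piece i" and c: "cof i (p n) \<noteq> 0"
  shows "tparam i p = p (Suc n) / cof i (p n)"
proof (cases "xm p = 0")
  case False
  then have "xm p * p (Suc n) = (p n - lam i) * cof i (p n)"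
    using p onX_cof[OF i] by (simp add: piece_def)
  then show ?thesis using False c by (simp add: tparam_def field_simps)
qed (simp add: tparam_def)

lemma cylinder_affine: "cylinder n (affine_space n) = affine_space (Suc n)"
  using affine_space_cylinder[of n "\<lambda>_. True"] by simp

definition triv :: "nat \<Rightarrow> point \<Rightarrow> point" where
  "triv i q = restrict (chart id i q) {..<n+2}"

definition untriv :: "nat \<Rightarrow> point \<Rightarrow> point" where
  "untriv i p = (base p)(n := tparam i p)"

lemma triv_simps:
  "j < n \<Longrightarrow> triv i q j = q j" "triv i q n = lam i + xm q * q n"
  "triv i q (Suc n) = q n * cof i (lam i + xm q * q n)" "xm (triv i q) = xm q"
proof -
  show 1: "j < n \<Longrightarrow> triv i q j = q j" for j by (simp add: triv_def chart_def)
  show "triv i q n = lam i + xm q * q n" by (simp add: triv_def chart_def)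
  show "triv i q (Suc n) = q n * cof i (lam i + xm q * q n)"
    by (simp add: triv_def chart_def cof_def add_diff_eq algebra_simps)
  show "xm (triv i q) = xm q" by (rule xm_cong) (rule 1)
qed

lemma triv_piece:
  assumes "i < r" shows "triv i q \<in> piece i"
proof -
  have "onX id (triv i q)" unfolding triv_def restrict_onX by (rule chart_onX[OF assms])
  moreover have "triv i q \<in> affine_space (n + 2)" unfolding triv_def by (rule affine_space_restrict)
  ultimately show ?thesis by (simp add: piece_def triv_simps)
qed

lemma triv_regular: "i < r \<Longrightarrow> regular_map (Suc n) (affine_space (Suc n)) (n + 2) (piece i) (triv i)"
  unfolding regular_map_def
proof (intro conjI allI impI)
  show "regular_function (Suc n) (affine_space (Suc n)) (\<lambda>p. triv i p j)" if "j < n + 2" for j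
    by (rule regular_functionI[of "chart Con i Var j"])
      (use that chart_in_polys[of j i] ev_chart[OF rhom_id, of i j] in \<open>auto simp: triv_def\<close>)
qed (auto simp: triv_piece)

lemma untriv_regular:
  assumes i: "i < r"
  shows "regular_map (n + 2) (piece i) (Suc n) (affine_space (Suc n)) (untriv i)"
  unfolding regular_map_def
proof (intro conjI allI impI)
  show "untriv i \<in> piece i \<rightarrow> affine_space (Suc n)"
    by (auto simp: untriv_def base_def affine_space_def PiE_def extensional_def)
  fix j assume "j < Suc n"
  then consider "j < n" | "j = n" by linarith
  then show "regular_function (n + 2) (piece i) (\<lambda>p. untriv i p j)"
  proof cases
    case 1
    then show ?thesis
      by (intro regular_functionI[OF polys_Var[of j]]) (auto simp: untriv_def base_def evid_simps)
  next
    case 2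
    show ?thesis
      unfolding regular_function_def
    proof
      fix p assume p: "p \<in> piece i"
      show "\<exists>g\<in>polys (n + 2). \<exists>h\<in>polys (n + 2). peval h p \<noteq> 0 \<and>
          (\<forall>q\<in>piece i. peval h q \<noteq> 0 \<longrightarrow> untriv i q j = peval g q / peval h q)"
      proof (cases "xm p = 0")
        case True
        then have "p n = lam i" using p by (simp add: piece_def)
        show ?thesis
        proof (rule bexI[OF _ polys_Var[of "Suc n"]], rule bexI[OF _ pcof_polys[of i]], intro conjI ballI impI)
          show "peval (pcof i) p \<noteq> 0"
            unfolding peval_pcof \<open>p n = lam i\<close> by (rule cof_lam_nonzero[OF i])
          show "untriv i q j = peval (Var (Suc n)) q / peval (pcof i) q"
            if "q \<in> piece i" "peval (pcof i) q \<noteq> 0" for q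
            using tparam_alt[OF i that(1)] that(2) unfolding peval_pcof peval_Var
            by (simp add: 2 untriv_def)
        qed simp
      next
        case False
        have "Var n - Con (lam i) \<in> polys (n + 2)" by (intro polys_diff polys_Var polys_Con) simp
        moreover have "xm Var \<in> polys (n + 2)" by (rule xm_Var_polys) simp
        moreover have "untriv i q j = peval (Var n - Con (lam i)) q / peval (xm Var) q"
          if "peval (xm Var) q \<noteq> 0" for q
          using that unfolding peval_xm peval_ev[of "Var n - Con (lam i)"] evid_simps
          by (simp add: 2 untriv_def tparam_def)
        moreover have "peval (xm Var) p \<noteq> 0" using False by (simp add: peval_xm)
        ultimately show ?thesis by blast
      qed
    qed
  qed
qed

lemma untriv_triv:
  assumes i: "i < r" and q: "q \<in> affine_space (Suc n)"
  shows "untriv i (triv i q) = q"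
proof (rule affine_space_eqI[of _ "Suc n"])
  show "untriv i (triv i q) \<in> affine_space (Suc n)"
    using untriv_regular[OF i] triv_piece[OF i] by (auto simp: regular_map_def)
  fix j assume "j < Suc n"
  then consider "j < n" | "j = n" by linarith
  then show "untriv i (triv i q) j = q j"
  proof cases
    case 1
    then show ?thesis by (simp add: untriv_def base_def triv_simps)
  next
    case 2
    then show ?thesis
      using cof_lam_nonzero[OF i] by (auto simp: untriv_def tparam_def triv_simps)
  qed
qed fact

lemma triv_untriv:
  assumes i: "i < r" and p: "p \<in> piece i"
  shows "triv i (untriv i p) = p"
proof -
  have pX: "p \<in> X" and tX: "triv i (untriv i p) \<in> X"
    using p triv_piece[OF i] by (auto simp: piece_def)
  have x: "xm (untriv i p) = xm p" by (rule xm_cong) (simp add: untriv_def base_def)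
  have c: "triv i (untriv i p) j = p j" if "j < n" for j
    using that by (simp add: triv_simps untriv_def base_def)
  have t: "untriv i p n = tparam i p" by (simp add: untriv_def)
  show ?thesis
  proof (cases "xm p = 0")
    case True
    then have pn: "p n = lam i" using p by (simp add: piece_def)
    show ?thesis
      by (rule X_eqI[OF tX pX c])
        (use True pn cof_lam_nonzero[OF i] in \<open>auto simp: triv_simps x t tparam_def\<close>)
  next
    case False
    then have "triv i (untriv i p) n = p n" by (simp add: triv_simps x t tparam_def)
    then show ?thesis
      by (intro X_eqI_torus[OF tX pX c]) (use False in \<open>auto simp: triv_simps x\<close>)
  qed
qed

text \<open>The flow of the locally nilpotent derivation that kills x and sends y to x^m and z to
  P'(y); the Taylor remainder of P supplies the terms of higher order in t. The motion of z is
  recorded only where x^m = 0, since the equation determines z elsewhere.\<close>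

lemma action_exists:
  obtains a where "morphism (n + 3) (cylinder (n + 2) X) (n + 2) X a"
    "\<And>p t j. p \<in> X \<Longrightarrow> j < n \<Longrightarrow> a (p(n + 2 := t)) j = p j"
    "\<And>p t. p \<in> X \<Longrightarrow> a (p(n + 2 := t)) n = p n + xm p * t"
    "\<And>p t. p \<in> X \<Longrightarrow> xm p = 0 \<Longrightarrow> a (p(n + 2 := t)) (Suc n) = p (Suc n) + t * poly (pderiv cpol) (p n)"
proof -
  let ?y = "Var n" and ?t = "Var (n + 2)" and ?D = "cev Con (pderiv cpol) (Var n)"
  have v: "?y \<in> polys (n + 3)" "?t \<in> polys (n + 3)" "Var (Suc n) \<in> polys (n + 3)" "xm Var \<in> polys (n + 3)"
    by (auto intro!: polys_Var xm_Var_polys)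
  have e: "xm Var * ?t \<in> polys (n + 3)" by (intro polys_mult v)
  obtain R where R: "R \<in> polys (n + 3)"
    "cev Con cpol (?y + xm Var * ?t) = cev Con cpol ?y + xm Var * ?t * ?D + (xm Var * ?t)\<^sup>2 * R"
    using taylor_2[OF v(1) e] by blast
  define act where "act j = (if j < n then Var j else if j = n then ?y + xm Var * ?t
      else Var (Suc n) + ?t * ?D + ?t\<^sup>2 * xm Var * R)" for j
  have act_polys: "act j \<in> polys (n + 3)" for j
  proof -
    have "?y + xm Var * ?t \<in> polys (n + 3)" "Var (Suc n) + ?t * ?D + ?t\<^sup>2 * xm Var * R \<in> polys (n + 3)"
      by (intro polys_add polys_mult polys_power v R cev_Con_in_polys)+
    then show ?thesis unfolding act_def by (auto intro: polys_Var)
  qed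
  define a where "a q = restrict (\<lambda>j. ev id (act j) q) {..<n+2}" for q
  have a_simps: "a q n = q n + xm q * q (n + 2)"
    "a q (Suc n) = q (Suc n) + q (n + 2) * poly (pderiv cpol) (q n) + (q (n + 2))\<^sup>2 * xm q * ev id R q"
    "j < n \<Longrightarrow> a q j = q j" for q j
  proof -
    have "a q n = ev id (?y + xm Var * ?t) q" by (simp add: a_def act_def)
    then show "a q n = q n + xm q * q (n + 2)" unfolding evid_simps ev_xm[OF rhom_id] .
    have "a q (Suc n) = ev id (Var (Suc n) + ?t * ?D + ?t\<^sup>2 * xm Var * R) q" by (simp add: a_def act_def)
    then show "a q (Suc n) = q (Suc n) + q (n + 2) * poly (pderiv cpol) (q n) + (q (n + 2))\<^sup>2 * xm q * ev id R q"
      unfolding evid_simps ev_xm[OF rhom_id] ev_cev_Con .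
    show "a q j = q j" if "j < n" using that by (simp add: a_def act_def evid_simps)
  qed
  have a_xm: "xm (a q) = xm q" for q by (rule xm_cong) (rule a_simps)
  have a_on: "onX id (a q)" if "onX id q" for q
  proof -
    have "pol id (q n + xm q * q (n + 2)) = pol id (q n) + xm q * q (n + 2) * poly (pderiv cpol) (q n)
        + (xm q * q (n + 2))\<^sup>2 * ev id R q"
      using arg_cong[OF R(2), of "\<lambda>Q. ev id Q q"]
      unfolding evid_simps ev_xm[OF rhom_id] ev_cev_Con poly_cpol .
    moreover have "x * (z + t * d + t\<^sup>2 * x * c) = x * z + x * t * d + (x * t)\<^sup>2 * c" for x z t d c :: complex
      by (simp add: algebra_simps power2_eq_square)
    ultimately show ?thesis
      using that unfolding onX_def a_xm a_simps by simp
  qed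
  have cyl: "q \<in> cylinder (n + 2) X \<Longrightarrow> onX id q" for q
    using affine_space_cylinder[of "n + 2" "onX id"] restrict_onX by auto
  have upd: "xm (p(n + 2 := t)) = xm p" for p :: point and t by simp
  show ?thesis
  proof (rule that[of a])
    show "morphism (n + 3) (cylinder (n + 2) X) (n + 2) X a"
      unfolding morphism_def
    proof (intro conjI allI impI)
      show "a \<in> cylinder (n + 2) X \<rightarrow> X"
        using cyl a_on affine_space_restrict[of _ "n + 2"] by (auto simp: a_def)
      show "\<exists>P\<in>polys (n + 3). \<forall>p\<in>cylinder (n + 2) X. a p j = peval P p" if "j < n + 2" for j
        by (rule bexI[OF _ act_polys[of j]]) (use that in \<open>simp add: a_def peval_ev\<close>)
    qed
  qed (use upd in \<open>simp_all only: a_simps upd\<close>, auto)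
qed

text \<open>The bundle is trivial over each whole chart of Z, so every neighbourhood
  \<open>V\<close> is taken to be all of affine space.\<close>

lemma bundle_X: "principal_additive_bundle (n + 2) X n r"
proof -
  obtain a where a: "morphism (n + 3) (cylinder (n + 2) X) (n + 2) X a"
    "\<And>p t j. p \<in> X \<Longrightarrow> j < n \<Longrightarrow> a (p(n + 2 := t)) j = p j"
    "\<And>p t. p \<in> X \<Longrightarrow> a (p(n + 2 := t)) n = p n + xm p * t"
    "\<And>p t. p \<in> X \<Longrightarrow> xm p = 0 \<Longrightarrow> a (p(n + 2 := t)) (Suc n) = p (Suc n) + t * poly (pderiv cpol) (p n)"
    using action_exists by blast
  define \<alpha> where "\<alpha> t p = a (p(n + 2 := t))" for t p
  have \<alpha>X: "\<alpha> t p \<in> X" if "p \<in> X" for t p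
    using a(1) that unfolding morphism_def \<alpha>_def cylinder_def by blast
  have \<alpha>c: "\<alpha> t p j = p j" if "p \<in> X" "j < n" for t p j unfolding \<alpha>_def by (rule a(2)[OF that])
  have \<alpha>n: "\<alpha> t p n = p n + xm p * t" if "p \<in> X" for t p unfolding \<alpha>_def by (rule a(3)[OF that])
  have \<alpha>z: "\<alpha> t p (Suc n) = p (Suc n) + t * poly (pderiv cpol) (p n)" if "p \<in> X" "xm p = 0" for t p
    unfolding \<alpha>_def by (rule a(4)[OF that])
  have \<alpha>x: "xm (\<alpha> t p) = xm p" if "p \<in> X" for t p by (rule xm_cong) (rule \<alpha>c[OF that])
  have eqI: "p = q" if "p \<in> X" "q \<in> X" "\<And>i. i < n \<Longrightarrow> p i = q i" "p n = q n"
    "xm p = 0 \<Longrightarrow> p (Suc n) = q (Suc n)" for p q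
    using X_eqI[of p q] X_eqI_torus[of p q] that by blast
  have add: "\<alpha> (s + t) p = \<alpha> s (\<alpha> t p)" if p: "p \<in> X" for s t p
    by (rule eqI) (use p \<alpha>X[OF p] \<alpha>X[OF \<alpha>X[OF p]] in
      \<open>auto simp: \<alpha>c \<alpha>n \<alpha>z \<alpha>x algebra_simps\<close>)
  have zero: "\<alpha> 0 p = p" if p: "p \<in> X" for p
    by (rule eqI) (use p \<alpha>X[OF p] in \<open>auto simp: \<alpha>c \<alpha>n \<alpha>z \<alpha>x\<close>)
  have action: "additive_action (n + 2) X \<alpha>"
    unfolding additive_action_def using a(1) add zero by (auto simp: \<alpha>_def eval_nat_numeral)
  have proj_\<alpha>: "proj (\<alpha> t p) = proj p" if p: "p \<in> X" for t p
  proof -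
    have on: "onX id p" "onX id (\<alpha> t p)" using p \<alpha>X[OF p] by auto
    have b: "base (\<alpha> t p) = base p"
      unfolding base_def by (rule restrict_ext) (use \<alpha>c[OF p] in auto)
    have "proj (\<alpha> t p) = Z_chart n r (idx p) (base p)"
      unfolding proj_eq_chart[OF on(2) idx_props(1)[OF on(1)] base_affine] b
      using idx_props(2)[OF on(1)] by (auto simp: \<alpha>x[OF p] \<alpha>n[OF p])
    then show ?thesis by (simp add: proj_def)
  qed
  show ?thesis
    unfolding principal_additive_bundle_def
  proof (intro exI[of _ proj] exI[of _ \<alpha>] conjI ballI allI)
    fix \<zeta> assume "\<zeta> \<in> Z_space n r"
    then obtain i x where ix: "i < r" "x \<in> affine_space n" "\<zeta> = Z_chart n r i x" by (rule Z_space_E)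
    have chart_proj: "proj (triv i (x(n := t))) = Z_chart n r i x" if x: "x \<in> affine_space n" for x t
    proof -
      have "base (triv i (x(n := t))) = x"
        by (rule affine_space_eqI[OF base_affine x]) (simp add: base_def triv_simps)
      then show ?thesis
        using proj_eq_chart[OF _ ix(1) x, of "triv i (x(n := t))"] triv_piece[OF ix(1), of "x(n := t)"]
        by (auto simp: piece_def)
    qed
    have equiv: "triv i (x(n := s + t)) = \<alpha> s (triv i (x(n := t)))" for x s t
    proof -
      have tX: "triv i q \<in> X" for q using triv_piece[OF ix(1)] by (auto simp: piece_def)
      \<comment> \<open>Over x^m = 0 the action moves z with speed P'(lam i) and the trivialisation
        with speed \<open>cof i (lam i)\<close>; equivariance needs the two to agree.\<close>
      have d: "poly (pderiv cpol) (lam i) = cof i (lam i)"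
      proof -
        have "poly (pderiv cpol) (lam i) = (\<Sum>j<r. if j = i then cof i (lam i) else 0)"
          unfolding pderiv_cpol poly_sum poly_prod cof_def
          by (intro sum.cong refl) (use ix(1) in auto)
        then show ?thesis using ix(1) by simp
      qed
      show ?thesis
        by (rule eqI[OF tX \<alpha>X[OF tX]]) (auto simp: \<alpha>c[OF tX] \<alpha>n[OF tX] \<alpha>z[OF tX] triv_simps d algebra_simps)
    qed
    show "\<exists>i<r. \<exists>V. zariski_open_in n (affine_space n) V \<and> \<zeta> \<in> Z_chart n r i ` V \<and>
        (let U = {p \<in> X. proj p \<in> Z_chart n r i ` V} in
          \<exists>\<Phi> \<Psi>. regular_map (Suc n) (cylinder n V) (n + 2) U \<Phi> \<and>
            regular_map (n + 2) U (Suc n) (cylinder n V) \<Psi> \<and>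
            (\<forall>q\<in>cylinder n V. \<Psi> (\<Phi> q) = q) \<and> (\<forall>p\<in>U. \<Phi> (\<Psi> p) = p) \<and>
            (\<forall>x\<in>V. \<forall>s t. proj (\<Phi> (x(n := t))) = Z_chart n r i x \<and>
              \<Phi> (x(n := s + t)) = \<alpha> s (\<Phi> (x(n := t)))))"
      unfolding Let_def
    proof (rule exI[of _ i], intro conjI ix(1), rule exI[of _ "affine_space n"], intro conjI)
      show "zariski_open_in n (affine_space n) (affine_space n)"
        unfolding zariski_open_in_def
        by (rule exI[of _ "{1}"]) (auto simp: polys_1 peval_ev evid_simps)
      show "\<zeta> \<in> Z_chart n r i ` affine_space n" using ix by simp
    qed (unfold cylinder_affine piece_eq[OF ix(1)], rule exI[of _ "triv i"], rule exI[of _ "untriv i"],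
        intro conjI ballI allI triv_regular untriv_regular untriv_triv triv_untriv chart_proj equiv ix(1))
  qed (use morphism_to_Z_proj action proj_\<alpha> in auto)
qed

lemma danielewski_variety_X: "danielewski_variety (n + 2) X"
  unfolding danielewski_variety_def
  using zariski_closed_X nonsingular_X bundle_X n1 r2
  by (intro conjI exI[of _ "n + 1"] exI[of _ n] exI[of _ r]) auto

lemma cylinder_X: "cylinder (n + 2) X = {p \<in> affine_space (n + 3). onX id p}"
  using affine_space_cylinder[of "n + 2" "onX id"] by (simp add: restrict_onX[simplified] eval_nat_numeral)

end

theorem mainTheorem2:
  fixes n r :: nat and m m' :: "nat \<Rightarrow> nat" and lam :: "nat \<Rightarrow> complex"
  assumes "n \<ge> 1" and "r \<ge> 2"
    and "\<forall>i<n. m i > 1" and "\<forall>i<n. m' i > 1"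
    and "m ` {..<n} \<noteq> m' ` {..<n}"
    and "inj_on lam {..<r}"
  shows "danielewski_variety (n + 2) (danielewski_hypersurface n m r lam) \<and>
    danielewski_variety (n + 2) (danielewski_hypersurface n m' r lam) \<and>
    \<not> isomorphic (n + 2) (danielewski_hypersurface n m r lam)
                 (n + 2) (danielewski_hypersurface n m' r lam) \<and>
    isomorphic (n + 3) (cylinder (n + 2) (danielewski_hypersurface n m r lam))
               (n + 3) (cylinder (n + 2) (danielewski_hypersurface n m' r lam))"
proof -
  interpret X: hypersurface n m r lam by unfold_locales (use assms in auto)
  interpret X': hypersurface n m' r lam by unfold_locales (use assms in auto)
  have eq: "danielewski_hypersurface n m r lam = X.X" "danielewski_hypersurface n m' r lam = X'.X"
    by (rule hypersurface_eq, unfold_locales)+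
  have cong: "X.onX id p \<Longrightarrow> X.onX id q" "X'.onX id p \<Longrightarrow> X'.onX id q"
    if "\<And>i. i < N \<Longrightarrow> p i = q i" "n + 2 \<le> N" for p q :: point and N
    using X.onX_cong[of p q] X'.onX_cong[of p q] that by auto
  have "\<not> isomorphic (n + 2) X.X (n + 2) X'.X"
  proof
    assume "isomorphic (n + 2) X.X (n + 2) X'.X"
    then obtain \<Phi> \<Psi> where "\<And>j. j < n + 2 \<Longrightarrow> \<Phi> j \<in> polys (n + 2)" "\<And>j. j < n + 2 \<Longrightarrow> \<Psi> j \<in> polys (n + 2)"
      "\<And>p. X.onX id p \<Longrightarrow> X'.onX id (\<lambda>j. ev id (\<Phi> j) p)" "\<And>p. X'.onX id p \<Longrightarrow> X.onX id (\<lambda>j. ev id (\<Psi> j) p)"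
      "\<And>p j. X.onX id p \<Longrightarrow> j < n + 2 \<Longrightarrow> ev id (\<Psi> j) (\<lambda>j. ev id (\<Phi> j) p) = p j"
      "\<And>q j. X'.onX id q \<Longrightarrow> j < n + 2 \<Longrightarrow> ev id (\<Phi> j) (\<lambda>j. ev id (\<Psi> j) q) = q j"
      by (rule isomorphicE) (auto dest: cong[rotated -1, OF _ _ order_refl])
    then interpret hypersurface_iso n m m' r lam \<Phi> \<Psi>
      by unfold_locales
    show False using equal_exponents assms(5) by simp
  qed
  moreover have "isomorphic (n + 3) (cylinder (n + 2) X.X) (n + 3) (cylinder (n + 2) X'.X)"
  proof -
    define k where "k = (\<Sum>i<n. m i) + (\<Sum>i<n. m' i)"
    have "m i \<le> k" "m' i \<le> k" if "i < n" for i
      using that member_le_sum[of i "{..<n}" m] member_le_sum[of i "{..<n}" m'] by (auto simp: k_def)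
    moreover have "k \<le> 2 ^ k" using less_exp[of k] by simp
    ultimately have k: "m i \<le> 2 ^ k" "m' i \<le> 2 ^ k" if "i < n" for i
      using that le_trans by blast+
    obtain A B where bez: "A * X.cpol + B * pderiv X.cpol = 1" by (rule X.bezout)
    interpret hypersurface_pair n m m' r lam A B k
      by unfold_locales (use bez k in auto)
    obtain \<Phi> \<Psi> where maps: "\<And>j. j < n + 3 \<Longrightarrow> \<Phi> j \<in> polys (n + 3)" "\<And>j. j < n + 3 \<Longrightarrow> \<Psi> j \<in> polys (n + 3)"
      "\<And>p. X.onX id p \<Longrightarrow> X'.onX id (\<lambda>j. ev id (\<Phi> j) p)"
      "\<And>q. X'.onX id q \<Longrightarrow> X.onX id (\<lambda>j. ev id (\<Psi> j) q)"
      "\<And>p j. X.onX id p \<Longrightarrow> j < n + 3 \<Longrightarrow> ev id (\<Psi> j) (\<lambda>j. ev id (\<Phi> j) p) = p j"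
      "\<And>q j. X'.onX id q \<Longrightarrow> j < n + 3 \<Longrightarrow> ev id (\<Phi> j) (\<lambda>j. ev id (\<Psi> j) q) = q j"
      using cylinder_maps by blast
    have le: "n + 2 \<le> n + 3" by simp
    show ?thesis
      unfolding X.cylinder_X X'.cylinder_X
    proof (rule isomorphicI[where \<Phi> = \<Phi> and \<Psi> = \<Psi>])
      show "X.onX id q" if "\<And>i. i < n + 3 \<Longrightarrow> p i = q i" "X.onX id p" for p q
        by (rule cong(1)[OF _ le that(2)]) (rule that(1))
      show "X'.onX id q" if "\<And>i. i < n + 3 \<Longrightarrow> p i = q i" "X'.onX id p" for p q
        by (rule cong(2)[OF _ le that(2)]) (rule that(1))
    qed (fact maps)+
  qed
  ultimately show ?thesis
    unfolding eq using X.danielewski_variety_X X'.danielewski_variety_X by blast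
qed

end
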